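(* Let $\mathcal{F}:\mathcal{R}\to\mathbf{Top}^*$ be a resonance functor such that $\mathcal{F}(1^l)$ is contractible for $l\ge2$. Let $a,k,l$ be positive integers with $a\ge2$, and let $l=am+\epsilon$, where $0\le\epsilon\le a-1$. (a) If $k\ne1$ or $\epsilon\ge2$, then $\mathcal{F}(a^k,1^l)$ is contractible. (b) If $k=1$ and $\epsilon\in\{0,1\}$, then $\mathcal{F}(a^k,1^l)\simeq\mathrm{susp}^m(\mathcal{F}(1)^{m+\epsilon+1})$, where $\mathcal{F}(1)^{m+\epsilon+1}$ denotes the $(m+\epsilon+1)$-fold smash product.
   Context: Cuts. For $A\subseteq\{-1,0,1\}^n$ let $\mathrm{span}(A)$ denote the intersection of $\{-1,0,1\}^n$ with the linear span of $A$ in $\mathbb{R}^n$. An $n$-cut is a subset $S\subseteq\{-1,0,1\}^n$ with $\mathrm{span}(S)=S$ such that every nonzero $x\in S$ has at least one coordinate equal to $1$ and at least one equal to $-1$. $\mathcal{R}_n$ is the set of $n$-cuts. For $x\in\{-1,0,1\}^n$, $\mathrm{Plus}(x)=\{i:x_i=1\}$, $\mathrm{Minus}(x)=\{i:x_i=-1\}$. $\mathcal{S}_n$ acts on $\mathcal{R}_n$ by permuting coordinates; the orbits are the $n$-resonances. Partitions. $P(A)$ (resp. $OP(A)$) is the set of unordered (resp. ordered) set partitions of $A$; $P(n)=P([n])$, $OP(n)=OP([n])$; $\mathrm{un}:OP(n)\to P(n)$ forgets the order. For an ordered set partition $\pi=(\pi_1,\dots,\pi_k)$ of $[m]$ and $\nu=(\nu_1,\dots,\nu_m)$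 of $[n]$, $\pi\circ\nu=(\mu_1,\dots,\mu_k)$ with $\mu_i=\bigcup_{j\in\pi_i}\nu_j$. For $S\in\mathcal{R}_n$ and $\pi=(\pi_1,\dots,\pi_m)\in OP(n)$, $\pi S\in\mathcal{R}_m$ is the set of $(t_1,\dots,t_m)\in\{-1,0,1\}^m$ such that the vector $s$ with $s_i=t_j$ for $i\in\pi_j$ lies in $S$. For $\pi\in P(n)$, $S^\pi$ is the set of $s\in S$ such that whenever $i\ne j$ lie in the same block of $\pi$, $s_i=s_j\ne0$. Resonance category $\mathcal{R}$: objects are all $n$-cuts, $n\ge1$; morphisms $S\to T$ ($S\in\mathcal{R}_m$, $T\in\mathcal{R}_n$) are triples $(S,T,\pi)$ with $\pi$ an ordered set partition of $[n]$ into $m$ blocks such that $S\subseteq\pi T$; the composite of $(S,T,\pi):S\to T$ and $(T,Q,\nu):T\to Q$ is $(S,Q,\pi\circ\nu)$. The morphism $(\pi T,T,\pi)$ is written $\pi T\stackrel{\pi}{\hookrightarrow}T$. Relative cuts. Let $A(n)$ be the set of collections of nonempty multisubsets of $[n]$. For $S\in\mathcal{R}_n$ and $\mathcal{A}\in A(n)$, $\mathcal{A}\Downarrow S\subseteq A(n)$ is the smallest set with: (1) $\mathcal{A}\in\mathcal{A}\Downarrow S$; (2) if $\{B_1,B_2,\dots,B_m\}\in\mathcal{A}\Downarrow S$ then $\{B_1\cup B_2,B_3,\dots,B_m\}\in\mathcal{A}\Downarrow S$; (3) if $\{B_1,\dots,B_m\}\in\mathcal{A}\Downarrow S$ and there is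 $x\in S$ with $\mathrm{Plus}(x)\subseteq B_1$ then $\{(B_1\setminus\mathrm{Plus}(x))\cup\mathrm{Minus}(x),B_2,\dots,B_m\}\in\mathcal{A}\Downarrow S$ (multiset operations). For $\pi\in P(n)$, $\pi\downarrow S=(\pi\Downarrow S)\cap P(n)$; for $\Pi\subseteq P(n)$, $\Pi\downarrow S=\bigcup_{\pi\in\Pi}\pi\downarrow S$, and $\Pi$ is $S$-closed if $\Pi\downarrow S=\Pi$. For $S$-closed $\Pi$ put $S\setminus\Pi=S\setminus\bigcup_{\pi\in\Pi}S^\pi$. A relative $n$-cut is a pair $(S,\Pi)$, $S\subseteq\{-1,0,1\}^n$, $\Pi\subseteq P(n)$, with $\Pi$ $(\mathrm{span}\,S)$-closed and $(\mathrm{span}\,S)\setminus\Pi=S$. $\mathcal{S}_n$ acts on relative $n$-cuts by $(S,\Pi)\mapsto(\sigma S,\Pi\sigma^{-1})$; the orbit of $(S,\Pi)$ is $[S,\Pi]$. For $S\in\mathcal{R}_n$ and $S$-closed $\Pi$, $Q(S,\Pi)=(S\setminus\Pi,\Pi)$; thus $(S,\Pi)=Q(\mathrm{span}\,S,\Pi)$. For a relative $n$-cut $(S,\Pi)$ and a relative $m$-cut $(T,\Lambda)$, $(S,\Pi)\times(T,\Lambda)=(S\times T,(\Pi\times P(m))\cup(P(n)\times\Lambda))$, where (identifying $[m]$ with $\{n+1,\dots,n+m\}$) $\Pi'\times\Lambda'$ is the set of partitions of $[n+m]$ whose restriction to $[n]$ is in $\Pi'$ and to $\{n+1,\dots,n+m\}$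 is in $\Lambda'$. Resonance functor: for a functor $\mathcal{F}:\mathcal{R}\to\mathbf{Top}^*$ (pointed topological spaces) put $\mathcal{F}(Q(S,\Pi))=\mathcal{F}(S)/\bigcup_{\mathrm{un}(\pi)\in\Pi}\mathrm{Im}\,\mathcal{F}(\pi S\stackrel{\pi}{\hookrightarrow}S)$. $\mathcal{F}$ is a resonance functor if: (A1) for $S\in\mathcal{R}_n$, $\pi\in OP(n)$, $\mathcal{F}(\pi S\stackrel{\pi}{\hookrightarrow}S)$ is an inclusion map and $\mathcal{F}(S)/\mathrm{Im}\,\mathcal{F}(\pi S\stackrel{\pi}{\hookrightarrow}S)\simeq\mathcal{F}(Q(S,\mathrm{un}(\pi)\downarrow S))$; (A2) if $[Q(S,\Pi)]=[Q(T,\Lambda)]$ then $\mathcal{F}(Q(S,\Pi))\simeq\mathcal{F}(Q(T,\Lambda))$; (A3) $\mathcal{F}(S,\Pi)\wedge\mathcal{F}(T,\Lambda)\simeq\mathcal{F}((S,\Pi)\times(T,\Lambda))$ for relative cuts $(S,\Pi)$, $(T,\Lambda)$. Notation $\mathcal{F}(\lambda)$: for a number partition with parts $\lambda=(\lambda_1,\dots,\lambda_n)$ (in any order), $\mathcal{F}(\lambda)=\mathcal{F}(S_\lambda)$ with $S_\lambda=\{x\in\{-1,0,1\}^n:\sum_ix_i\lambda_i=0\}$, well defined up to homeomorphism. $(a^k,1^l)$ is the partition with $k$ parts equal to $a$ and $l$ parts equal to $1$. $\mathrm{susp}^m$ is $m$-fold suspension.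
   Formalization: In (A1) "inclusion map" is taken to be an embedding with the pointed homotopy extension property (a cofibration), since (b) fails for bare closed embeddings; "contractible", "≃" and suspension are the pointed (reduced) notions. *)

theory Defs
  imports
    "HOL-Analysis.Analysis"
    "HOL-Library.Multiset"
    "HOL-Library.Disjoint_Sets"
    "HOL-Combinatorics.Permutations"
begin

section \<open>Cuts\<close>

text \<open>
  Vectors in $\{-1,0,1\}^n$ are integer lists of length \<open>n\<close>, indexed from 0; accordingly the
  index set $[n]$ is \<open>{..<n}\<close> throughout.
\<close>

definition tern :: "nat \<Rightarrow> int list set" where
  "tern n = {x. length x = n \<and> set x \<subseteq> {-1, 0, 1}}"

definition tspan :: "nat \<Rightarrow> int list set \<Rightarrow> int list set" where
  "tspan n A = {x \<in> tern n. \<exists>B c. finite B \<and> B \<subseteq> A \<and>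
     (\<forall>i<n. real_of_int (x ! i) = (\<Sum>a\<in>B. c a * real_of_int (a ! i)))}"

text \<open>An \<open>n\<close>-cut contains the zero vector of length \<open>n\<close>, so it determines \<open>n\<close>.\<close>

definition cuts :: "nat \<Rightarrow> int list set set" where
  "cuts n = {S. 0 < n \<and> S \<subseteq> tern n \<and> tspan n S = S \<and>
     (\<forall>x\<in>S. x \<noteq> replicate n 0 \<longrightarrow> 1 \<in> set x \<and> -1 \<in> set x)}"

definition plus_idx :: "int list \<Rightarrow> nat set" where
  "plus_idx x = {i. i < length x \<and> x ! i = 1}"

definition minus_idx :: "int list \<Rightarrow> nat set" where
  "minus_idx x = {i. i < length x \<and> x ! i = -1}"


section \<open>Set partitions\<close>

definition parts :: "nat \<Rightarrow> nat set set set" where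
  "parts n = {P. partition_on {..<n} P}"

text \<open>The map forgetting the order of an ordered partition is \<open>set\<close>.\<close>

definition oparts :: "nat \<Rightarrow> nat set list set" where
  "oparts n = {p. distinct p \<and> set p \<in> parts n}"

definition ocomp :: "nat set list \<Rightarrow> nat set list \<Rightarrow> nat set list" where
  "ocomp p q = map (\<lambda>B. \<Union>j\<in>B. q ! j) p"

text \<open>
  \<open>pull p S\<close> is $\pi S$. As the blocks of \<open>p\<close> cover \<open>{..<n}\<close>, the vector \<open>s\<close> below is determined
  by \<open>t\<close>.
\<close>

definition pull :: "nat set list \<Rightarrow> int list set \<Rightarrow> int list set" where
  "pull p S = {t \<in> tern (length p). \<exists>s\<in>S. \<forall>j<length p. \<forall>i\<in>p ! j. s ! i = t ! j}"

text \<open>\<open>stratum S P\<close> is $S^\pi$.\<close>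

definition stratum :: "int list set \<Rightarrow> nat set set \<Rightarrow> int list set" where
  "stratum S P = {s \<in> S. \<forall>B\<in>P. \<forall>i\<in>B. \<forall>j\<in>B. i \<noteq> j \<longrightarrow> s ! i = s ! j \<and> s ! i \<noteq> 0}"


section \<open>Relative cuts\<close>

text \<open>
  \<open>Down S A\<close> is $\mathcal{A}\Downarrow S$. Collections of multisubsets are multisets of multisets,
  and unions of multisets add multiplicities.
\<close>

inductive_set Down :: "int list set \<Rightarrow> nat multiset multiset \<Rightarrow> nat multiset multiset set"
  for S :: "int list set" and A :: "nat multiset multiset" where
  start: "A \<in> Down S A"
| merge: "add_mset B (add_mset C M) \<in> Down S A \<Longrightarrow> add_mset (B + C) M \<in> Down S A"
| exchange: "add_mset B M \<in> Down S A \<Longrightarrow> x \<in> S \<Longrightarrow> mset_set (plus_idx x) \<subseteq># B \<Longrightarrow>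
    add_mset ((B - mset_set (plus_idx x)) + mset_set (minus_idx x)) M \<in> Down S A"

definition part_mset :: "nat set set \<Rightarrow> nat multiset multiset" where
  "part_mset P = image_mset mset_set (mset_set P)"

definition down :: "nat \<Rightarrow> int list set \<Rightarrow> nat set set set \<Rightarrow> nat set set set" where
  "down n S \<Gamma> = (\<Union>P\<in>\<Gamma>. {R \<in> parts n. part_mset R \<in> Down S (part_mset P)})"

definition closed_parts :: "nat \<Rightarrow> int list set \<Rightarrow> nat set set set \<Rightarrow> bool" where
  "closed_parts n S \<Gamma> \<longleftrightarrow> \<Gamma> \<subseteq> parts n \<and> down n S \<Gamma> = \<Gamma>"

definition cut_minus :: "int list set \<Rightarrow> nat set set set \<Rightarrow> int list set" where
  "cut_minus S \<Gamma> = S - (\<Union>P\<in>\<Gamma>. stratum S P)"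

type_synonym relcut = "int list set \<times> nat set set set"

text \<open>
  Closedness refers to \<open>n\<close>-cuts only, so the span of the first component is required to be one.
\<close>

definition relative_cut :: "nat \<Rightarrow> relcut \<Rightarrow> bool" where
  "relative_cut n = (\<lambda>(S, \<Gamma>). S \<subseteq> tern n \<and> tspan n S \<in> cuts n \<and>
     closed_parts n (tspan n S) \<Gamma> \<and> cut_minus (tspan n S) \<Gamma> = S)"

definition Qcut :: "int list set \<Rightarrow> nat set set set \<Rightarrow> relcut" where
  "Qcut S \<Gamma> = (cut_minus S \<Gamma>, \<Gamma>)"

text \<open>
  Coordinates are permuted by \<open>x \<mapsto> x \<circ> \<sigma>\<close>, so blocks have to be moved by \<open>inv \<sigma>\<close>. Using the inverse
  convention yields the same orbits.
\<close>

definition perm_relcut :: "nat \<Rightarrow> (nat \<Rightarrow> nat) \<Rightarrow> relcut \<Rightarrow> relcut" where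
  "perm_relcut n \<sigma> = (\<lambda>(S, \<Gamma>).
     ((\<lambda>x. map (\<lambda>i. x ! \<sigma> i) [0..<n]) ` S, (\<lambda>P. (\<lambda>B. inv \<sigma> ` B) ` P) ` \<Gamma>))"

definition relcut_orbit :: "nat \<Rightarrow> relcut \<Rightarrow> relcut set" where
  "relcut_orbit n C = {perm_relcut n \<sigma> C | \<sigma>. \<sigma> permutes {..<n}}"

definition restrict_part :: "nat set set \<Rightarrow> nat set \<Rightarrow> nat set set" where
  "restrict_part P A = (\<lambda>B. B \<inter> A) ` P - {{}}"

text \<open>The second factor lives on \<open>{n..<n + m}\<close>, which is identified with \<open>{..<m}\<close> by \<open>i \<mapsto> i - n\<close>.\<close>

definition parts_times :: "nat \<Rightarrow> nat \<Rightarrow> nat set set set \<Rightarrow> nat set set set \<Rightarrow> nat set set set" where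
  "parts_times n m \<Gamma> \<Lambda> = {P \<in> parts (n + m). restrict_part P {..<n} \<in> \<Gamma> \<and>
     (\<lambda>B. (\<lambda>i. i - n) ` B) ` restrict_part P {n..<n + m} \<in> \<Lambda>}"

definition relcut_times :: "nat \<Rightarrow> nat \<Rightarrow> relcut \<Rightarrow> relcut \<Rightarrow> relcut" where
  "relcut_times n m = (\<lambda>(S, \<Gamma>) (T, \<Lambda>).
     ({x @ y | x y. x \<in> S \<and> y \<in> T},
      parts_times n m \<Gamma> (parts m) \<union> parts_times n m (parts n) \<Lambda>))"


section \<open>Pointed spaces\<close>

type_synonym 'a pointed = "'a topology \<times> 'a"

definition pointed_space :: "'a pointed \<Rightarrow> bool" where
  "pointed_space X \<longleftrightarrow> snd X \<in> topspace (fst X)"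

definition pointed_map :: "'a pointed \<Rightarrow> 'b pointed \<Rightarrow> ('a \<Rightarrow> 'b) \<Rightarrow> bool" where
  "pointed_map X Y f \<longleftrightarrow> continuous_map (fst X) (fst Y) f \<and> f (snd X) = snd Y"

definition pointed_homotopic :: "'a pointed \<Rightarrow> 'b pointed \<Rightarrow> ('a \<Rightarrow> 'b) \<Rightarrow> ('a \<Rightarrow> 'b) \<Rightarrow> bool" where
  "pointed_homotopic X Y = homotopic_with (\<lambda>h. h (snd X) = snd Y) (fst X) (fst Y)"

definition pointed_heq :: "'a pointed \<Rightarrow> 'b pointed \<Rightarrow> bool" where
  "pointed_heq X Y \<longleftrightarrow> (\<exists>f g. pointed_map X Y f \<and> pointed_map Y X g \<and>
     pointed_homotopic X X (g \<circ> f) id \<and> pointed_homotopic Y Y (f \<circ> g) id)"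

definition pointed_contractible :: "'a pointed \<Rightarrow> bool" where
  "pointed_contractible X \<longleftrightarrow> pointed_homotopic X X id (\<lambda>_. snd X)"

text \<open>
  The homotopy extension property in pointed spaces. It is enough to test targets carried by
  \<open>'b \<times> real\<close>: the universal target is the reduced mapping cylinder of \<open>i\<close>, whose points can be
  represented by the pairs \<open>(y, 0)\<close> with \<open>y\<close> in \<open>Y\<close> and \<open>(i x, t)\<close> with \<open>t > 0\<close> and \<open>x\<close> in \<open>X\<close>
  not the base point, provided \<open>i\<close> is injective.
\<close>

definition pointed_hep :: "'a pointed \<Rightarrow> 'b pointed \<Rightarrow> ('a \<Rightarrow> 'b) \<Rightarrow> bool" where
  "pointed_hep X Y i \<longleftrightarrow> (\<forall>(Z :: ('b \<times> real) pointed) f h.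
     pointed_space Z \<and> pointed_map Y Z f \<and>
     continuous_map (prod_topology (top_of_set {0..1::real}) (fst X)) (fst Z) h \<and>
     (\<forall>t\<in>{0..1}. h (t, snd X) = snd Z) \<and>
     (\<forall>x\<in>topspace (fst X). h (0, x) = f (i x)) \<longrightarrow>
     (\<exists>H. continuous_map (prod_topology (top_of_set {0..1::real}) (fst Y)) (fst Z) H \<and>
        (\<forall>t\<in>{0..1}. H (t, snd Y) = snd Z) \<and>
        (\<forall>y\<in>topspace (fst Y). H (0, y) = f y) \<and>
        (\<forall>t\<in>{0..1}. \<forall>x\<in>topspace (fst X). H (t, i x) = h (t, x))))"

text \<open>
  Inclusion maps are understood as in homotopy theory: embeddings that are cofibrations, as for
  inclusions of CW subcomplexes. For bare (even closed) embeddings of arbitrary topological spaces,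
  the quotient by a contractible subspace need not have the homotopy type of the ambient space, and
  the computation of $\mathcal{F}(a^k,1^l)$ from the axioms of a resonance functor breaks down.
\<close>

definition inclusion_cofibration :: "'a pointed \<Rightarrow> 'b pointed \<Rightarrow> ('a \<Rightarrow> 'b) \<Rightarrow> bool" where
  "inclusion_cofibration X Y i \<longleftrightarrow>
     pointed_map X Y i \<and> embedding_map (fst X) (fst Y) i \<and> pointed_hep X Y i"

definition quot_topology :: "('a \<Rightarrow> 'b) \<Rightarrow> 'a topology \<Rightarrow> 'b topology" where
  "quot_topology f X =
     topology (\<lambda>U. U \<subseteq> f ` topspace X \<and> openin X {x \<in> topspace X. f x \<in> U})"

lemma openin_quot_topology:
  "openin (quot_topology f X) U \<longleftrightarrow>
     U \<subseteq> f ` topspace X \<and> openin X {x \<in> topspace X. f x \<in> U}"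
proof -
  have "istopology (\<lambda>U. U \<subseteq> f ` topspace X \<and> openin X {x \<in> topspace X. f x \<in> U})"
    unfolding istopology_def
  proof (intro conjI allI impI)
    fix S T
    assume S: "S \<subseteq> f ` topspace X \<and> openin X {x \<in> topspace X. f x \<in> S}"
      and T: "T \<subseteq> f ` topspace X \<and> openin X {x \<in> topspace X. f x \<in> T}"
    show "S \<inter> T \<subseteq> f ` topspace X" using S by blast
    have "{x \<in> topspace X. f x \<in> S \<inter> T} =
        {x \<in> topspace X. f x \<in> S} \<inter> {x \<in> topspace X. f x \<in> T}" by blast
    then show "openin X {x \<in> topspace X. f x \<in> S \<inter> T}" using S T by auto
  next
    fix K
    assume K: "\<forall>S\<in>K. S \<subseteq> f ` topspace X \<and> openin X {x \<in> topspace X. f x \<in> S}"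
    show "\<Union>K \<subseteq> f ` topspace X" using K by blast
    have "{x \<in> topspace X. f x \<in> \<Union>K} = (\<Union>S\<in>K. {x \<in> topspace X. f x \<in> S})" by blast
    then show "openin X {x \<in> topspace X. f x \<in> \<Union>K}" using K by auto
  qed
  then show ?thesis
    unfolding quot_topology_def by (simp add: topology_inverse')
qed

lemma topspace_quot_topology: "topspace (quot_topology f X) = f ` topspace X"
proof
  show "topspace (quot_topology f X) \<subseteq> f ` topspace X"
    using openin_quot_topology[of f X "topspace (quot_topology f X)"] by simp
  have "{x \<in> topspace X. f x \<in> f ` topspace X} = topspace X" by blast
  then show "f ` topspace X \<subseteq> topspace (quot_topology f X)"
    by (intro openin_subset) (simp add: openin_quot_topology)
qed

lemma quotient_map_quot_topology: "quotient_map X (quot_topology f X) f"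
  by (auto simp: quotient_map_def openin_quot_topology topspace_quot_topology)

text \<open>For \<open>f\<close> injective on the underlying set, this is a homeomorphic copy of \<open>X\<close>.\<close>

definition relabel :: "('a \<Rightarrow> 'b) \<Rightarrow> 'a pointed \<Rightarrow> 'b pointed" where
  "relabel f X = (quot_topology f (fst X), f (snd X))"

text \<open>
  The quotient of \<open>X\<close> by a subset \<open>A\<close> containing the point \<open>b\<close>, which represents the collapsed class
  and is the base point. For \<open>A\<close> empty, nothing is collapsed.
\<close>

definition collapse :: "'a topology \<Rightarrow> 'a set \<Rightarrow> 'a \<Rightarrow> 'a pointed" where
  "collapse X A b = (quot_topology (\<lambda>x. if x \<in> A then b else x) X, b)"

definition smash :: "'a pointed \<Rightarrow> 'b pointed \<Rightarrow> ('a \<times> 'b) pointed" where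
  "smash X Y = collapse (prod_topology (fst X) (fst Y))
     ({snd X} \<times> topspace (fst Y) \<union> topspace (fst X) \<times> {snd Y}) (snd X, snd Y)"

text \<open>
  Iterated smash product $X\wedge(X\wedge(\cdots\wedge X))$, with a tuple of points stored as a list.
  The case 0 is the 0-sphere.
\<close>

fun smash_power :: "'a pointed \<Rightarrow> nat \<Rightarrow> 'a list pointed" where
  "smash_power X 0 = (discrete_topology {[], [snd X]}, [])"
| "smash_power X (Suc 0) = relabel (\<lambda>x. [x]) X"
| "smash_power X (Suc (Suc n)) =
     relabel (\<lambda>(x, xs). x # xs) (smash X (smash_power X (Suc n)))"

text \<open>Reduced suspension.\<close>

definition susp :: "'a pointed \<Rightarrow> (real \<times> 'a) pointed" where
  "susp X = collapse (prod_topology (top_of_set {0..1}) (fst X))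
     ({0, 1} \<times> topspace (fst X) \<union> {0..1} \<times> {snd X}) (0, snd X)"

text \<open>Iterated suspension, with the list of suspension coordinates stored in the first component.\<close>

primrec susp_iter :: "nat \<Rightarrow> 'a pointed \<Rightarrow> (real list \<times> 'a) pointed" where
  "susp_iter 0 X = relabel (\<lambda>x. ([], x)) X"
| "susp_iter (Suc m) X = relabel (\<lambda>(t, ts, x). (t # ts, x)) (susp (susp_iter m X))"


section \<open>Resonance functors\<close>

text \<open>\<open>res_mor S T p\<close>: \<open>(S, T, p)\<close> is a morphism of the resonance category.\<close>

definition res_mor :: "int list set \<Rightarrow> int list set \<Rightarrow> nat set list \<Rightarrow> bool" where
  "res_mor S T p \<longleftrightarrow> (\<exists>m n. S \<in> cuts m \<and> T \<in> cuts n \<and> p \<in> oparts n \<and> length p = m \<and>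
     S \<subseteq> pull p T)"

text \<open>
  A functor from the resonance category to pointed spaces is given by its object part \<open>Fo\<close> and its
  morphism part \<open>Fm\<close>. Maps are only relevant on the underlying set of their domain. The category
  has countably many objects, so placing all values on one type \<open>'a\<close> is no restriction.
\<close>

definition res_pointed_functor ::
  "(int list set \<Rightarrow> 'a pointed) \<Rightarrow> (int list set \<Rightarrow> int list set \<Rightarrow> nat set list \<Rightarrow> 'a \<Rightarrow> 'a) \<Rightarrow> bool" where
  "res_pointed_functor Fo Fm \<longleftrightarrow>
     (\<forall>n. \<forall>S\<in>cuts n. pointed_space (Fo S)) \<and>
     (\<forall>S T p. res_mor S T p \<longrightarrow> pointed_map (Fo S) (Fo T) (Fm S T p)) \<and>
     (\<forall>n. \<forall>S\<in>cuts n. \<forall>x\<in>topspace (fst (Fo S)). Fm S S (map (\<lambda>i. {i}) [0..<n]) x = x) \<and>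
     (\<forall>S T Q p q. res_mor S T p \<longrightarrow> res_mor T Q q \<longrightarrow>
        (\<forall>x\<in>topspace (fst (Fo S)). Fm S Q (ocomp p q) x = Fm T Q q (Fm S T p x)))"

definition pull_image ::
  "(int list set \<Rightarrow> 'a pointed) \<Rightarrow> (int list set \<Rightarrow> int list set \<Rightarrow> nat set list \<Rightarrow> 'a \<Rightarrow> 'a) \<Rightarrow>
   int list set \<Rightarrow> nat set list \<Rightarrow> 'a set" where
  "pull_image Fo Fm S p = Fm (pull p S) S p ` topspace (fst (Fo (pull p S)))"

text \<open>\<open>Fquot Fo Fm n S \<Gamma>\<close> is $\mathcal{F}(Q(S,\Pi))$ for an \<open>n\<close>-cut \<open>S\<close>.\<close>

definition Fquot ::
  "(int list set \<Rightarrow> 'a pointed) \<Rightarrow> (int list set \<Rightarrow> int list set \<Rightarrow> nat set list \<Rightarrow> 'a \<Rightarrow> 'a) \<Rightarrow>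
   nat \<Rightarrow> int list set \<Rightarrow> nat set set set \<Rightarrow> 'a pointed" where
  "Fquot Fo Fm n S \<Gamma> = collapse (fst (Fo S))
     (\<Union>p\<in>{p \<in> oparts n. set p \<in> \<Gamma>}. pull_image Fo Fm S p) (snd (Fo S))"

text \<open>The value on a relative cut \<open>(S, \<Gamma>)\<close>, which equals \<open>Qcut (tspan n S) \<Gamma>\<close>.\<close>

definition Frel ::
  "(int list set \<Rightarrow> 'a pointed) \<Rightarrow> (int list set \<Rightarrow> int list set \<Rightarrow> nat set list \<Rightarrow> 'a \<Rightarrow> 'a) \<Rightarrow>
   nat \<Rightarrow> relcut \<Rightarrow> 'a pointed" where
  "Frel Fo Fm n = (\<lambda>(S, \<Gamma>). Fquot Fo Fm n (tspan n S) \<Gamma>)"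

definition inclusion_axiom ::
  "(int list set \<Rightarrow> 'a pointed) \<Rightarrow> (int list set \<Rightarrow> int list set \<Rightarrow> nat set list \<Rightarrow> 'a \<Rightarrow> 'a) \<Rightarrow> bool" where
  "inclusion_axiom Fo Fm \<longleftrightarrow> (\<forall>n. \<forall>S\<in>cuts n. \<forall>p\<in>oparts n.
     inclusion_cofibration (Fo (pull p S)) (Fo S) (Fm (pull p S) S p) \<and>
     pointed_heq (collapse (fst (Fo S)) (pull_image Fo Fm S p) (snd (Fo S)))
       (Fquot Fo Fm n S (down n S {set p})))"

definition relative_resonance_axiom ::
  "(int list set \<Rightarrow> 'a pointed) \<Rightarrow> (int list set \<Rightarrow> int list set \<Rightarrow> nat set list \<Rightarrow> 'a \<Rightarrow> 'a) \<Rightarrow> bool" where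
  "relative_resonance_axiom Fo Fm \<longleftrightarrow> (\<forall>n. \<forall>S\<in>cuts n. \<forall>T\<in>cuts n. \<forall>\<Gamma> \<Lambda>.
     closed_parts n S \<Gamma> \<and> closed_parts n T \<Lambda> \<and>
     relcut_orbit n (Qcut S \<Gamma>) = relcut_orbit n (Qcut T \<Lambda>) \<longrightarrow>
     pointed_heq (Fquot Fo Fm n S \<Gamma>) (Fquot Fo Fm n T \<Lambda>))"

definition direct_product_axiom ::
  "(int list set \<Rightarrow> 'a pointed) \<Rightarrow> (int list set \<Rightarrow> int list set \<Rightarrow> nat set list \<Rightarrow> 'a \<Rightarrow> 'a) \<Rightarrow> bool" where
  "direct_product_axiom Fo Fm \<longleftrightarrow> (\<forall>n m C D. relative_cut n C \<and> relative_cut m D \<longrightarrow>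
     pointed_heq (smash (Frel Fo Fm n C) (Frel Fo Fm m D))
       (Frel Fo Fm (n + m) (relcut_times n m C D)))"

definition resonance_functor ::
  "(int list set \<Rightarrow> 'a pointed) \<Rightarrow> (int list set \<Rightarrow> int list set \<Rightarrow> nat set list \<Rightarrow> 'a \<Rightarrow> 'a) \<Rightarrow> bool" where
  "resonance_functor Fo Fm \<longleftrightarrow> res_pointed_functor Fo Fm \<and>
     inclusion_axiom Fo Fm \<and> relative_resonance_axiom Fo Fm \<and> direct_product_axiom Fo Fm"

text \<open>The cut $S_\lambda$ of a number partition with list of parts \<open>lam\<close>.\<close>

definition partition_cut :: "nat list \<Rightarrow> int list set" where
  "partition_cut lam =
     {x \<in> tern (length lam). (\<Sum>i<length lam. x ! i * int (lam ! i)) = 0}"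

end

theory Submission
  imports Defs
begin

text \<open>
  Write $\mathcal{F}(k,l)$ for $\mathcal{F}(a^k,1^l)$. Collecting \<open>a\<close> of the ones into a block gives
  an inclusion $\mathcal{F}(k+1,l-a)\to\mathcal{F}(k,l)$. A vector of the cut of $(a^k,1^l)$ survives in
  the quotient iff it has fewer than \<open>a\<close> plus signs and fewer than \<open>a\<close> minus signs on the ones; then
  its sum over the ones is a multiple of \<open>a\<close> of absolute value below \<open>a\<close>, so it vanishes and the cut
  splits. Hence the quotient is $\mathcal{F}(1^k)\wedge(\mathcal{F}(1^l)/\mathcal{F}(1,l-a))$.
  For $k\ge2$ the first factor is contractible, so $\mathcal{F}(k,l)$ is contractible by induction on
  \<open>l\<close>. For $k=1$ the subspace $\mathcal{F}(2,l-a)$ is therefore contractible, and so is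
  $\mathcal{F}(1^l)$; this gives
  $\mathcal{F}(1,l)\simeq\mathcal{F}(1)\wedge\mathrm{susp}\,\mathcal{F}(1,l-a)$.
\<close>

text \<open>The values of the functor are arbitrary pointed spaces, so the passage between a space
  and its quotients rests on the pointed homotopy extension property alone. Products with the
  interval preserve quotient maps, as the interval is locally compact Hausdorff; products with other
  spaces need not, so smash products and suspensions are exchanged only up to homotopy. Collapsing
  one image does not by itself produce a product. (A1) enlarges the collapse to the closed family
  \<open>big_parts\<close>, and for this family the block cut and the split cut have the same
  remaining vectors. (A2) and (A3) also compare families of partitions, so the closure must be known
  exactly: swaps along \<open>e_i - e_j\<close> and merges give one inclusion, a count that never
  decreases gives the other. Each reduction of \<open>l\<close> by \<open>a\<close> contributes one
  suspension and one smash factor. The starting value \<open>F 1 e\<close> has \<open>e + 1\<close>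
  factors for \<open>e\<close> at most 1, whence \<open>m\<close> suspensions and
  \<open>m + e + 1\<close> factors.\<close>

section \<open>Continuity of composed and paired maps\<close>

lemma continuous_map_compose_arg:
  assumes "continuous_map Y Z h" "continuous_map X Y f"
  shows "continuous_map X Z (\<lambda>x. h (f x))"
  using continuous_map_compose[OF assms(2,1)] by (simp add: o_def)

lemma continuous_map_compose_pair:
  assumes "continuous_map (prod_topology A B) C h" "continuous_map W A f" "continuous_map W B g"
  shows "continuous_map W C (\<lambda>w. h (f w, g w))"
  by (rule continuous_map_compose_arg[OF assms(1)]) (intro continuous_map_pairedI assms(2,3))

lemma continuous_map_fst_arg:
  "continuous_map W (prod_topology A B) f \<Longrightarrow> continuous_map W A (\<lambda>w. fst (f w))"
  by (rule continuous_map_compose_arg[OF continuous_map_fst])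

lemma continuous_map_snd_arg:
  "continuous_map W (prod_topology A B) f \<Longrightarrow> continuous_map W B (\<lambda>w. snd (f w))"
  by (rule continuous_map_compose_arg[OF continuous_map_snd])

lemma continuous_map_self: "continuous_map X X (\<lambda>x. x)"
  by (simp flip: id_def)

lemmas continuous_map_projections = continuous_map_self continuous_map_fst_arg continuous_map_snd_arg

lemma continuous_map_into_unit_interval:
  assumes "continuous_map X euclideanreal f" "\<And>x. x \<in> topspace X \<Longrightarrow> 0 \<le> f x \<and> f x \<le> 1"
  shows "continuous_map X (top_of_set {0..1}) f"
  using assms by (auto simp: continuous_map_in_subtopology)

lemma locally_compact_unit_interval: "locally_compact_space (top_of_set {0..1::real})"
  by (intro compact_imp_locally_compact_space) (simp add: compact_space_subtopology)

lemma Hausdorff_unit_interval: "Hausdorff_space (top_of_set {0..1::real})"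
  by (simp add: Hausdorff_space_subtopology)

section \<open>Quotients by a subset\<close>

definition collapse_map :: "'a set \<Rightarrow> 'a \<Rightarrow> 'a \<Rightarrow> 'a" where
  "collapse_map A b x = (if x \<in> A then b else x)"

lemma collapse_eq: "collapse X A b = (quot_topology (collapse_map A b) X, b)"
  by (simp add: collapse_def collapse_map_def[abs_def])

lemma snd_collapse [simp]: "snd (collapse X A b) = b"
  by (simp add: collapse_def)

lemma quotient_map_collapse_map: "quotient_map X (fst (collapse X A b)) (collapse_map A b)"
  by (simp add: collapse_eq quotient_map_quot_topology)

lemma continuous_map_collapse_map: "continuous_map X (fst (collapse X A b)) (collapse_map A b)"
  by (rule quotient_imp_continuous_map) (rule quotient_map_collapse_map)

lemma in_topspace_collapse:
  assumes "b \<in> topspace X" "b \<in> A \<or> A = {}"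
  shows "x \<in> topspace (fst (collapse X A b)) \<longleftrightarrow> x \<in> topspace X \<and> (x \<in> A \<longrightarrow> x = b)"
  using assms by (auto simp: collapse_eq topspace_quot_topology collapse_map_def)

lemma pointed_space_collapse:
  assumes "b \<in> topspace X"
  shows "pointed_space (collapse X A b)"
  using assms by (auto simp: pointed_space_def collapse_eq topspace_quot_topology collapse_map_def image_iff)

lemma continuous_map_from_collapse:
  assumes "continuous_map X Z g" "\<And>x. x \<in> topspace X \<Longrightarrow> x \<in> A \<Longrightarrow> g x = g b"
  shows "continuous_map (fst (collapse X A b)) Z g"
  by (rule continuous_compose_quotient_map[OF quotient_map_collapse_map])
     (rule continuous_map_eq[OF assms(1)], simp add: collapse_map_def assms(2))

text \<open>The product of a quotient map with the identity of a locally compact Hausdorff space is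
  again a quotient map. With \<open>W\<close> the unit interval, a homotopy on a quotient can thus
  be defined on the space above it.\<close>

lemma continuous_map_from_prod_collapse:
  assumes "locally_compact_space W" "Hausdorff_space W"
    and "continuous_map (prod_topology W X) Z h"
    and "\<And>w x. w \<in> topspace W \<Longrightarrow> x \<in> topspace X \<Longrightarrow> x \<in> A \<Longrightarrow> h (w, x) = h (w, b)"
  shows "continuous_map (prod_topology W (fst (collapse X A b))) Z h"
proof (rule continuous_compose_quotient_map)
  show "quotient_map (prod_topology W X) (prod_topology W (fst (collapse X A b)))
      (\<lambda>(w, x). (w, collapse_map A b x))"
    using assms(1,2) quotient_map_collapse_map by (intro quotient_map_prod_right) auto
  show "continuous_map (prod_topology W X) Z (h \<circ> (\<lambda>(w, x). (w, collapse_map A b x)))"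
    by (rule continuous_map_eq[OF assms(3)]) (auto simp: collapse_map_def assms(4))
qed

lemmas continuous_map_from_interval_collapse =
  continuous_map_from_prod_collapse[OF locally_compact_unit_interval Hausdorff_unit_interval]

text \<open>This makes a cut the special case of a relative cut with empty family, on which
  \<open>Fquot\<close> returns the value of the functor itself.\<close>

lemma collapse_empty: "collapse X {} b = (X, b)"
proof -
  have "openin (quot_topology (\<lambda>x. x) X) U \<longleftrightarrow> openin X U" for U
  proof -
    have "{x \<in> topspace X. x \<in> U} = U" if "U \<subseteq> topspace X"
      using that by auto
    then show ?thesis
      using openin_subset[of X U] by (auto simp: openin_quot_topology)
  qed
  then show ?thesis
    by (simp add: collapse_def topology_eq)
qed

section \<open>Pointed homotopy equivalence\<close>

lemma pointed_homotopic_iff: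
  assumes "pointed_space X"
  shows "pointed_homotopic X Y f g \<longleftrightarrow>
    (\<exists>h. continuous_map (prod_topology (top_of_set {0..1::real}) (fst X)) (fst Y) h \<and>
      (\<forall>x\<in>topspace (fst X). h (0, x) = f x) \<and> (\<forall>x\<in>topspace (fst X). h (1, x) = g x) \<and>
      (\<forall>t\<in>{0..1}. h (t, snd X) = snd Y))"
  unfolding pointed_homotopic_def using assms
  by (subst homotopic_with) (auto simp: pointed_space_def)

lemma pointed_homotopicI:
  assumes "pointed_space X"
    and "continuous_map (prod_topology (top_of_set {0..1::real}) (fst X)) (fst Y) h"
    and "\<And>x. x \<in> topspace (fst X) \<Longrightarrow> h (0, x) = f x"
    and "\<And>x. x \<in> topspace (fst X) \<Longrightarrow> h (1, x) = g x"
    and "\<And>t. 0 \<le> t \<Longrightarrow> t \<le> 1 \<Longrightarrow> h (t, snd X) = snd Y"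
  shows "pointed_homotopic X Y f g"
  using assms by (subst pointed_homotopic_iff) auto

lemma pointed_homotopicE:
  assumes "pointed_homotopic X Y f g" "pointed_space X"
  obtains h where "continuous_map (prod_topology (top_of_set {0..1::real}) (fst X)) (fst Y) h"
    and "\<And>x. x \<in> topspace (fst X) \<Longrightarrow> h (0, x) = f x"
    and "\<And>x. x \<in> topspace (fst X) \<Longrightarrow> h (1, x) = g x"
    and "\<And>t. 0 \<le> t \<Longrightarrow> t \<le> 1 \<Longrightarrow> h (t, snd X) = snd Y"
  using assms by (subst (asm) pointed_homotopic_iff) auto

lemma pointed_homotopic_eq:
  assumes "pointed_space X" "pointed_map X Y f" "\<And>x. x \<in> topspace (fst X) \<Longrightarrow> f x = g x"
  shows "pointed_homotopic X Y f g"
  unfolding pointed_homotopic_def using assms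
  by (intro homotopic_with_equal) (auto simp: pointed_map_def pointed_space_def)

lemma pointed_homotopic_cong:
  assumes "pointed_homotopic X Y f g" "pointed_space X"
    and "\<And>x. x \<in> topspace (fst X) \<Longrightarrow> f x = f' x" "\<And>x. x \<in> topspace (fst X) \<Longrightarrow> g x = g' x"
  shows "pointed_homotopic X Y f' g'"
  using assms(1,3,4) unfolding pointed_homotopic_iff[OF assms(2)] by auto

lemma pointed_homotopic_sym: "pointed_homotopic X Y f g \<Longrightarrow> pointed_homotopic X Y g f"
  unfolding pointed_homotopic_def by (rule homotopic_with_symD)

lemma pointed_homotopic_trans:
  "pointed_homotopic X Y f g \<Longrightarrow> pointed_homotopic X Y g h \<Longrightarrow> pointed_homotopic X Y f h"
  unfolding pointed_homotopic_def by (rule homotopic_with_trans)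

lemma pointed_homotopic_compose_left:
  assumes "pointed_homotopic X Y f g" "pointed_map Y Z h"
  shows "pointed_homotopic X Z (h \<circ> f) (h \<circ> g)"
  using assms unfolding pointed_homotopic_def pointed_map_def
  by (auto intro: homotopic_with_compose_continuous_map_left)

lemma pointed_homotopic_compose_right:
  assumes "pointed_homotopic Y Z f g" "pointed_map X Y h"
  shows "pointed_homotopic X Z (f \<circ> h) (g \<circ> h)"
  using assms unfolding pointed_homotopic_def pointed_map_def
  by (auto intro: homotopic_with_compose_continuous_map_right)

lemma pointed_map_id: "pointed_map X X id"
  by (simp add: pointed_map_def)

lemma pointed_map_compose: "pointed_map X Y f \<Longrightarrow> pointed_map Y Z g \<Longrightarrow> pointed_map X Z (g \<circ> f)"
  by (auto simp: pointed_map_def intro: continuous_map_compose)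

lemma pointed_map_in: "pointed_map X Y f \<Longrightarrow> x \<in> topspace (fst X) \<Longrightarrow> f x \<in> topspace (fst Y)"
  by (auto simp: pointed_map_def continuous_map_def)

lemma pointed_heqI:
  assumes "pointed_map X Y f" "pointed_map Y X g"
    and "pointed_homotopic X X (g \<circ> f) id" "pointed_homotopic Y Y (f \<circ> g) id"
  shows "pointed_heq X Y"
  using assms unfolding pointed_heq_def by blast

lemma pointed_heq_refl: "pointed_heq X X"
  by (rule pointed_heqI[of _ _ id id]) (auto simp: pointed_map_def pointed_homotopic_def)

lemma pointed_heq_sym: "pointed_heq X Y \<Longrightarrow> pointed_heq Y X"
  unfolding pointed_heq_def by blast

lemma pointed_heq_trans [trans]:
  assumes "pointed_heq X Y" "pointed_heq Y Z"
  shows "pointed_heq X Z"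
proof -
  obtain f g where f: "pointed_map X Y f" "pointed_map Y X g"
    "pointed_homotopic X X (g \<circ> f) id" "pointed_homotopic Y Y (f \<circ> g) id"
    using assms(1) unfolding pointed_heq_def by blast
  obtain f' g' where f': "pointed_map Y Z f'" "pointed_map Z Y g'"
    "pointed_homotopic Y Y (g' \<circ> f') id" "pointed_homotopic Z Z (f' \<circ> g') id"
    using assms(2) unfolding pointed_heq_def by blast
  show ?thesis
  proof (rule pointed_heqI)
    show "pointed_map X Z (f' \<circ> f)" "pointed_map Z X (g \<circ> g')"
      using f f' pointed_map_compose by blast+
    have "pointed_homotopic X X (g \<circ> ((g' \<circ> f') \<circ> f)) (g \<circ> (id \<circ> f))"
      by (rule pointed_homotopic_compose_left[OF pointed_homotopic_compose_right[OF f'(3) f(1)] f(2)])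
    then show "pointed_homotopic X X ((g \<circ> g') \<circ> (f' \<circ> f)) id"
      using f(3) pointed_homotopic_trans by (fastforce simp: o_assoc)
    have "pointed_homotopic Z Z (f' \<circ> ((f \<circ> g) \<circ> g')) (f' \<circ> (id \<circ> g'))"
      by (rule pointed_homotopic_compose_left[OF pointed_homotopic_compose_right[OF f(4) f'(2)] f'(1)])
    then show "pointed_homotopic Z Z ((f' \<circ> f) \<circ> (g \<circ> g')) id"
      using f'(4) pointed_homotopic_trans by (fastforce simp: o_assoc)
  qed
qed

lemma pointed_contractibleE:
  assumes "pointed_contractible X" "pointed_space X"
  obtains c where "continuous_map (prod_topology (top_of_set {0..1::real}) (fst X)) (fst X) c"
    and "\<And>x. x \<in> topspace (fst X) \<Longrightarrow> c (0, x) = x"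
    and "\<And>x. x \<in> topspace (fst X) \<Longrightarrow> c (1, x) = snd X"
    and "\<And>t. 0 \<le> t \<Longrightarrow> t \<le> 1 \<Longrightarrow> c (t, snd X) = snd X"
  using pointed_homotopicE[OF assms[unfolded pointed_contractible_def], unfolded id_apply] by blast

text \<open>Up to homotopy the identity of \<open>X\<close> factors through \<open>Y\<close>, where
  it can be contracted.\<close>

lemma pointed_contractible_heq:
  assumes "pointed_heq X Y" "pointed_contractible Y"
  shows "pointed_contractible X"
proof -
  obtain f g where f: "pointed_map X Y f" "pointed_map Y X g" "pointed_homotopic X X (g \<circ> f) id"
    using assms(1) unfolding pointed_heq_def by blast
  have "pointed_homotopic X X (g \<circ> (id \<circ> f)) (g \<circ> ((\<lambda>_. snd Y) \<circ> f))"
    using assms(2) unfolding pointed_contractible_def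
    by (rule pointed_homotopic_compose_left[OF pointed_homotopic_compose_right[OF _ f(1)] f(2)])
  moreover have "g \<circ> ((\<lambda>_. snd Y) \<circ> f) = (\<lambda>_. snd X)"
    using f(2) by (auto simp: pointed_map_def)
  ultimately show ?thesis
    unfolding pointed_contractible_def
    using pointed_homotopic_trans[OF pointed_homotopic_sym[OF f(3)]] by simp
qed

lemma pointed_space_relabel: "pointed_space X \<Longrightarrow> pointed_space (relabel f X)"
  by (auto simp: pointed_space_def relabel_def topspace_quot_topology)

lemma snd_relabel [simp]: "snd (relabel f X) = f (snd X)"
  by (simp add: relabel_def)

lemma topspace_relabel [simp]: "topspace (fst (relabel f X)) = f ` topspace (fst X)"
  by (simp add: relabel_def topspace_quot_topology)

text \<open>The inverse function is continuous because \<open>f\<close> is a quotient map onto the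
  relabelled space. This compares \<open>smash_power\<close> and \<open>susp_iter\<close>, carried
  by lists, with the binary constructions.\<close>

lemma pointed_heq_relabel:
  assumes "pointed_space X" "inj f"
  shows "pointed_heq X (relabel f X)"
proof (rule pointed_heqI)
  have q: "quotient_map (fst X) (fst (relabel f X)) f"
    by (simp add: relabel_def quotient_map_quot_topology)
  show f: "pointed_map X (relabel f X) f"
    using q by (auto simp: pointed_map_def quotient_imp_continuous_map)
  have "continuous_map (fst X) (fst X) (inv f \<circ> f)"
    using assms(2) by simp
  then have "continuous_map (fst (relabel f X)) (fst X) (inv f)"
    by (rule continuous_compose_quotient_map[OF q])
  then show g: "pointed_map (relabel f X) X (inv f)"
    using assms(2) by (simp add: pointed_map_def)
  show "pointed_homotopic X X (inv f \<circ> f) id"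
    using assms by (simp add: pointed_homotopic_def)
  show "pointed_homotopic (relabel f X) (relabel f X) (f \<circ> inv f) id"
    using assms pointed_map_compose[OF g f]
    by (intro pointed_homotopic_eq) (auto simp: pointed_space_relabel)
qed

section \<open>Smash products and suspensions\<close>

text \<open>The projection onto the smash product. Points of the quotient are representing pairs, so
  maps into a smash product are given by a formula on pairs followed by this normalization.\<close>

definition smash_map :: "'a pointed \<Rightarrow> 'b pointed \<Rightarrow> 'a \<times> 'b \<Rightarrow> 'a \<times> 'b" where
  "smash_map X Y = collapse_map
     ({snd X} \<times> topspace (fst Y) \<union> topspace (fst X) \<times> {snd Y}) (snd X, snd Y)"

lemma smash_map_apply:
  "x \<in> topspace (fst X) \<Longrightarrow> y \<in> topspace (fst Y) \<Longrightarrow>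
    smash_map X Y (x, y) = (if x = snd X \<or> y = snd Y then (snd X, snd Y) else (x, y))"
  by (auto simp: smash_map_def collapse_map_def)

lemma smash_map_base:
  assumes "pointed_space X" "pointed_space Y"
  shows "y \<in> topspace (fst Y) \<Longrightarrow> smash_map X Y (snd X, y) = (snd X, snd Y)"
    and "x \<in> topspace (fst X) \<Longrightarrow> smash_map X Y (x, snd Y) = (snd X, snd Y)"
  using assms by (auto simp: smash_map_apply pointed_space_def)

lemma snd_smash [simp]: "snd (smash X Y) = (snd X, snd Y)"
  by (simp add: smash_def)

lemma continuous_map_smash_map:
  "continuous_map (prod_topology (fst X) (fst Y)) (fst (smash X Y)) (smash_map X Y)"
  by (simp add: smash_def smash_map_def continuous_map_collapse_map)

lemma pointed_space_smash:
  "pointed_space X \<Longrightarrow> pointed_space Y \<Longrightarrow> pointed_space (smash X Y)"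
  unfolding smash_def by (intro pointed_space_collapse) (auto simp: pointed_space_def)

lemma in_topspace_smash:
  assumes "pointed_space X" "pointed_space Y"
  shows "(x, y) \<in> topspace (fst (smash X Y)) \<longleftrightarrow>
    x \<in> topspace (fst X) \<and> y \<in> topspace (fst Y) \<and> (x = snd X \<longleftrightarrow> y = snd Y)"
  using assms unfolding smash_def
  by (subst in_topspace_collapse) (auto simp: pointed_space_def)

lemma smash_map_id:
  assumes "pointed_space X" "pointed_space Y" "p \<in> topspace (fst (smash X Y))"
  shows "smash_map X Y p = p"
  using assms by (cases p) (auto simp: in_topspace_smash smash_map_apply)

text \<open>Both homotopies run at the same time; being pointed, they send the collapsed wedge to
  the base point throughout. Constant homotopies give the induced maps, null homotopies give
  contractibility.\<close>

lemma smash_homotopic: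
  assumes X: "pointed_space X" and Y: "pointed_space Y"
    and f: "pointed_homotopic X X' f f'" and g: "pointed_homotopic Y Y' g g'"
  shows "pointed_homotopic (smash X Y) (smash X' Y')
    (\<lambda>p. smash_map X' Y' (f (fst p), g (snd p))) (\<lambda>p. smash_map X' Y' (f' (fst p), g' (snd p)))"
proof -
  let ?I = "top_of_set {0..1::real}"
  obtain h where h: "continuous_map (prod_topology ?I (fst X)) (fst X') h"
    "\<And>x. x \<in> topspace (fst X) \<Longrightarrow> h (0, x) = f x"
    "\<And>x. x \<in> topspace (fst X) \<Longrightarrow> h (1, x) = f' x"
    "\<And>t. 0 \<le> t \<Longrightarrow> t \<le> 1 \<Longrightarrow> h (t, snd X) = snd X'"
    using pointed_homotopicE[OF f X] by blast
  obtain k where k: "continuous_map (prod_topology ?I (fst Y)) (fst Y') k"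
    "\<And>x. x \<in> topspace (fst Y) \<Longrightarrow> k (0, x) = g x"
    "\<And>x. x \<in> topspace (fst Y) \<Longrightarrow> k (1, x) = g' x"
    "\<And>t. 0 \<le> t \<Longrightarrow> t \<le> 1 \<Longrightarrow> k (t, snd Y) = snd Y'"
    using pointed_homotopicE[OF g Y] by blast
  have hin: "h (t, x) \<in> topspace (fst X')" if "0 \<le> t" "t \<le> 1" "x \<in> topspace (fst X)" for t x
    using h(1) that by (auto simp: continuous_map_def Pi_iff)
  have kin: "k (t, x) \<in> topspace (fst Y')" if "0 \<le> t" "t \<le> 1" "x \<in> topspace (fst Y)" for t x
    using k(1) that by (auto simp: continuous_map_def Pi_iff)
  have base: "snd X' \<in> topspace (fst X')" "snd Y' \<in> topspace (fst Y')"
    using hin[of 0 "snd X"] kin[of 0 "snd Y"] h(4)[of 0] k(4)[of 0] X Y by (auto simp: pointed_space_def)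
  let ?H = "\<lambda>q. smash_map X' Y' (h (fst q, fst (snd q)), k (fst q, snd (snd q)))"
  have c: "continuous_map (prod_topology ?I (prod_topology (fst X) (fst Y))) (fst (smash X' Y')) ?H"
    by (rule continuous_map_compose_pair[OF continuous_map_smash_map]
        continuous_map_compose_pair[OF h(1)] continuous_map_compose_pair[OF k(1)]
        continuous_map_projections)+
  show ?thesis
  proof (rule pointed_homotopicI[of _ _ ?H])
    show "continuous_map (prod_topology ?I (fst (smash X Y))) (fst (smash X' Y')) ?H"
      unfolding smash_def[of X Y]
    proof (rule continuous_map_from_interval_collapse[OF c], goal_cases)
      case (1 w p)
      then show ?case
        using X Y base by (auto simp: smash_map_apply hin kin h(4) k(4) pointed_space_def)
    qed
  qed (use X Y base in \<open>auto simp: pointed_space_smash in_topspace_smash smash_map_apply hin kin h k pointed_space_def\<close>)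
qed

text \<open>Lets the statements about homotopies of smash products and suspensions serve as
  statements about induced maps.\<close>

lemma pointed_map_iff_homotopic: "pointed_map X Y f \<longleftrightarrow> pointed_homotopic X Y f f"
  by (simp add: pointed_map_def pointed_homotopic_def)

lemma smash_heq:
  assumes sp: "pointed_space X" "pointed_space Y" "pointed_space X'" "pointed_space Y'"
    and X: "pointed_heq X X'" and Y: "pointed_heq Y Y'"
  shows "pointed_heq (smash X Y) (smash X' Y')"
proof -
  \<comment> \<open>The two composites differ by exchanging source and target. The fresh type
    variables make the statement usable for both.\<close>
  have half: "pointed_homotopic (smash X Y) (smash X Y)
      ((\<lambda>p. smash_map X Y (g (fst p), g' (snd p))) \<circ> (\<lambda>p. smash_map X' Y' (f (fst p), f' (snd p)))) id"
    if sp: "pointed_space X" "pointed_space Y" "pointed_space X'" "pointed_space Y'"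
    and f: "pointed_map X X' f" "pointed_map X' X g" "pointed_homotopic X X (g \<circ> f) id"
    and f': "pointed_map Y Y' f'" "pointed_map Y' Y g'" "pointed_homotopic Y Y (g' \<circ> f') id"
    for X :: "'e pointed" and Y :: "'f pointed" and X' :: "'g pointed" and Y' :: "'h pointed" and f f' g g'
  proof -
    let ?F = "\<lambda>p. smash_map X Y ((g \<circ> f) (fst p), (g' \<circ> f') (snd p))"
    have "pointed_homotopic (smash X Y) (smash X Y) ?F (\<lambda>p. smash_map X Y (id (fst p), id (snd p)))"
      using smash_homotopic[OF sp(1,2) f(3) f'(3)] .
    then have 1: "pointed_homotopic (smash X Y) (smash X Y) ?F id"
      by (rule pointed_homotopic_trans, intro pointed_homotopic_eq)
         (use sp smash_homotopic[OF sp(1,2) pointed_map_id[of X, unfolded pointed_map_iff_homotopic]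
            pointed_map_id[of Y, unfolded pointed_map_iff_homotopic]] in
          \<open>auto simp: pointed_space_smash smash_map_id pointed_map_iff_homotopic\<close>)
    have "pointed_homotopic (smash X Y) (smash X Y) ?F
       ((\<lambda>p. smash_map X Y (g (fst p), g' (snd p))) \<circ> (\<lambda>p. smash_map X' Y' (f (fst p), f' (snd p))))"
    proof (rule pointed_homotopic_eq)
      show "pointed_map (smash X Y) (smash X Y) ?F"
        unfolding pointed_map_iff_homotopic
        by (intro smash_homotopic sp, unfold pointed_map_iff_homotopic[symmetric])
           (rule pointed_map_compose[OF f(1,2)] pointed_map_compose[OF f'(1,2)])+
    next
      fix p assume "p \<in> topspace (fst (smash X Y))"
      then show "?F p = ((\<lambda>p. smash_map X Y (g (fst p), g' (snd p))) \<circ> (\<lambda>p. smash_map X' Y' (f (fst p), f' (snd p)))) p"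
        using sp f(1,2) f'(1,2) pointed_map_in[OF f(1)] pointed_map_in[OF f'(1)]
          pointed_map_in[OF f(2)] pointed_map_in[OF f'(2)]
        by (cases p) (auto simp: in_topspace_smash smash_map_apply pointed_map_def pointed_space_def)
    qed (simp add: sp pointed_space_smash)
    then show ?thesis
      using 1 pointed_homotopic_sym pointed_homotopic_trans by blast
  qed
  obtain f g where f: "pointed_map X X' f" "pointed_map X' X g"
    "pointed_homotopic X X (g \<circ> f) id" "pointed_homotopic X' X' (f \<circ> g) id"
    using X unfolding pointed_heq_def by blast
  obtain f' g' where f': "pointed_map Y Y' f'" "pointed_map Y' Y g'"
    "pointed_homotopic Y Y (g' \<circ> f') id" "pointed_homotopic Y' Y' (f' \<circ> g') id"
    using Y unfolding pointed_heq_def by blast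
  show ?thesis
  proof (rule pointed_heqI)
    show "pointed_map (smash X Y) (smash X' Y') (\<lambda>p. smash_map X' Y' (f (fst p), f' (snd p)))"
      "pointed_map (smash X' Y') (smash X Y) (\<lambda>p. smash_map X Y (g (fst p), g' (snd p)))"
      using f f' unfolding pointed_map_iff_homotopic by (auto intro!: smash_homotopic sp)
  qed (auto intro!: half sp f f')
qed

lemma smash_contractible:
  assumes "pointed_space X" "pointed_space Y" "pointed_contractible X"
  shows "pointed_contractible (smash X Y)"
proof -
  have "pointed_homotopic (smash X Y) (smash X Y)
      (\<lambda>p. smash_map X Y (id (fst p), id (snd p))) (\<lambda>p. smash_map X Y (snd X, id (snd p)))"
    using smash_homotopic[OF assms(1,2) assms(3)[unfolded pointed_contractible_def]
        pointed_map_id[of Y, unfolded pointed_map_iff_homotopic]] .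
  then show ?thesis
    unfolding pointed_contractible_def pointed_homotopic_iff[OF pointed_space_smash[OF assms(1,2)]]
    using assms(1,2)
    by (elim ex_forward) (auto simp: smash_map_id in_topspace_smash smash_map_apply pointed_space_def)
qed

lemma smash_contractible_right:
  assumes "pointed_space X" "pointed_space Y" "pointed_contractible Y"
  shows "pointed_contractible (smash X Y)"
proof -
  have "pointed_homotopic (smash X Y) (smash X Y)
      (\<lambda>p. smash_map X Y (id (fst p), id (snd p))) (\<lambda>p. smash_map X Y (id (fst p), snd Y))"
    using smash_homotopic[OF assms(1,2) pointed_map_id[of X, unfolded pointed_map_iff_homotopic]
        assms(3)[unfolded pointed_contractible_def]] .
  then show ?thesis
    unfolding pointed_contractible_def pointed_homotopic_iff[OF pointed_space_smash[OF assms(1,2)]]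
    using assms(1,2)
    by (elim ex_forward) (auto simp: smash_map_id in_topspace_smash smash_map_apply pointed_space_def)
qed

section \<open>Reduced suspensions\<close>

definition susp_map :: "'a pointed \<Rightarrow> real \<times> 'a \<Rightarrow> real \<times> 'a" where
  "susp_map X = collapse_map ({0, 1} \<times> topspace (fst X) \<union> {0..1} \<times> {snd X}) (0, snd X)"

lemma susp_map_apply:
  "0 \<le> t \<Longrightarrow> t \<le> 1 \<Longrightarrow> x \<in> topspace (fst X) \<Longrightarrow>
    susp_map X (t, x) = (if t = 0 \<or> t = 1 \<or> x = snd X then (0, snd X) else (t, x))"
  by (auto simp: susp_map_def collapse_map_def)

lemma susp_map_base:
  "pointed_space X \<Longrightarrow> 0 \<le> t \<Longrightarrow> t \<le> 1 \<Longrightarrow> susp_map X (t, snd X) = (0, snd X)"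
  "x \<in> topspace (fst X) \<Longrightarrow> susp_map X (0, x) = (0, snd X)"
  "x \<in> topspace (fst X) \<Longrightarrow> susp_map X (1, x) = (0, snd X)"
  by (auto simp: susp_map_apply pointed_space_def)

lemma snd_susp [simp]: "snd (susp X) = (0, snd X)"
  by (simp add: susp_def)

lemma continuous_map_susp_map:
  "continuous_map (prod_topology (top_of_set {0..1}) (fst X)) (fst (susp X)) (susp_map X)"
  by (simp add: susp_def susp_map_def continuous_map_collapse_map)

lemma pointed_space_susp: "pointed_space X \<Longrightarrow> pointed_space (susp X)"
  unfolding susp_def by (intro pointed_space_collapse) (auto simp: pointed_space_def)

lemma in_topspace_susp:
  assumes "pointed_space X"
  shows "(t, x) \<in> topspace (fst (susp X)) \<longleftrightarrow> 0 \<le> t \<and> t \<le> 1 \<and> x \<in> topspace (fst X) \<and>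
    (t = 0 \<or> t = 1 \<or> x = snd X \<longrightarrow> t = 0 \<and> x = snd X)"
  using assms unfolding susp_def
  by (subst in_topspace_collapse) (auto simp: pointed_space_def)

lemma susp_map_id:
  assumes "pointed_space X" "p \<in> topspace (fst (susp X))"
  shows "susp_map X p = p"
  using assms by (cases p) (auto simp: in_topspace_susp susp_map_apply)

text \<open>The suspension coordinate may be deformed along with the map, provided \<open>c\<close>
  fixes both ends. The choice of \<open>c\<close> as the second projection gives functoriality; an
  interpolation between \<open>pinch\<close> and the identity gives
  \<open>susp_pinch_homotopic\<close>.\<close>

lemma susp_homotopic:
  assumes X: "pointed_space X" and f: "pointed_homotopic X Y f g"
    and c: "continuous_map (prod_topology (top_of_set {0..1}) (top_of_set {0..1})) (top_of_set {0..1}) c"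
    and c01: "\<And>u. 0 \<le> u \<Longrightarrow> u \<le> 1 \<Longrightarrow> c (u, 0) = 0" "\<And>u. 0 \<le> u \<Longrightarrow> u \<le> 1 \<Longrightarrow> c (u, 1) = (1 :: real)"
  shows "pointed_homotopic (susp X) (susp Y)
    (\<lambda>p. susp_map Y (c (0 :: real, fst p), f (snd p))) (\<lambda>p. susp_map Y (c (1, fst p), g (snd p)))"
proof -
  let ?I = "top_of_set {0..1::real}"
  obtain h where h: "continuous_map (prod_topology ?I (fst X)) (fst Y) h"
    "\<And>x. x \<in> topspace (fst X) \<Longrightarrow> h (0, x) = f x"
    "\<And>x. x \<in> topspace (fst X) \<Longrightarrow> h (1, x) = g x"
    "\<And>t. 0 \<le> t \<Longrightarrow> t \<le> 1 \<Longrightarrow> h (t, snd X) = snd Y"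
    using pointed_homotopicE[OF f X] by blast
  have hin: "h (t, x) \<in> topspace (fst Y)" if "0 \<le> t" "t \<le> 1" "x \<in> topspace (fst X)" for t x
    using h(1) that by (auto simp: continuous_map_def Pi_iff)
  have base: "snd Y \<in> topspace (fst Y)"
    using hin[of 0 "snd X"] h(4)[of 0] X by (auto simp: pointed_space_def)
  have cin: "0 \<le> c (u, t) \<and> c (u, t) \<le> 1" if "0 \<le> t" "t \<le> 1" "0 \<le> u" "u \<le> 1" for t u
    using c that by (auto simp: continuous_map_def Pi_iff)
  let ?H = "\<lambda>q. susp_map Y (c (fst q, fst (snd q)), h (fst q, snd (snd q)))"
  have H: "continuous_map (prod_topology ?I (prod_topology ?I (fst X))) (fst (susp Y)) ?H"
    by (rule continuous_map_compose_pair[OF continuous_map_susp_map]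
        continuous_map_compose_pair[OF h(1)] continuous_map_compose_pair[OF c]
        continuous_map_projections)+
  show ?thesis
  proof (rule pointed_homotopicI[of _ _ ?H])
    show "continuous_map (prod_topology ?I (fst (susp X))) (fst (susp Y)) ?H"
      unfolding susp_def[of X]
    proof (rule continuous_map_from_interval_collapse[OF H], goal_cases)
      case (1 w p)
      then show ?case
        using X base by (auto simp: susp_map_apply hin cin h(4) c01 pointed_space_def)
    qed
  qed (use X base in \<open>auto simp: pointed_space_susp in_topspace_susp susp_map_apply hin cin c01 h pointed_space_def\<close>)
qed

lemma susp_homotopic_map:
  assumes "pointed_space X" "pointed_homotopic X Y f g"
  shows "pointed_homotopic (susp X) (susp Y)
    (\<lambda>p. susp_map Y (fst p, f (snd p))) (\<lambda>p. susp_map Y (fst p, g (snd p)))"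
  using susp_homotopic[OF assms continuous_map_snd] by simp

lemma susp_heq:
  assumes sp: "pointed_space X" "pointed_space Y" and XY: "pointed_heq X Y"
  shows "pointed_heq (susp X) (susp Y)"
proof -
  have half: "pointed_homotopic (susp X) (susp X)
      ((\<lambda>p. susp_map X (fst p, g (snd p))) \<circ> (\<lambda>p. susp_map Y (fst p, f (snd p)))) id"
    if sp: "pointed_space X" "pointed_space Y"
    and f: "pointed_map X Y f" "pointed_map Y X g" "pointed_homotopic X X (g \<circ> f) id"
    for X :: "'e pointed" and Y :: "'f pointed" and f g
  proof -
    show ?thesis
    proof (rule pointed_homotopic_cong[OF susp_homotopic_map[OF sp(1) f(3)]])
      show "pointed_space (susp X)" by (rule pointed_space_susp[OF sp(1)])
      fix p assume p: "p \<in> topspace (fst (susp X))"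
      then show "susp_map X (fst p, id (snd p)) = id p"
        using susp_map_id[OF sp(1)] by simp
      obtain t x where tx: "p = (t, x)" "0 \<le> t" "t \<le> 1" "x \<in> topspace (fst X)"
        using p sp(1) by (cases p) (simp add: in_topspace_susp)
      have "f (snd X) = snd Y" "g (snd Y) = snd X" "f x \<in> topspace (fst Y)" "g (f x) \<in> topspace (fst X)"
        using f(1,2) pointed_map_in[OF f(1) tx(4)] pointed_map_in[OF f(2)] by (auto simp: pointed_map_def)
      then show "susp_map X (fst p, (g \<circ> f) (snd p)) =
          ((\<lambda>p. susp_map X (fst p, g (snd p))) \<circ> (\<lambda>p. susp_map Y (fst p, f (snd p)))) p"
        using tx sp by (simp add: susp_map_apply pointed_space_def)
    qed
  qed
  obtain f g where f: "pointed_map X Y f" "pointed_map Y X g"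
    "pointed_homotopic X X (g \<circ> f) id" "pointed_homotopic Y Y (f \<circ> g) id"
    using XY unfolding pointed_heq_def by blast
  show ?thesis
  proof (rule pointed_heqI)
    show "pointed_map (susp X) (susp Y) (\<lambda>p. susp_map Y (fst p, f (snd p)))"
      "pointed_map (susp Y) (susp X) (\<lambda>p. susp_map X (fst p, g (snd p)))"
      using f unfolding pointed_map_iff_homotopic by (auto intro!: susp_homotopic_map sp)
  qed (auto intro!: half sp f)
qed

text \<open>
  In arbitrary spaces the product with \<open>X\<close> need not preserve the quotient map onto the suspension.
  It does so for maps that are constant near both ends of the suspension coordinate.
\<close>

lemma continuous_map_prod_susp:
  assumes A: "pointed_space A"
    and g: "continuous_map (prod_topology X (prod_topology (top_of_set {0..1::real}) (fst A))) Z g"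
    and const: "\<And>x t a. x \<in> topspace X \<Longrightarrow> 0 \<le> t \<Longrightarrow> t \<le> 1 \<Longrightarrow> a \<in> topspace (fst A) \<Longrightarrow>
      a = snd A \<or> t \<le> 1/3 \<or> 2/3 \<le> t \<Longrightarrow> g (x, t, a) = g (x, 0, snd A)"
  shows "continuous_map (prod_topology X (fst (susp A))) Z g"
proof -
  let ?I = "top_of_set {0..1::real}"
  let ?IA = "prod_topology ?I (fst A)"
  let ?B = "{0, 1} \<times> topspace (fst A) \<union> {0..1} \<times> {snd A}"
  have a0: "snd A \<in> topspace (fst A)"
    using A by (simp add: pointed_space_def)
  have sub: "p \<in> topspace ?IA" "p \<in> ?B \<Longrightarrow> p = (0, snd A)" if "p \<in> topspace (fst (susp A))" for p
    using that A by (cases p, auto simp: in_topspace_susp)+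
  \<comment> \<open>An open set of the cylinder descends to the suspension if it contains or misses
    the whole collapsed set. The rest of the proof finds neighbourhoods of this kind.\<close>
  have openS: "openin (fst (susp A)) (W \<inter> topspace (fst (susp A)))"
    if W: "openin ?IA W" and sat: "?B \<subseteq> W \<or> ?B \<inter> W = {}" for W
  proof -
    have "(0, snd A) \<in> ?B" using a0 by auto
    have W': "W \<subseteq> topspace ?IA" using openin_subset[OF W] .
    have "{p \<in> topspace ?IA. collapse_map ?B (0, snd A) p \<in> W \<inter> topspace (fst (susp A))} = W"
    proof (intro set_eqI)
      fix p
      have "collapse_map ?B (0, snd A) p \<in> topspace (fst (susp A))" if "p \<in> topspace ?IA"
        using that a0 A by (cases p) (auto simp: collapse_map_def in_topspace_susp)
      then show "p \<in> {p \<in> topspace ?IA. collapse_map ?B (0, snd A) p \<in> W \<inter> topspace (fst (susp A))} \<longleftrightarrow> p \<in> W"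
        using W' sat \<open>(0, snd A) \<in> ?B\<close> unfolding collapse_map_def
        by (smt (verit) IntI Int_iff emptyE mem_Collect_eq subsetD)
    qed
    moreover have "W \<inter> topspace (fst (susp A)) \<subseteq> collapse_map ?B (0, snd A) ` topspace ?IA"
      by (auto simp: susp_def collapse_eq topspace_quot_topology)
    ultimately show ?thesis
      using W by (subst (1) susp_def, subst collapse_eq, simp only: fst_conv openin_quot_topology)
  qed
  show ?thesis
    unfolding continuous_map
  proof (intro conjI allI impI)
    show "g ` topspace (prod_topology X (fst (susp A))) \<subseteq> topspace Z"
    proof clarify
      fix x t a assume "(x, t, a) \<in> topspace (prod_topology X (fst (susp A)))"
      then have "(x, t, a) \<in> topspace (prod_topology X ?IA)"
        using sub(1)[of "(t, a)"] by simp
      then show "g (x, t, a) \<in> topspace Z"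
        using g by (simp only: continuous_map_def Pi_iff)
    qed
  next
    fix U assume U: "openin Z U"
    define V where "V = {p \<in> topspace (prod_topology X ?IA). g p \<in> U}"
    have V: "openin (prod_topology X ?IA) V"
      using g U unfolding V_def by (auto simp: continuous_map)
    show "openin (prod_topology X (fst (susp A))) {p \<in> topspace (prod_topology X (fst (susp A))). g p \<in> U}"
      unfolding openin_prod_topology_alt
    proof (intro allI impI)
      fix x p
      assume xp: "(x, p) \<in> {p \<in> topspace (prod_topology X (fst (susp A))). g p \<in> U}"
      then have x: "x \<in> topspace X" and p: "p \<in> topspace (fst (susp A))" by auto
      have "(x, p) \<in> V"
        using xp sub(1)[OF p] by (simp add: V_def)
      then obtain N' W' where W': "openin X N'" "openin ?IA W'" "x \<in> N'" "p \<in> W'" "N' \<times> W' \<subseteq> V"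
        using iffD1[OF openin_prod_topology_alt V] by meson
      have "\<exists>N W. openin X N \<and> openin ?IA W \<and> x \<in> N \<and> p \<in> W \<and> (?B \<subseteq> W \<or> ?B \<inter> W = {}) \<and> N \<times> W \<subseteq> V"
      proof (cases "g (x, 0, snd A) \<in> U")
        case True
        \<comment> \<open>The segment over \<open>x\<close> and the base point of \<open>A\<close>
          lies in \<open>V\<close>. With the interval as last coordinate, the tube lemma thickens
          the segment to a neighbourhood that is uniform in \<open>t\<close>.\<close>
        define V' where "V' = {q \<in> topspace (prod_topology (prod_topology X (fst A)) ?I).
            (fst (fst q), snd q, snd (fst q)) \<in> V}"
        have "continuous_map (prod_topology (prod_topology X (fst A)) ?I) (prod_topology X ?IA)
            (\<lambda>q. (fst (fst q), snd q, snd (fst q)))"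
          by (rule continuous_map_pairedI continuous_map_projections)+
        then have V': "openin (prod_topology (prod_topology X (fst A)) ?I) V'"
          unfolding V'_def by (rule openin_continuous_map_preimage[OF _ V])
        have "{(x, snd A)} \<times> {0..1} \<subseteq> V'"
        proof clarify
          fix t :: real assume t: "t \<in> {0..1}"
          then have "g (x, t, snd A) = g (x, 0, snd A)"
            using x a0 by (intro const) auto
          then show "((x, snd A), t) \<in> V'"
            using t x a0 True by (simp add: V'_def V_def)
        qed
        moreover have "compactin ?I {0..1}"
          by (simp add: compactin_subtopology)
        ultimately obtain U1 U2 where U1: "openin (prod_topology X (fst A)) U1" "(x, snd A) \<in> U1"
            "{0..1} \<subseteq> U2" "U1 \<times> U2 \<subseteq> V'"
          using tube_lemma_right[OF V', of "{0..1}" "(x, snd A)"] x a0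
          unfolding topspace_prod_topology by (meson SigmaI)
        then obtain N Y where N: "openin X N" "openin (fst A) Y" "x \<in> N" "snd A \<in> Y" "N \<times> Y \<subseteq> U1"
          using iffD1[OF openin_prod_topology_alt U1(1)] by meson
        have NY: "(x', t, a) \<in> V" if "x' \<in> N" "a \<in> Y" "0 \<le> t" "t \<le> 1" for x' t a
        proof -
          have "((x', a), t) \<in> V'"
            using that N(5) U1(3,4) by (meson SigmaI atLeastAtMost_iff subsetD)
          then show ?thesis by (simp add: V'_def)
        qed
        \<comment> \<open>On these two collars \<open>g\<close> has the same value as at the base
          point, so all of \<open>A\<close> can be adjoined over them without leaving
          \<open>V\<close>. The collars contain both ends of the interval.\<close>
        define J where "J = {t \<in> {0..1::real}. t < 1/3} \<union> {t \<in> {0..1}. 2/3 < t}"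
        have J: "openin ?I J"
        proof -
          have "J = ({0..1} \<inter> {..<1/3}) \<union> ({0..1} \<inter> {2/3<..})"
            by (auto simp: J_def)
          then show ?thesis
            using openin_open_Int[OF open_lessThan, of "{0..1}" "1/3::real"]
              openin_open_Int[OF open_greaterThan, of "{0..1}" "2/3::real"] by (simp add: openin_Un)
        qed
        define W where "W = J \<times> topspace (fst A) \<union> {0..1} \<times> Y"
        have W: "openin ?IA W"
          using J N(2) openin_topspace[of ?I] unfolding W_def
          by (intro openin_Un) (auto simp: openin_prod_Times_iff)
        have NW: "N \<times> W \<subseteq> V"
        proof (clarify)
          fix x' t a assume x': "x' \<in> N" and ta: "(t, a) \<in> W"
          have x'X: "x' \<in> topspace X" using x' openin_subset[OF N(1)] by auto
          show "(x', t, a) \<in> V"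
          proof (cases "a \<in> Y \<and> 0 \<le> t \<and> t \<le> 1")
            case True then show ?thesis using NY x' by auto
          next
            case False
            then have t: "t \<in> J" "a \<in> topspace (fst A)" using ta by (auto simp: W_def)
            have "g (x', 0, snd A) \<in> U" using NY[OF x' N(4), of 0] by (auto simp: V_def)
            moreover have "g (x', t, a) = g (x', 0, snd A)"
              using t x'X by (intro const) (auto simp: J_def)
            ultimately show ?thesis using t x'X by (auto simp: V_def J_def)
          qed
        qed
        show ?thesis
        proof (intro exI conjI)
          show "openin X (N \<inter> N')" "openin ?IA (W \<union> W')"
            using N W W' by auto
          show "(N \<inter> N') \<times> (W \<union> W') \<subseteq> V" using NW W'(5) by auto
          show "?B \<subseteq> W \<union> W' \<or> ?B \<inter> (W \<union> W') = {}"
            using N(4) a0 by (auto simp: W_def J_def)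
        qed (use N W' in auto)
      next
        case False
        \<comment> \<open>At \<open>x\<close> every collapsed point has the value
          \<open>g (x, 0, snd A)\<close>, which lies outside \<open>U\<close>; hence a box around
          \<open>x\<close> inside \<open>V\<close> misses all of them.\<close>
        have "?B \<inter> W' = {}"
        proof -
          have "q \<notin> W'" if "q \<in> ?B" for q
          proof
            assume q: "q \<in> W'"
            have "(x, q) \<in> V" using q W' by blast
            moreover have "g (x, q) = g (x, 0, snd A)"
              using that x a0 by (cases q) (auto intro!: const)
            ultimately show False using False by (simp add: V_def)
          qed
          then show ?thesis by blast
        qed
        then show ?thesis using W' by blast
      qed
      then obtain N W where W: "openin X N" "openin ?IA W" "x \<in> N" "p \<in> W"
        "?B \<subseteq> W \<or> ?B \<inter> W = {}" "N \<times> W \<subseteq> V" by blast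
      show "\<exists>N W. openin X N \<and> openin (fst (susp A)) W \<and> x \<in> N \<and> p \<in> W \<and>
          N \<times> W \<subseteq> {p \<in> topspace (prod_topology X (fst (susp A))). g p \<in> U}"
      proof (intro exI conjI)
        show "openin (fst (susp A)) (W \<inter> topspace (fst (susp A)))"
          using openS W by blast
        show "N \<times> (W \<inter> topspace (fst (susp A))) \<subseteq>
            {p \<in> topspace (prod_topology X (fst (susp A))). g p \<in> U}"
          using W(6) openin_subset[OF W(1)] by (auto simp: V_def)
      qed (use W p in auto)
    qed
  qed
qed

text \<open>The thirds match the collars in \<open>continuous_map_prod_susp\<close>: after
  reparametrization by \<open>pinch\<close> a map is constant near both ends of the suspension
  coordinate.\<close>

definition pinch :: "real \<Rightarrow> real" where
  "pinch t = max 0 (min 1 (3 * t - 1))"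

text \<open>The straight line from \<open>pinch\<close> to the identity stays in the unit interval
  and fixes both of its ends.\<close>

lemma susp_pinch_homotopic:
  assumes "pointed_space X"
  shows "pointed_homotopic (susp X) (susp X) (\<lambda>p. susp_map X (pinch (fst p), snd p)) id"
proof -
  let ?I = "top_of_set {0..1::real}"
  let ?c = "\<lambda>q. (1 - fst q) * pinch (snd q) + fst q * snd q"
  have cl: "0 \<le> pinch t" "pinch t \<le> 1" for t
    by (auto simp: pinch_def)
  have "continuous_map (prod_topology ?I ?I) ?I ?c"
  proof (rule continuous_map_into_unit_interval)
    have "continuous_on ({0..1} \<times> {0..1}) ?c"
      unfolding pinch_def by (intro continuous_intros)
    then show "continuous_map (prod_topology ?I ?I) euclideanreal ?c"
      by (simp add: prod_topology_subtopology_eu)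
    fix q :: "real \<times> real" assume "q \<in> topspace (prod_topology ?I ?I)"
    then have q: "0 \<le> fst q" "fst q \<le> 1" "0 \<le> snd q" "snd q \<le> 1" by auto
    have "(1 - fst q) * pinch (snd q) + fst q * snd q \<le> (1 - fst q) * 1 + fst q * 1"
      using q cl by (intro add_mono mult_left_mono) auto
    then show "0 \<le> ?c q \<and> ?c q \<le> 1" using q cl by auto
  qed
  then have "pointed_homotopic (susp X) (susp X)
    (\<lambda>p. susp_map X (?c (0, fst p), id (snd p))) (\<lambda>p. susp_map X (?c (1, fst p), id (snd p)))"
    by (rule susp_homotopic[OF assms pointed_map_id[unfolded pointed_map_iff_homotopic]])
       (simp_all add: pinch_def)
  then show ?thesis
    by (rule pointed_homotopic_cong) (simp_all add: pointed_space_susp susp_map_id assms)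
qed

text \<open>The obvious exchange of coordinates may fail to be continuous on
  \<open>smash X (susp A)\<close>, as \<open>X\<close> is arbitrary. The map \<open>?f\<close>
  therefore applies \<open>pinch\<close> first. The reverse map \<open>?g\<close> comes from a
  product with the interval and can be taken literally. Both composites are then reparametrizations
  by \<open>pinch\<close>.\<close>

lemma smash_susp:
  assumes X: "pointed_space X" and A: "pointed_space A"
  shows "pointed_heq (smash X (susp A)) (susp (smash X A))"
proof -
  let ?I = "top_of_set {0..1::real}"
  let ?f = "\<lambda>q. susp_map (smash X A) (pinch (fst (snd q)), smash_map X A (fst q, snd (snd q)))"
  let ?g = "\<lambda>q. smash_map X (susp A) (fst (snd q), susp_map A (fst q, snd (snd q)))"
  have base: "snd X \<in> topspace (fst X)" "snd A \<in> topspace (fst A)"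
    using X A by (auto simp: pointed_space_def)
  have cl: "0 \<le> pinch t" "pinch t \<le> 1" for t
    by (auto simp: pinch_def)
  have smin: "smash_map X A (x, a) \<in> topspace (fst (smash X A))"
    if "x \<in> topspace (fst X)" "a \<in> topspace (fst A)" for x a
    using that base X A by (auto simp: smash_map_apply in_topspace_smash)
  have suin: "susp_map A (t, a) \<in> topspace (fst (susp A))"
    if "0 \<le> t" "t \<le> 1" "a \<in> topspace (fst A)" for t a
    using that base A by (auto simp: susp_map_apply in_topspace_susp)
  note sps = pointed_space_smash[OF X A] pointed_space_susp[OF A]
  have conv: "continuous_map ?I ?I pinch"
    by (rule continuous_map_into_unit_interval)
       (auto simp: pinch_def[abs_def] intro!: continuous_intros)
  note simps = smash_map_base[OF X A] smash_map_base[OF X sps(2), simplified]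
    susp_map_base(1)[OF A] susp_map_base(1)[OF sps(1), simplified]
  have f: "continuous_map (fst (smash X (susp A))) (fst (susp (smash X A))) ?f"
    unfolding smash_def[of X "susp A"]
  proof (rule continuous_map_from_collapse)
    show "continuous_map (prod_topology (fst X) (fst (susp A))) (fst (susp (smash X A))) ?f"
    proof (rule continuous_map_prod_susp[OF A])
      show "continuous_map (prod_topology (fst X) (prod_topology ?I (fst A))) (fst (susp (smash X A))) ?f"
        by (rule continuous_map_compose_pair[OF continuous_map_susp_map]
            continuous_map_compose_pair[OF continuous_map_smash_map]
            continuous_map_compose_arg[OF conv] continuous_map_projections)+
      show "?f (x, t, a) = ?f (x, 0, snd A)"
        if "x \<in> topspace (fst X)" "0 \<le> t" "t \<le> 1" "a \<in> topspace (fst A)"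
          and end_cases: "a = snd A \<or> t \<le> 1/3 \<or> 2/3 \<le> t" for x t a
      proof -
        consider "a = snd A" | "pinch t = 0" | "pinch t = 1"
          using end_cases by (auto simp: pinch_def)
        then show ?thesis
          using that(1,4) base cl smin[OF that(1,4)]
          by cases (auto simp: simps susp_map_base(2,3))
      qed
    qed
  next
    fix q assume "q \<in> topspace (prod_topology (fst X) (fst (susp A)))"
      "q \<in> {snd X} \<times> topspace (fst (susp A)) \<union> topspace (fst X) \<times> {snd (susp A)}"
    then consider t a where "q = (snd X, t, a)" "a \<in> topspace (fst A)"
      | x where "q = (x, 0, snd A)" "x \<in> topspace (fst X)"
      using A by (cases q) (auto simp: in_topspace_susp)
    then show "?f q = ?f (snd X, snd (susp A))"
      using base cl by cases (auto simp: simps)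
  qed
  have g: "continuous_map (fst (susp (smash X A))) (fst (smash X (susp A))) ?g"
    unfolding susp_def[of "smash X A"]
  proof (rule continuous_map_from_collapse)
    show "continuous_map (prod_topology ?I (fst (smash X A))) (fst (smash X (susp A))) ?g"
      unfolding smash_def[of X A]
    proof (rule continuous_map_from_interval_collapse)
      show "continuous_map (prod_topology ?I (prod_topology (fst X) (fst A))) (fst (smash X (susp A))) ?g"
        by (rule continuous_map_compose_pair[OF continuous_map_smash_map]
            continuous_map_compose_pair[OF continuous_map_susp_map] continuous_map_projections)+
      fix t q assume t: "t \<in> topspace ?I" and "q \<in> topspace (prod_topology (fst X) (fst A))"
        "q \<in> {snd X} \<times> topspace (fst A) \<union> topspace (fst X) \<times> {snd A}"
      then consider a where "q = (snd X, a)" "a \<in> topspace (fst A)"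
        | x where "q = (x, snd A)" "x \<in> topspace (fst X)" by auto
      then show "?g (t, q) = ?g (t, (snd X, snd A))"
        using t base suin by cases (auto simp: simps)
    qed
  next
    fix q assume "q \<in> topspace (prod_topology ?I (fst (smash X A)))"
      "q \<in> {0, 1} \<times> topspace (fst (smash X A)) \<union> {0..1} \<times> {snd (smash X A)}"
    then consider t where "q = (t, snd X, snd A)" "0 \<le> t" "t \<le> 1"
      | t x a where "q = (t, x, a)" "t = 0 \<or> t = 1" "x \<in> topspace (fst X)" "a \<in> topspace (fst A)"
      using X A by (cases q) (auto simp: in_topspace_smash)
    then show "?g q = ?g (0, snd (smash X A))"
      using base by cases (auto simp: simps susp_map_base(2,3))
  qed
  show ?thesis
  proof (rule pointed_heqI)
    show "pointed_map (smash X (susp A)) (susp (smash X A)) ?f"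
      using f base cl by (auto simp: pointed_map_def simps)
    show "pointed_map (susp (smash X A)) (smash X (susp A)) ?g"
      using g base suin by (auto simp: pointed_map_def simps)
    let ?h = "\<lambda>p. smash_map X (susp A) (id (fst p), susp_map A (pinch (fst (snd p)), snd (snd p)))"
    have h: "pointed_homotopic (smash X (susp A)) (smash X (susp A))
        ?h (\<lambda>p. smash_map X (susp A) (id (fst p), id (snd p)))"
      by (rule smash_homotopic[OF X sps(2) pointed_map_id[unfolded pointed_map_iff_homotopic]
            susp_pinch_homotopic[OF A]])
    show "pointed_homotopic (smash X (susp A)) (smash X (susp A)) (?g \<circ> ?f) id"
    proof (rule pointed_homotopic_cong[OF h pointed_space_smash[OF X sps(2)]])
      fix p assume p: "p \<in> topspace (fst (smash X (susp A)))"
      show "smash_map X (susp A) (id (fst p), id (snd p)) = id p"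
        using smash_map_id[OF X sps(2) p] by simp
      consider "p = (snd X, 0, snd A)"
        | x t a where "p = (x, t, a)" "x \<in> topspace (fst X)" "x \<noteq> snd X"
          "a \<in> topspace (fst A)" "a \<noteq> snd A"
        using p X A sps by (cases p) (auto simp: in_topspace_smash in_topspace_susp)
      then show "?h p = (?g \<circ> ?f) p"
      proof cases
        case 1
        then show ?thesis using base cl suin by (simp add: simps)
      next
        case 2
        have xa: "smash_map X A (x, a) = (x, a)"
          using 2 by (simp add: smash_map_apply)
        have "(x, a) \<in> topspace (fst (smash X A))" using smin[of x a] 2 xa by simp
        then show ?thesis using 2 base cl
          by (auto simp: xa susp_map_apply[of _ _ "smash X A"] susp_map_apply[of _ a A] simps susp_map_base(2,3))
      qed
    qed
    let ?k = "\<lambda>p. susp_map (smash X A) (pinch (fst p), snd p)"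
    have k: "pointed_homotopic (susp (smash X A)) (susp (smash X A)) ?k id"
      by (rule susp_pinch_homotopic[OF sps(1)])
    show "pointed_homotopic (susp (smash X A)) (susp (smash X A)) (?f \<circ> ?g) id"
    proof (rule pointed_homotopic_cong[OF k pointed_space_susp[OF sps(1)]])
      fix p assume p: "p \<in> topspace (fst (susp (smash X A)))"
      obtain t x a where "p = (t, x, a)" by (cases p)
      with p consider "p = (0, snd X, snd A)"
        | "p = (t, x, a)" "0 < t" "t < 1" "x \<in> topspace (fst X)" "x \<noteq> snd X"
          "a \<in> topspace (fst A)" "a \<noteq> snd A"
        using X A sps by (cases "t = 0"; cases "t = 1") (auto simp: in_topspace_smash in_topspace_susp)
      then show "?k p = (?f \<circ> ?g) p"
      proof cases
        case 1
        then show ?thesis using base cl suin by (simp add: simps)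
      next
        case 2
        have xa: "smash_map X A (x, a) = (x, a)" and ta: "susp_map A (t, a) = (t, a)"
          using 2 by (auto simp: smash_map_apply susp_map_apply)
        then have "(t, a) \<in> topspace (fst (susp A))" using suin[of t a] 2 by simp
        then show ?thesis using 2 by (simp add: xa ta smash_map_apply[of x X _ "susp A"])
      qed
    qed simp
  qed
qed

section \<open>Cofibrations\<close>

text \<open>
  The space \<open>M\<close> in the proof is the reduced mapping cylinder of \<open>i\<close>. An extension into this single
  target yields extensions into targets of any type.
\<close>

lemma pointed_hep_extend:
  fixes X :: "'a pointed" and Y :: "'b pointed" and Z :: "'c pointed"
  assumes X: "pointed_space X" and Y: "pointed_space Y" and Z: "pointed_space Z"
    and hep: "pointed_hep X Y i" and i: "pointed_map X Y i" and inj: "inj_on i (topspace (fst X))"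
    and f: "pointed_map Y Z f"
    and h: "continuous_map (prod_topology (top_of_set {0..1::real}) (fst X)) (fst Z) h"
    and h_base: "\<And>t. 0 \<le> t \<Longrightarrow> t \<le> 1 \<Longrightarrow> h (t, snd X) = snd Z"
    and h0: "\<And>x. x \<in> topspace (fst X) \<Longrightarrow> h (0, x) = f (i x)"
  obtains H where "continuous_map (prod_topology (top_of_set {0..1::real}) (fst Y)) (fst Z) H"
    and "\<And>t. 0 \<le> t \<Longrightarrow> t \<le> 1 \<Longrightarrow> H (t, snd Y) = snd Z"
    and "\<And>y. y \<in> topspace (fst Y) \<Longrightarrow> H (0, y) = f y"
    and "\<And>t x. 0 \<le> t \<Longrightarrow> t \<le> 1 \<Longrightarrow> x \<in> topspace (fst X) \<Longrightarrow> H (t, i x) = h (t, x)"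
proof -
  let ?I = "top_of_set {0..1::real}"
  let ?IX = "prod_topology ?I (fst X)"
  have bX: "snd X \<in> topspace (fst X)" and bY: "snd Y \<in> topspace (fst Y)" and ib: "i (snd X) = snd Y"
    using X Y i by (auto simp: pointed_space_def pointed_map_def)
  \<comment> \<open>The segment over the base point is pushed down to height 0, so that the cylinder
    is reduced.\<close>
  define m where "m = (\<lambda>(t, x). (i x, if x = snd X then 0 else t :: real))"
  define C where "C = (\<lambda>y. (y, 0)) ` topspace (fst Y) \<union> m ` topspace ?IX"
  \<comment> \<open>The pushout topology: a set is open if its preimages in \<open>Y\<close> and in
    the cylinder over \<open>X\<close> are open.\<close>
  define op where "op U \<longleftrightarrow> U \<subseteq> C \<and> openin (fst Y) {y \<in> topspace (fst Y). (y, 0) \<in> U} \<and>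
    openin ?IX {p \<in> topspace ?IX. m p \<in> U}" for U
  have "istopology op"
    unfolding istopology_def
  proof (intro conjI allI impI)
    fix S T assume S: "op S" and T: "op T"
    have 1: "{y \<in> topspace (fst Y). (y, 0) \<in> S \<inter> T} =
        {y \<in> topspace (fst Y). (y, 0) \<in> S} \<inter> {y \<in> topspace (fst Y). (y, 0) \<in> T}" by blast
    have 2: "{p \<in> topspace ?IX. m p \<in> S \<inter> T} =
        {p \<in> topspace ?IX. m p \<in> S} \<inter> {p \<in> topspace ?IX. m p \<in> T}" by blast
    show "op (S \<inter> T)"
      unfolding op_def 1 2
    proof (intro conjI openin_Int)
      show "S \<inter> T \<subseteq> C" using S by (auto simp only: op_def)
    qed (use S T in \<open>simp_all only: op_def\<close>)
  next
    fix K assume K: "\<forall>S\<in>K. op S"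
    have 1: "{y \<in> topspace (fst Y). (y, 0) \<in> \<Union>K} = (\<Union>S\<in>K. {y \<in> topspace (fst Y). (y, 0) \<in> S})"
      by blast
    have 2: "{p \<in> topspace ?IX. m p \<in> \<Union>K} = (\<Union>S\<in>K. {p \<in> topspace ?IX. m p \<in> S})"
      by blast
    show "op (\<Union>K)"
      unfolding op_def 1 2
    proof (intro conjI openin_Union)
      show "\<Union>K \<subseteq> C" using K by (auto simp only: op_def)
    qed (use K in \<open>auto simp only: op_def\<close>)
  qed
  then have op: "openin (topology op) U \<longleftrightarrow> op U" for U
    by (simp add: topology_inverse')
  have "op C"
  proof -
    have 1: "{y \<in> topspace (fst Y). (y, 0) \<in> C} = topspace (fst Y)"
      unfolding C_def by blast
    have 2: "{p \<in> topspace ?IX. m p \<in> C} = topspace ?IX"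
      unfolding C_def by blast
    show ?thesis
      unfolding op_def 1 2 by (intro conjI subset_refl openin_topspace)
  qed
  then have topM: "topspace (topology op) = C"
    unfolding topspace_def op by (auto simp only: op_def)
  define M where "M = (topology op, (snd Y, 0 :: real))"
  have M: "pointed_space M"
    using bY by (auto simp: pointed_space_def M_def topM C_def)
  have e: "pointed_map Y M (\<lambda>y. (y, 0))"
    unfolding pointed_map_def M_def continuous_map by (auto simp: topM op op_def C_def)
  have m: "continuous_map ?IX (fst M) m"
    unfolding M_def continuous_map fst_conv topM op by (simp add: op_def C_def)
  have m_base: "m (t, snd X) = snd M" for t
    by (simp add: m_def M_def ib)
  \<comment> \<open>The universal instance: the tautological homotopy \<open>m\<close> is extended
    over \<open>Y\<close>. Every other extension is \<open>r\<close> followed by a map out of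
    \<open>M\<close>.\<close>
  obtain r where r: "continuous_map (prod_topology ?I (fst Y)) (fst M) r"
    "\<And>t. 0 \<le> t \<Longrightarrow> t \<le> 1 \<Longrightarrow> r (t, snd Y) = snd M"
    "\<And>y. y \<in> topspace (fst Y) \<Longrightarrow> r (0, y) = (y, 0)"
    "\<And>t x. 0 \<le> t \<Longrightarrow> t \<le> 1 \<Longrightarrow> x \<in> topspace (fst X) \<Longrightarrow> r (t, i x) = m (t, x)"
  proof -
    have m0: "\<forall>x\<in>topspace (fst X). m (0, x) = (i x, 0)"
      by (simp add: m_def)
    have "\<exists>H. continuous_map (prod_topology ?I (fst Y)) (fst M) H \<and>
        (\<forall>t\<in>{0..1}. H (t, snd Y) = snd M) \<and> (\<forall>y\<in>topspace (fst Y). H (0, y) = (y, 0)) \<and>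
        (\<forall>t\<in>{0..1}. \<forall>x\<in>topspace (fst X). H (t, i x) = m (t, x))"
      using hep[unfolded pointed_hep_def, rule_format, of M "\<lambda>y. (y, 0)" m] M e m m_base m0
      by blast
    then show ?thesis using that by (metis atLeastAtMost_iff)
  qed
  \<comment> \<open>The map out of the pushout induced by \<open>f\<close> and \<open>h\<close>.
    Away from height 0 a point determines its preimage in \<open>X\<close> because \<open>i\<close>
    is injective; at height 0 the two prescriptions agree.\<close>
  define G where "G = (\<lambda>(y, s). if s = 0 then f y else h (s, inv_into (topspace (fst X)) i y))"
  have Gm: "G (m (t, x)) = h (t, x)" if "0 \<le> t" "t \<le> 1" "x \<in> topspace (fst X)" for t x
  proof (cases "x = snd X")
    case True
    then show ?thesis using h_base[OF that(1,2)] f by (simp add: G_def m_def ib pointed_map_def)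
  next
    case False
    then show ?thesis using h0[of x] that inj by (auto simp: G_def m_def)
  qed
  have G: "continuous_map (fst M) (fst Z) G"
    unfolding continuous_map
  proof (intro conjI allI impI)
    show "G ` topspace (fst M) \<subseteq> topspace (fst Z)"
    proof clarify
      fix z assume "z \<in> topspace (fst M)"
      then consider y where "z = (y, 0)" "y \<in> topspace (fst Y)"
        | t x where "z = m (t, x)" "0 \<le> t" "t \<le> 1" "x \<in> topspace (fst X)"
        by (auto simp: M_def topM C_def)
      then show "G z \<in> topspace (fst Z)"
      proof cases
        case 1
        then show ?thesis using pointed_map_in[OF f] by (simp add: G_def)
      next
        case 2
        then have "(t, x) \<in> topspace ?IX" by simp
        then show ?thesis using 2 Gm h unfolding continuous_map by force
      qed
    qed
  next
    fix U assume U: "openin (fst Z) U"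
    have 1: "{y \<in> topspace (fst Y). (y, 0) \<in> {p \<in> C. G p \<in> U}} = {y \<in> topspace (fst Y). f y \<in> U}"
      by (auto simp: C_def G_def)
    have mC: "m p \<in> C" if "p \<in> topspace ?IX" for p
      using that unfolding C_def by blast
    have Gm': "G (m p) = h p" if "p \<in> topspace ?IX" for p
      using that Gm[of "fst p" "snd p"] by (simp add: mem_Times_iff)
    have 2: "{p \<in> topspace ?IX. m p \<in> {p \<in> C. G p \<in> U}} = {p \<in> topspace ?IX. h p \<in> U}"
      by (rule Collect_cong) (metis (no_types, lifting) mem_Collect_eq mC Gm')
    have "op {p \<in> C. G p \<in> U}"
      unfolding op_def 1 2
    proof (intro conjI)
      show "openin (fst Y) {y \<in> topspace (fst Y). f y \<in> U}"
        using f U by (simp add: pointed_map_def continuous_map)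
      show "openin ?IX {p \<in> topspace ?IX. h p \<in> U}"
        using h U by (simp add: continuous_map)
    qed simp
    then show "openin (fst M) {p \<in> topspace (fst M). G p \<in> U}"
      unfolding M_def fst_conv topM op .
  qed
  show ?thesis
  proof
    show "continuous_map (prod_topology ?I (fst Y)) (fst Z) (G \<circ> r)"
      by (rule continuous_map_compose[OF r(1) G])
    show "(G \<circ> r) (t, snd Y) = snd Z" if "0 \<le> t" "t \<le> 1" for t
      using r(2)[OF that] f by (simp add: M_def G_def pointed_map_def)
    show "(G \<circ> r) (0, y) = f y" if "y \<in> topspace (fst Y)" for y
      using r(3)[OF that] by (simp add: G_def)
    show "(G \<circ> r) (t, i x) = h (t, x)" if "0 \<le> t" "t \<le> 1" "x \<in> topspace (fst X)" for t x
      using r(4)[OF that] Gm[OF that] by simp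
  qed
qed

text \<open>The contraction of \<open>A\<close>, viewed in \<open>X\<close>, extends to a
  deformation \<open>H\<close> of \<open>X\<close> that starts at the identity. Its final map sends
  the image of \<open>A\<close> to the base point and so factors through the quotient, giving the
  homotopy inverse. As \<open>H\<close> keeps the image of \<open>A\<close> inside itself, it also
  descends to a homotopy on the quotient.\<close>

lemma collapse_contractible_heq:
  assumes A: "pointed_space A" and X: "pointed_space X"
    and hep: "pointed_hep A X i" and i: "pointed_map A X i" and inj: "inj_on i (topspace (fst A))"
    and contr: "pointed_contractible A"
  shows "pointed_heq X (collapse (fst X) (i ` topspace (fst A)) (snd X))"
proof -
  let ?I = "top_of_set {0..1::real}"
  let ?B = "i ` topspace (fst A)"
  let ?k = "collapse_map ?B (snd X)"
  let ?Q = "collapse (fst X) ?B (snd X)"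
  have bA: "snd A \<in> topspace (fst A)" and bX: "snd X \<in> topspace (fst X)" and ib: "i (snd A) = snd X"
    using A X i by (auto simp: pointed_space_def pointed_map_def)
  have bB: "snd X \<in> ?B" using bA ib by force
  have Q: "pointed_space ?Q"
    by (rule pointed_space_collapse[OF bX])
  have inQ: "y \<in> topspace (fst ?Q) \<longleftrightarrow> y \<in> topspace (fst X) \<and> (y \<in> ?B \<longrightarrow> y = snd X)" for y
    using in_topspace_collapse[OF bX, of ?B] bB by blast
  obtain c where c: "continuous_map (prod_topology ?I (fst A)) (fst A) c"
    "\<And>x. x \<in> topspace (fst A) \<Longrightarrow> c (0, x) = x"
    "\<And>x. x \<in> topspace (fst A) \<Longrightarrow> c (1, x) = snd A"
    "\<And>t. 0 \<le> t \<Longrightarrow> t \<le> 1 \<Longrightarrow> c (t, snd A) = snd A"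
    using pointed_contractibleE[OF contr A] by blast
  have cin: "c (t, x) \<in> topspace (fst A)" if "0 \<le> t" "t \<le> 1" "x \<in> topspace (fst A)" for t x
    using c(1) that by (auto simp: continuous_map_def Pi_iff)
  have ic: "continuous_map (prod_topology ?I (fst A)) (fst X) (\<lambda>p. i (c p))"
    by (rule continuous_map_compose_arg[OF _ c(1)]) (use i in \<open>simp add: pointed_map_def\<close>)
  obtain H where H: "continuous_map (prod_topology ?I (fst X)) (fst X) H"
    "\<And>t. 0 \<le> t \<Longrightarrow> t \<le> 1 \<Longrightarrow> H (t, snd X) = snd X"
    "\<And>x. x \<in> topspace (fst X) \<Longrightarrow> H (0, x) = id x"
    "\<And>t x. 0 \<le> t \<Longrightarrow> t \<le> 1 \<Longrightarrow> x \<in> topspace (fst A) \<Longrightarrow> H (t, i x) = i (c (t, x))"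
  proof (rule pointed_hep_extend[OF A X X hep i inj pointed_map_id ic])
    fix H assume "continuous_map (prod_topology ?I (fst X)) (fst X) H"
      "\<And>t. 0 \<le> t \<Longrightarrow> t \<le> 1 \<Longrightarrow> H (t, snd X) = snd X"
      "\<And>x. x \<in> topspace (fst X) \<Longrightarrow> H (0, x) = id x"
      "\<And>t x. 0 \<le> t \<Longrightarrow> t \<le> 1 \<Longrightarrow> x \<in> topspace (fst A) \<Longrightarrow> H (t, i x) = i (c (t, x))"
    then show thesis by (rule that)
  qed (simp_all add: c ib)
  have H1: "continuous_map (fst X) (fst X) (\<lambda>x. H (1, x))"
    by (rule continuous_map_compose_pair[OF H(1)]) (simp_all add: continuous_map_self)
  have HB1: "H (1, y) = snd X" if "y \<in> ?B" for y
    using that H(4)[of 1] c(3) ib by auto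
  have HB: "H (t, y) \<in> ?B" if "y \<in> ?B" "0 \<le> t" "t \<le> 1" for t y
  proof -
    obtain a where "y = i a" "a \<in> topspace (fst A)" using \<open>y \<in> ?B\<close> by blast
    then show ?thesis using H(4)[of t a] cin[of t a] that by simp
  qed
  have k_in: "?k y = snd X" if "y \<in> ?B" for y
    using that by (simp add: collapse_map_def)
  have k_notin: "?k y = y" if "y \<notin> ?B" for y
    using that by (simp add: collapse_map_def)
  have kQ: "?k y = y" if "y \<in> topspace (fst ?Q)" for y
    using that inQ[of y] k_in k_notin by blast
  have k: "pointed_map X ?Q ?k"
    by (simp add: pointed_map_def continuous_map_collapse_map k_in[OF bB])
  show ?thesis
  proof (rule pointed_heqI[OF k])
    show "pointed_map ?Q X (\<lambda>x. H (1, x))"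
      unfolding pointed_map_def snd_collapse
    proof (intro conjI continuous_map_from_collapse[OF H1])
      show "H (1, x) = H (1, snd X)" if "x \<in> ?B" for x
        using HB1[OF that] HB1[OF bB] by simp
      show "H (1, snd X) = snd X" by (rule HB1[OF bB])
    qed
    show "pointed_homotopic X X ((\<lambda>x. H (1, x)) \<circ> ?k) id"
    proof (rule pointed_homotopic_sym, rule pointed_homotopicI[OF X H(1) H(3)])
      fix x assume "x \<in> topspace (fst X)"
      show "H (1, x) = ((\<lambda>x. H (1, x)) \<circ> ?k) x"
        using k_in[of x] k_notin[of x] HB1[of x] HB1[OF bB] by (cases "x \<in> ?B") simp_all
    qed (use H(2) in simp_all)
    show "pointed_homotopic ?Q ?Q (?k \<circ> (\<lambda>x. H (1, x))) id"
    proof (rule pointed_homotopic_sym, rule pointed_homotopicI[OF Q])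
      have "continuous_map (prod_topology ?I (fst X)) (fst ?Q) (\<lambda>p. ?k (H p))"
        by (rule continuous_map_compose_arg[OF continuous_map_collapse_map H(1)])
      then show "continuous_map (prod_topology ?I (fst ?Q)) (fst ?Q) (\<lambda>p. ?k (H p))"
      proof (rule continuous_map_from_interval_collapse)
        fix t x assume "t \<in> topspace ?I" "x \<in> ?B"
        then show "?k (H (t, x)) = ?k (H (t, snd X))"
          using k_in[OF HB, of x t] k_in[OF HB, of "snd X" t] bB by simp
      qed
      fix x assume x: "x \<in> topspace (fst ?Q)"
      then show "?k (H (0, x)) = id x"
        using H(3)[of x] inQ[of x] kQ[of x] by simp
      show "?k (H (1, x)) = (?k \<circ> (\<lambda>x. H (1, x))) x" by simp
    next
      fix t :: real assume "0 \<le> t" "t \<le> 1"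
      then show "?k (H (t, snd ?Q)) = snd ?Q"
        using H(2) k_in[OF bB] by simp
    qed
  qed
qed

text \<open>
  The map to the suspension comes from extending the tautological homotopy of \<open>A\<close> in its suspension.
  The extension is made together with its trace in the reduced cylinder on \<open>X\<close>, from which the
  homotopy on \<open>X/A\<close> is read off.
\<close>

lemma collapse_heq_susp:
  assumes A: "pointed_space A" and X: "pointed_space X"
    and hep: "pointed_hep A X i" and i: "pointed_map A X i" and inj: "inj_on i (topspace (fst A))"
    and contr: "pointed_contractible X"
  shows "pointed_heq (collapse (fst X) (i ` topspace (fst A)) (snd X)) (susp A)"
proof -
  let ?I = "top_of_set {0..1::real}"
  let ?B = "i ` topspace (fst A)"
  let ?k = "collapse_map ?B (snd X)"
  let ?Q = "collapse (fst X) ?B (snd X)"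
  let ?S = "susp A"
  let ?D = "{0..1::real} \<times> {snd X}"
  let ?N = "collapse (prod_topology ?I (fst X)) ?D (0, snd X)"
  let ?n = "collapse_map ?D (0, snd X)"
  have bA: "snd A \<in> topspace (fst A)" and bX: "snd X \<in> topspace (fst X)" and ib: "i (snd A) = snd X"
    using A X i by (auto simp: pointed_space_def pointed_map_def)
  have ci: "continuous_map (fst A) (fst X) i"
    using i by (simp add: pointed_map_def)
  have iin: "i a \<in> topspace (fst X)" if "a \<in> topspace (fst A)" for a
    using that i by (rule pointed_map_in[rotated])
  have bB: "snd X \<in> ?B" using bA ib by force
  have Q: "pointed_space ?Q"
    by (rule pointed_space_collapse[OF bX])
  have inQ: "y \<in> topspace (fst ?Q) \<longleftrightarrow> y \<in> topspace (fst X) \<and> (y \<in> ?B \<longrightarrow> y = snd X)" for y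
    using in_topspace_collapse[OF bX, of ?B] bB by blast
  have kB: "?k (i a) = snd X" if "a \<in> topspace (fst A)" for a
    using that by (simp add: collapse_map_def)
  have kb: "?k (snd X) = snd X" by (simp add: collapse_map_def)
  have kQ: "?k y = y" if "y \<in> topspace (fst ?Q)" for y
    using that inQ by (simp add: collapse_map_def)
  have n: "?n (t, x) = (if x = snd X then (0, snd X) else (t, x))" if "0 \<le> t" "t \<le> 1" for t x
    using that by (simp add: collapse_map_def)
  obtain c where c: "continuous_map (prod_topology ?I (fst X)) (fst X) c"
    "\<And>x. x \<in> topspace (fst X) \<Longrightarrow> c (0, x) = x"
    "\<And>x. x \<in> topspace (fst X) \<Longrightarrow> c (1, x) = snd X"
    "\<And>t. 0 \<le> t \<Longrightarrow> t \<le> 1 \<Longrightarrow> c (t, snd X) = snd X"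
    using pointed_contractibleE[OF contr X] by blast
  have cin: "c (t, x) \<in> topspace (fst X)" if "0 \<le> t" "t \<le> 1" "x \<in> topspace (fst X)" for t x
    using c(1) that by (auto simp: continuous_map_def Pi_iff)
  \<comment> \<open>The contraction of \<open>X\<close> run backwards: at \<open>t = 0\<close> the
    point \<open>i a\<close> has been contracted to the base point, and at \<open>t = 1\<close> it
    is in its place in \<open>A\<close>, which the quotient collapses.\<close>
  define G where "G q = ?k (c (1 - fst q, i (snd q)))" for q
  have minus: "continuous_map ?I ?I (\<lambda>t. 1 - t)"
    by (rule continuous_map_into_unit_interval) (auto intro!: continuous_intros)
  note conv1 = continuous_map_compose_arg[OF minus continuous_map_fst]
  have G: "continuous_map (prod_topology ?I (fst A)) (fst ?Q) G"
    unfolding G_def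
    by (rule continuous_map_compose_arg[OF continuous_map_collapse_map]
        continuous_map_compose_pair[OF c(1)] conv1 continuous_map_compose_arg[OF ci]
        continuous_map_projections)+
  have Gbase: "G (0, a) = snd X" "G (1, a) = snd X" if "a \<in> topspace (fst A)" for a
    using that by (auto simp: G_def c iin kB kb)
  have Gbase': "G (t, snd A) = snd X" if "0 \<le> t" "t \<le> 1" for t
    using that by (auto simp: G_def c ib kb)
  have GS: "pointed_map ?S ?Q G"
    unfolding pointed_map_def susp_def
    by (intro conjI continuous_map_from_collapse[OF G]) (auto simp: Gbase Gbase' bA)
  have G_susp: "G (susp_map A (t, a)) = G (t, a)" if "0 \<le> t" "t \<le> 1" "a \<in> topspace (fst A)" for t a
    using that by (auto simp: susp_map_apply Gbase Gbase' bA)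
  \<comment> \<open>The contraction delayed by the height \<open>t\<close> in the cylinder. At time
    1 it has reached \<open>c (1 - t, x)\<close>, the formula behind \<open>G\<close>; up to time
    \<open>t\<close> it has not moved \<open>x\<close>.\<close>
  define w where "w p = c (max 0 (fst p - fst (snd p)), snd (snd p))" for p :: "real \<times> real \<times> 'b"
  have monus: "continuous_map (prod_topology ?I ?I) ?I (\<lambda>p. max 0 (fst p - snd p))"
  proof (rule continuous_map_into_unit_interval)
    have "continuous_on ({0..1} \<times> {0..1}) (\<lambda>p. max 0 (fst p - snd p) :: real)"
      by (intro continuous_intros)
    then show "continuous_map (prod_topology ?I ?I) euclideanreal (\<lambda>p. max 0 (fst p - snd p))"
      by (simp add: prod_topology_subtopology_eu)
  qed auto
  have convmax: "continuous_map (prod_topology ?I (prod_topology ?I (fst X))) ?I (\<lambda>p. max 0 (fst p - fst (snd p)))"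
    using continuous_map_compose_pair[OF monus continuous_map_fst continuous_map_fst_arg[OF continuous_map_snd]]
    by simp
  have w: "continuous_map (prod_topology ?I (fst ?N)) (fst X) w"
  proof (rule continuous_map_from_interval_collapse)
    show "continuous_map (prod_topology ?I (prod_topology ?I (fst X))) (fst X) w"
      unfolding w_def
      by (rule continuous_map_compose_pair[OF c(1)] convmax continuous_map_projections)+
  qed (auto simp: w_def c)
  have wn: "w (s, ?n (t, x)) = c (max 0 (s - t), x)"
    if "0 \<le> t" "t \<le> 1" "0 \<le> s" "s \<le> 1" for s t x
    using that by (auto simp: n w_def c)
  have w1: "continuous_map (fst ?N) (fst X) (\<lambda>q. w (1, q))"
    by (rule continuous_map_compose_pair[OF w]) (auto simp: continuous_map_self)
  \<comment> \<open>The fibre product of the suspension and the reduced cylinder over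
    \<open>X/A\<close>. Extending into it yields a map \<open>K\<close> to the suspension together
    with a trace \<open>J\<close> that determines \<open>G\<close> after \<open>K\<close>.\<close>
  define Z where "Z = (subtopology (prod_topology (fst ?S) (fst ?N))
      {z. G (fst z) = ?k (w (1, snd z))}, ((0 :: real, snd A), (0 :: real, snd X)))"
  have Nb: "pointed_space ?N"
    using bX by (intro pointed_space_collapse) auto
  have n0: "?n (0, x) = (0, x)" for x by (simp add: n)
  have w10: "w (1, (0, x)) = snd X" if "x \<in> topspace (fst X)" for x
    using that by (simp add: w_def c)
  have Sb: "(0, snd A) \<in> topspace (fst ?S)" and Nb': "(0, snd X) \<in> topspace (fst ?N)"
    using pointed_space_susp[OF A] Nb by (auto simp: pointed_space_def)
  have Z: "pointed_space Z"
    using Sb Nb' bA bX by (simp add: pointed_space_def Z_def Gbase w10 kb)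
  have f: "pointed_map X Z (\<lambda>x. ((0, snd A), ?n (0, x)))"
    unfolding pointed_map_def Z_def fst_conv snd_conv
  proof (intro conjI continuous_map_into_subtopology continuous_map_pairedI)
    show "continuous_map (fst X) (fst ?S) (\<lambda>x. (0, snd A))"
      using Sb by simp
    show "continuous_map (fst X) (fst ?N) (\<lambda>x. ?n (0, x))"
      by (rule continuous_map_compose_arg[OF continuous_map_collapse_map])
         (auto intro!: continuous_map_pairedI simp: continuous_map_self)
  qed (auto simp: n0 w10 Gbase bA kb)
  have h: "continuous_map (prod_topology ?I (fst A)) (fst Z) (\<lambda>q. (susp_map A q, ?n (fst q, i (snd q))))"
    unfolding Z_def fst_conv
  proof (intro continuous_map_into_subtopology continuous_map_pairedI continuous_map_susp_map)
    show "continuous_map (prod_topology ?I (fst A)) (fst ?N) (\<lambda>q. ?n (fst q, i (snd q)))"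
      by (rule continuous_map_compose_arg[OF continuous_map_collapse_map] continuous_map_pairedI
          continuous_map_compose_arg[OF ci] continuous_map_projections)+
  qed (auto simp: G_susp wn, simp add: G_def)
  obtain H where H: "continuous_map (prod_topology ?I (fst X)) (fst Z) H"
    "\<And>t. 0 \<le> t \<Longrightarrow> t \<le> 1 \<Longrightarrow> H (t, snd X) = snd Z"
    "\<And>x. x \<in> topspace (fst X) \<Longrightarrow> H (0, x) = ((0, snd A), ?n (0, x))"
    "\<And>t a. 0 \<le> t \<Longrightarrow> t \<le> 1 \<Longrightarrow> a \<in> topspace (fst A) \<Longrightarrow>
       H (t, i a) = (susp_map A (t, a), ?n (t, i a))"
  proof (rule pointed_hep_extend[OF A X Z hep i inj f h])
    fix t :: real assume "0 \<le> t" "t \<le> 1"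
    then show "(susp_map A (t, snd A), ?n (fst (t, snd A), i (snd (t, snd A)))) = snd Z"
      using susp_map_base(1)[OF A] by (simp add: Z_def ib n)
  next
    fix a assume "a \<in> topspace (fst A)"
    then show "(susp_map A (0, a), ?n (fst (0 :: real, a), i (snd (0 :: real, a)))) = ((0, snd A), ?n (0, i a))"
      by (simp add: susp_map_base)
  next
    fix H assume "continuous_map (prod_topology ?I (fst X)) (fst Z) H"
      "\<And>t. 0 \<le> t \<Longrightarrow> t \<le> 1 \<Longrightarrow> H (t, snd X) = snd Z"
      "\<And>x. x \<in> topspace (fst X) \<Longrightarrow> H (0, x) = ((0, snd A), ?n (0, x))"
      "\<And>t a. 0 \<le> t \<Longrightarrow> t \<le> 1 \<Longrightarrow> a \<in> topspace (fst A) \<Longrightarrow>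
        H (t, i a) = (susp_map A (t, a), ?n (fst (t, a), i (snd (t, a))))"
    then show thesis
      unfolding fst_conv snd_conv by (rule that)
  qed
  define K where "K p = fst (H p)" for p
  define J where "J p = snd (H p)" for p
  have H': "continuous_map (prod_topology ?I (fst X)) (prod_topology (fst ?S) (fst ?N)) H"
    using H(1) by (simp add: Z_def continuous_map_in_subtopology)
  have K: "continuous_map (prod_topology ?I (fst X)) (fst ?S) K"
    and J: "continuous_map (prod_topology ?I (fst X)) (fst ?N) J"
    unfolding K_def J_def by (rule continuous_map_fst_arg[OF H'] continuous_map_snd_arg[OF H'])+
  have GK: "G (K (t, x)) = ?k (w (1, J (t, x)))" if "0 \<le> t" "t \<le> 1" "x \<in> topspace (fst X)" for t x
  proof -
    have "H (t, x) \<in> topspace (fst Z)"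
      using H(1) that by (auto simp: continuous_map_def Pi_iff)
    then show ?thesis by (simp add: Z_def K_def J_def)
  qed
  have Kb: "K (t, snd X) = (0, snd A)" if "0 \<le> t" "t \<le> 1" for t
    using H(2)[OF that] by (simp add: K_def Z_def)
  have K0: "K (0, x) = (0, snd A)" and J0: "J (0, x) = (0, x)" if "x \<in> topspace (fst X)" for x
    using H(3)[OF that] n0 by (auto simp: K_def J_def)
  have KA: "K (t, i a) = susp_map A (t, a)" and JA: "J (t, i a) = ?n (t, i a)"
    if "0 \<le> t" "t \<le> 1" "a \<in> topspace (fst A)" for t a
    using H(4)[OF that] by (auto simp: K_def J_def)
  have K1: "continuous_map (fst X) (fst ?S) (\<lambda>x. K (1, x))"
    by (rule continuous_map_compose_pair[OF K]) (auto simp: continuous_map_self)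
  have F: "pointed_map ?Q ?S (\<lambda>x. K (1, x))"
    unfolding pointed_map_def
  proof (intro conjI continuous_map_from_collapse[OF K1])
    fix x assume "x \<in> ?B"
    then obtain a where "x = i a" "a \<in> topspace (fst A)" by blast
    then show "K (1, x) = K (1, snd X)"
      using KA[of 1 a] Kb[of 1] susp_map_base(3)[of a A] by simp
  qed (simp add: Kb)
  show ?thesis
  proof (rule pointed_heqI[OF F GS])
    \<comment> \<open>At time 0 the trace is \<open>(0, x)\<close> and nothing has moved; at time 1
      the fibre product condition turns the formula into \<open>G\<close> after \<open>K\<close>. On
      \<open>A\<close> the height of the trace equals the time, so points stay in \<open>A\<close>
      and are collapsed.\<close>
    let ?W = "\<lambda>p. ?k (w (fst p, J p))"
    have W: "continuous_map (prod_topology ?I (fst X)) (fst ?Q) ?W"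
      by (rule continuous_map_compose_arg[OF continuous_map_collapse_map]
          continuous_map_compose_pair[OF w] J continuous_map_projections)+
    have WA: "?W (t, i a) = snd X" if "0 \<le> t" "t \<le> 1" "a \<in> topspace (fst A)" for t a
      using that by (simp add: JA wn c iin kB)
    have Wb: "?W (t, snd X) = snd X" if "0 \<le> t" "t \<le> 1" for t
      using WA[OF that bA] by (simp add: ib)
    show "pointed_homotopic ?Q ?Q (G \<circ> (\<lambda>x. K (1, x))) id"
    proof (rule pointed_homotopic_sym, rule pointed_homotopicI[OF Q, of _ ?W])
      show "continuous_map (prod_topology ?I (fst ?Q)) (fst ?Q) ?W"
      proof (rule continuous_map_from_interval_collapse[OF W])
        fix t x assume "t \<in> topspace ?I" "x \<in> ?B"
        then show "?W (t, x) = ?W (t, snd X)" using WA Wb by auto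
      qed
      fix x assume x: "x \<in> topspace (fst ?Q)"
      then show "?W (0, x) = id x"
        using inQ kQ by (simp add: J0 w_def c)
      show "?W (1, x) = (G \<circ> (\<lambda>x. K (1, x))) x"
        using x inQ GK by simp
    qed (use Wb in auto)
    txt \<open>
      On the square of parameters \<open>(s, t)\<close> of \<open>K (s, c (t, -))\<close>, the edge \<open>s = 1\<close> is moved to the edge
      \<open>t = 0\<close>. Its end point \<open>(1, 0)\<close> stays fixed, and its other end point runs along the edges \<open>t = 1\<close>
      and \<open>s = 0\<close>, where the value is the base point.
    \<close>
    let ?s = "\<lambda>p. (1 - snd p) * max 0 (1 - 2 * fst p) + snd p"
    let ?t = "\<lambda>p. (1 - snd p) * min 1 (2 - 2 * fst p)"
    have sin: "0 \<le> (1 - t) * max 0 (1 - 2 * u) + t \<and> (1 - t) * max 0 (1 - 2 * u) + t \<le> 1"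
      "0 \<le> (1 - t) * min 1 (2 - 2 * u) \<and> (1 - t) * min 1 (2 - 2 * u) \<le> 1"
      if "0 \<le> t" "t \<le> 1" "0 \<le> u" "u \<le> 1" for t u :: real
    proof -
      have "(1 - t) * max 0 (1 - 2 * u) \<le> (1 - t) * 1" "(1 - t) * min 1 (2 - 2 * u) \<le> 1 * 1"
        using that by (intro mult_left_mono mult_mono; auto)+
      then show "0 \<le> (1 - t) * max 0 (1 - 2 * u) + t \<and> (1 - t) * max 0 (1 - 2 * u) + t \<le> 1"
        "0 \<le> (1 - t) * min 1 (2 - 2 * u) \<and> (1 - t) * min 1 (2 - 2 * u) \<le> 1"
        using that by auto
    qed
    have convs: "continuous_map (prod_topology ?I ?I) ?I ?s" and convt: "continuous_map (prod_topology ?I ?I) ?I ?t"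
      using sin by (auto simp: prod_topology_subtopology_eu intro!: continuous_map_into_unit_interval continuous_intros)
    let ?V = "\<lambda>p. K (?s (fst p, fst (snd p)), c (?t (fst p, fst (snd p)), i (snd (snd p))))"
    have V: "continuous_map (prod_topology ?I (prod_topology ?I (fst A))) (fst ?S) ?V"
      by (rule continuous_map_compose_pair[OF K] continuous_map_compose_pair[OF c(1)]
          continuous_map_compose_pair[OF convs] continuous_map_compose_pair[OF convt]
          continuous_map_compose_arg[OF ci] continuous_map_projections)+
    have Vb: "?V (u, t, a) = (0, snd A)"
      if "0 \<le> u" "u \<le> 1" "0 \<le> t" "t \<le> 1" "a \<in> topspace (fst A)"
        and ends: "t = 0 \<or> t = 1 \<or> a = snd A" for u t a
    proof -
      consider "t = 0" "u \<le> 1/2" | "t = 0" "u \<ge> 1/2" | "t = 1" | "a = snd A"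
        using ends by linarith
      then show ?thesis
      proof cases
        case 1
        then have "?t (u, t) = 1" by simp
        then show ?thesis using that sin(1)[of t u] by (simp add: c iin Kb del: mult_eq_1_iff)
      next
        case 2
        then have "?s (u, t) = 0" by simp
        then show ?thesis using that sin(2)[of t u] cin iin by (simp add: K0)
      next
        case 3
        then show ?thesis using that by (simp add: c iin KA susp_map_base)
      next
        case 4
        then show ?thesis using that sin[of t u] by (simp add: ib c Kb)
      qed
    qed
    show "pointed_homotopic ?S ?S ((\<lambda>x. K (1, x)) \<circ> G) id"
    proof (rule pointed_homotopicI[OF pointed_space_susp[OF A], of _ ?V])
      show "continuous_map (prod_topology ?I (fst ?S)) (fst ?S) ?V"
        unfolding susp_def[of A]
      proof (rule continuous_map_from_interval_collapse[OF V[unfolded susp_def[of A]]])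
        fix u q assume "u \<in> topspace ?I" "q \<in> topspace (prod_topology ?I (fst A))"
          "q \<in> {0, 1} \<times> topspace (fst A) \<union> {0..1} \<times> {snd A}"
        then show "?V (u, q) = ?V (u, 0, snd A)"
          using Vb[of u "fst q" "snd q"] Vb[of u 0 "snd A"] bA by (cases q) auto
      qed
      fix q assume q: "q \<in> topspace (fst ?S)"
      obtain t a where ta: "q = (t, a)" "0 \<le> t" "t \<le> 1" "a \<in> topspace (fst A)"
        using q A by (cases q) (auto simp: in_topspace_susp)
      have "K (1, ?k y) = K (1, y)" if "y \<in> topspace (fst X)" for y
      proof (cases "y \<in> ?B")
        case True
        then obtain a where "y = i a" "a \<in> topspace (fst A)" by blast
        then show ?thesis
          using KA[of 1 a] Kb[of 1] susp_map_base(3)[of a A] kB[of a] by simp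
      qed (simp add: collapse_map_def)
      then show "?V (0, q) = ((\<lambda>x. K (1, x)) \<circ> G) q"
        using ta cin iin by (simp add: G_def)
      show "?V (1, q) = id q"
        using ta q by (simp add: c iin KA susp_map_id[OF A])
    next
      fix u :: real assume "0 \<le> u" "u \<le> 1"
      then show "?V (u, snd ?S) = snd ?S"
        using Vb[of u 0 "snd A"] bA by simp
    qed
  qed
qed

section \<open>Iterated smash powers and suspensions\<close>

lemma pointed_space_smash_power:
  assumes "pointed_space X"
  shows "pointed_space (smash_power X n)"
  using assms
proof (induction X n rule: smash_power.induct)
  case (1 X)
  show ?case by (simp add: pointed_space_def)
qed (simp_all add: pointed_space_relabel pointed_space_smash)

lemma smash_power_Suc_heq:
  assumes "pointed_space X"
  shows "pointed_heq (smash X (smash_power X (Suc n))) (smash_power X (Suc (Suc n)))"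
  unfolding smash_power.simps
  by (rule pointed_heq_relabel) (auto simp: pointed_space_smash pointed_space_smash_power assms inj_def)

lemma pointed_space_susp_iter:
  assumes "pointed_space X"
  shows "pointed_space (susp_iter m X)"
  by (induction m) (simp_all add: pointed_space_relabel pointed_space_susp assms)

lemma susp_iter_0_heq:
  assumes "pointed_space X"
  shows "pointed_heq X (susp_iter 0 X)"
  unfolding susp_iter.simps by (rule pointed_heq_relabel) (auto simp: assms inj_def)

lemma susp_iter_Suc_heq:
  assumes "pointed_space X"
  shows "pointed_heq (susp (susp_iter m X)) (susp_iter (Suc m) X)"
  unfolding susp_iter.simps
  by (rule pointed_heq_relabel) (auto simp: pointed_space_susp pointed_space_susp_iter assms inj_def)

lemma susp_iter_heq:
  assumes "pointed_space X" "pointed_space Y" "pointed_heq X Y"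
  shows "pointed_heq (susp_iter m X) (susp_iter m Y)"
proof (induction m)
  case 0
  show ?case
    using assms by (meson pointed_heq_sym pointed_heq_trans susp_iter_0_heq)
next
  case (Suc m)
  have "pointed_heq (susp (susp_iter m X)) (susp (susp_iter m Y))"
    by (intro susp_heq pointed_space_susp_iter assms Suc)
  then show ?case
    using assms by (meson pointed_heq_sym pointed_heq_trans susp_iter_Suc_heq)
qed

lemma smash_susp_iter:
  assumes X: "pointed_space X" and Y: "pointed_space Y"
  shows "pointed_heq (smash X (susp_iter m Y)) (susp_iter m (smash X Y))"
proof (induction m)
  case 0
  have "pointed_heq (smash X (susp_iter 0 Y)) (smash X Y)"
    by (intro smash_heq pointed_heq_refl pointed_heq_sym[OF susp_iter_0_heq] pointed_space_susp_iter assms)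
  then show ?case
    using susp_iter_0_heq[OF pointed_space_smash[OF X Y]] by (rule pointed_heq_trans)
next
  case (Suc m)
  note sp = pointed_space_susp_iter[OF Y] pointed_space_susp_iter[OF pointed_space_smash[OF X Y]]
  have "pointed_heq (smash X (susp_iter (Suc m) Y)) (smash X (susp (susp_iter m Y)))"
    by (intro smash_heq pointed_heq_refl pointed_heq_sym[OF susp_iter_Suc_heq] pointed_space_susp sp assms)
  also have "pointed_heq (smash X (susp (susp_iter m Y))) (susp (smash X (susp_iter m Y)))"
    by (intro smash_susp X sp)
  also have "pointed_heq (susp (smash X (susp_iter m Y))) (susp (susp_iter m (smash X Y)))"
    by (intro susp_heq Suc pointed_space_smash X sp)
  also have "pointed_heq (susp (susp_iter m (smash X Y))) (susp_iter (Suc m) (smash X Y))"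
    by (intro susp_iter_Suc_heq pointed_space_smash X Y)
  finally show ?case .
qed

lemma susp_contractible:
  assumes X: "pointed_space X" and contr: "pointed_contractible X"
  shows "pointed_contractible (susp X)"
  unfolding pointed_contractible_def
proof (rule pointed_homotopic_cong[OF susp_homotopic_map[OF X contr[unfolded pointed_contractible_def]]])
  show "pointed_space (susp X)" by (rule pointed_space_susp[OF X])
  fix p assume p: "p \<in> topspace (fst (susp X))"
  then show "susp_map X (fst p, id (snd p)) = id p"
    using susp_map_id[OF X] by simp
  show "susp_map X (fst p, snd X) = snd (susp X)"
    using p X by (cases p) (simp add: in_topspace_susp susp_map_base(1))
qed

section \<open>The cuts of two-valued partitions\<close>

text \<open>A linear combination may be indexed by a family with repetitions, whereas
  \<open>tspan\<close> asks for a set of vectors; the coefficients of equal vectors are added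
  up.\<close>

lemma tspan_member:
  assumes x: "x \<in> tern n" and J: "finite J" and g: "\<And>j. j \<in> J \<Longrightarrow> g j \<in> A"
    and eq: "\<And>i. i < n \<Longrightarrow> real_of_int (x ! i) = (\<Sum>j\<in>J. d j * real_of_int (g j ! i))"
  shows "x \<in> tspan n A"
proof -
  let ?c = "\<lambda>b. \<Sum>j\<in>{j \<in> J. g j = b}. d j"
  have "real_of_int (x ! i) = (\<Sum>b\<in>g ` J. ?c b * real_of_int (b ! i))" if "i < n" for i
  proof -
    have "(\<Sum>j\<in>J. d j * real_of_int (g j ! i)) =
        (\<Sum>b\<in>g ` J. \<Sum>j\<in>{j \<in> J. g j = b}. d j * real_of_int (g j ! i))"
      by (rule sum.image_gen[OF J])
    also have "\<dots> = (\<Sum>b\<in>g ` J. ?c b * real_of_int (b ! i))"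
      by (simp add: sum_distrib_right)
    finally show ?thesis using eq[OF that] by simp
  qed
  then show ?thesis
    unfolding tspan_def using x J g by (intro CollectI conjI exI[of _ "g ` J"] exI[of _ ?c]) auto
qed

lemma subset_tspan: "A \<subseteq> tern n \<Longrightarrow> A \<subseteq> tspan n A"
proof
  fix x assume "A \<subseteq> tern n" "x \<in> A"
  then show "x \<in> tspan n A"
    by (intro tspan_member[of x n "{()}" "\<lambda>_. x" A "\<lambda>_. 1"]) auto
qed

text \<open>Linear relations pass to the span. The computation takes place in the reals, where the
  coefficients live, and its result is read back in the integers.\<close>

lemma tspan_linear:
  assumes "x \<in> tspan n A" and A: "\<And>y. y \<in> A \<Longrightarrow> (\<Sum>i\<in>I. u i * y ! i) = 0" and I: "I \<subseteq> {..<n}"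
  shows "(\<Sum>i\<in>I. u i * x ! i) = (0 :: int)"
proof -
  obtain B c where B: "finite B" "B \<subseteq> A"
    and eq: "\<And>i. i < n \<Longrightarrow> real_of_int (x ! i) = (\<Sum>b\<in>B. c b * real_of_int (b ! i))"
    using assms(1) unfolding tspan_def by auto
  have "real_of_int (\<Sum>i\<in>I. u i * x ! i) = (\<Sum>i\<in>I. u i * real_of_int (x ! i))"
    by simp
  also have "\<dots> = (\<Sum>i\<in>I. u i * (\<Sum>b\<in>B. c b * real_of_int (b ! i)))"
    using I by (intro sum.cong) (auto simp: eq)
  also have "\<dots> = (\<Sum>b\<in>B. c b * (\<Sum>i\<in>I. u i * real_of_int (b ! i)))"
  proof -
    have "(\<Sum>i\<in>I. u i * (\<Sum>b\<in>B. c b * real_of_int (b ! i))) =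
        (\<Sum>i\<in>I. \<Sum>b\<in>B. c b * (u i * real_of_int (b ! i)))"
      by (simp add: sum_distrib_left mult_ac)
    also have "\<dots> = (\<Sum>b\<in>B. \<Sum>i\<in>I. c b * (u i * real_of_int (b ! i)))"
      by (rule sum.swap)
    finally show ?thesis by (simp add: sum_distrib_left)
  qed
  also have "\<dots> = (\<Sum>b\<in>B. c b * real_of_int (\<Sum>i\<in>I. u i * b ! i))"
    by simp
  also have "\<dots> = 0"
  proof (intro sum.neutral ballI)
    fix b assume "b \<in> B"
    then have "(\<Sum>i\<in>I. u i * b ! i) = 0" using A B(2) by blast
    then show "c b * real_of_int (\<Sum>i\<in>I. u i * b ! i) = 0" by (simp only: of_int_0 mult_zero_right)
  qed
  finally show ?thesis by linarith
qed

lemma tspan_subset_tern: "tspan n A \<subseteq> tern n"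
  by (auto simp: tspan_def)

text \<open>
  \<open>block_cut a k l\<close> is $S_{(a^k,1^l)}$, and \<open>split_cut k l\<close> is $S_{(1^k)}\times S_{(1^l)}$.
\<close>

definition block_cut :: "nat \<Rightarrow> nat \<Rightarrow> nat \<Rightarrow> int list set" where
  "block_cut a k l = {x \<in> tern (k + l). int a * (\<Sum>i<k. x ! i) + (\<Sum>i=k..<k+l. x ! i) = 0}"

definition split_cut :: "nat \<Rightarrow> nat \<Rightarrow> int list set" where
  "split_cut k l = {x \<in> tern (k + l). (\<Sum>i<k. x ! i) = 0 \<and> (\<Sum>i=k..<k+l. x ! i) = 0}"

lemma sum_lessThan_add_split:
  fixes f :: "nat \<Rightarrow> int"
  shows "(\<Sum>i<k + l. f i) = (\<Sum>i<k. f i) + (\<Sum>i=k..<k+l. f i)"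
  using sum.atLeastLessThan_concat[of 0 k "k + l" f] by (simp add: lessThan_atLeast0)

lemma partition_cut_block: "partition_cut (replicate k a @ replicate l 1) = block_cut a k l"
proof -
  have "(\<Sum>i<k. x ! i * int ((replicate k a @ replicate l 1) ! i)) = int a * (\<Sum>i<k. x ! i)"
    "(\<Sum>i=k..<k+l. x ! i * int ((replicate k a @ replicate l 1) ! i)) = (\<Sum>i=k..<k+l. x ! i)" for x
    by (auto simp: nth_append sum_distrib_left mult.commute intro!: sum.cong)
  then show ?thesis
    by (simp add: partition_cut_def block_cut_def sum_lessThan_add_split)
qed

lemma partition_cut_ones: "partition_cut (replicate l 1) = block_cut a 0 l"
  using partition_cut_block[of 0 a l] by simp

text \<open>The common factor \<open>a\<close> cancels from the defining equation.\<close>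

lemma partition_cut_no_ones:
  assumes "0 < a"
  shows "partition_cut (replicate k a) = partition_cut (replicate k 1)"
  using partition_cut_block[of k a 0] partition_cut_block[of 0 1 k] assms
  by (simp add: block_cut_def lessThan_atLeast0)

lemma split_cut_0: "split_cut 0 l = partition_cut (replicate l 1)"
  using partition_cut_ones[of l 1] by (simp add: split_cut_def block_cut_def)

lemma split_subset_block: "split_cut k l \<subseteq> block_cut a k l"
  by (auto simp: split_cut_def block_cut_def)

lemma tern_nth: "x \<in> tern n \<Longrightarrow> i < n \<Longrightarrow> x ! i = -1 \<or> x ! i = 0 \<or> x ! i = 1"
  using nth_mem by (fastforce simp: tern_def)

text \<open>With positive weights, the terms of a nonzero vector of a single sign cannot
  cancel.\<close>

lemma tern_signs:
  assumes x: "x \<in> tern n" and sum: "(\<Sum>i<n. u i * x ! i) = (0 :: int)"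
    and u: "\<And>i. i < n \<Longrightarrow> 0 < u i" and nz: "x \<noteq> replicate n 0"
  shows "1 \<in> set x \<and> -1 \<in> set x"
proof -
  have len: "length x = n" using x by (simp add: tern_def)
  obtain i where i: "i < n" "x ! i \<noteq> 0"
    using nz len by (metis nth_equalityI length_replicate nth_replicate)
  have "\<exists>j<n. x ! j = 1"
  proof (rule ccontr)
    assume no: "\<not> (\<exists>j<n. x ! j = 1)"
    have le: "u j * x ! j \<le> 0" if "j < n" for j
      using tern_nth[OF x that] no that u[OF that] by (auto simp: mult_le_0_iff)
    have "x ! i = -1" using tern_nth[OF x i(1)] i no by blast
    then have "u i * x ! i < 0" using u[OF i(1)] by simp
    then have "(\<Sum>i<n. u i * x ! i) < (\<Sum>i<n. 0)"
      using le i(1) by (intro sum_strict_mono_ex1) auto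
    then show False using sum by simp
  qed
  moreover have "\<exists>j<n. x ! j = -1"
  proof (rule ccontr)
    assume no: "\<not> (\<exists>j<n. x ! j = -1)"
    have le: "0 \<le> u j * x ! j" if "j < n" for j
      using tern_nth[OF x that] no that u[OF that] by auto
    have "x ! i = 1" using tern_nth[OF x i(1)] i no by blast
    then have "0 < u i * x ! i" using u[OF i(1)] by simp
    then have "(\<Sum>i<n. 0) < (\<Sum>i<n. u i * x ! i)"
      using le i(1) by (intro sum_strict_mono_ex1) auto
    then show False using sum by simp
  qed
  ultimately show ?thesis using len nth_mem by metis
qed

text \<open>A single weighted equation is the form to which \<open>tspan_linear\<close> and
  \<open>tern_signs\<close> apply.\<close>

lemma block_cut_weighted:
  "x \<in> block_cut a k l \<longleftrightarrow> x \<in> tern (k + l) \<and> (\<Sum>i<k+l. (if i < k then int a else 1) * x ! i) = 0"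
proof -
  have "(\<Sum>i<k. (if i < k then int a else 1) * x ! i) = int a * (\<Sum>i<k. x ! i)"
    "(\<Sum>i=k..<k+l. (if i < k then int a else 1) * x ! i) = (\<Sum>i=k..<k+l. x ! i)"
    by (simp_all add: sum_distrib_left)
  then show ?thesis
    by (simp add: block_cut_def sum_lessThan_add_split)
qed

lemma block_cut_in_cuts:
  assumes "0 < a" "0 < k + l"
  shows "block_cut a k l \<in> cuts (k + l)"
proof -
  let ?u = "\<lambda>i. if i < k then int a else 1"
  have "tspan (k + l) (block_cut a k l) \<subseteq> block_cut a k l"
  proof
    fix x assume x: "x \<in> tspan (k + l) (block_cut a k l)"
    have "(\<Sum>i\<in>{..<k+l}. ?u i * x ! i) = 0"
      by (rule tspan_linear[OF x]) (auto simp: block_cut_weighted)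
    then show "x \<in> block_cut a k l"
      using x tspan_subset_tern by (auto simp: block_cut_weighted)
  qed
  moreover have "block_cut a k l \<subseteq> tern (k + l)"
    by (auto simp: block_cut_def)
  moreover have "1 \<in> set x \<and> -1 \<in> set x" if "x \<in> block_cut a k l" "x \<noteq> replicate (k + l) 0" for x
    using that assms by (intro tern_signs[of x "k + l" ?u]) (auto simp: block_cut_weighted)
  ultimately show ?thesis
    unfolding cuts_def using subset_tspan[of "block_cut a k l" "k + l"] assms(2)
    by (intro CollectI conjI equalityI) simp_all
qed

lemma tspan_split_subset:
  assumes "A \<subseteq> split_cut k l"
  shows "tspan (k + l) A \<subseteq> split_cut k l"
proof
  fix x assume x: "x \<in> tspan (k + l) A"
  have A: "(\<Sum>i<k. 1 * y ! i) = 0" "(\<Sum>i=k..<k+l. 1 * y ! i) = 0" if "y \<in> A" for y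
    using that assms by (auto simp: split_cut_def)
  have "(\<Sum>i<k. 1 * x ! i) = 0" "(\<Sum>i=k..<k+l. 1 * x ! i) = 0"
    by (rule tspan_linear[OF x]; use A in auto)+
  then show "x \<in> split_cut k l"
    using x tspan_subset_tern by (auto simp: split_cut_def)
qed

lemma split_cut_in_cuts:
  assumes "0 < k + l"
  shows "split_cut k l \<in> cuts (k + l)"
proof -
  have "split_cut k l \<subseteq> tern (k + l)"
    by (auto simp: split_cut_def)
  moreover have "1 \<in> set x \<and> -1 \<in> set x" if "x \<in> split_cut k l" "x \<noteq> replicate (k + l) 0" for x
    using that by (intro tern_signs[of x "k + l" "\<lambda>_. 1"]) (auto simp: split_cut_def sum_lessThan_add_split)
  ultimately show ?thesis
    unfolding cuts_def using subset_tspan[of "split_cut k l" "k + l"] tspan_split_subset[of "split_cut k l" k l] assms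
    by (intro CollectI conjI equalityI) simp_all
qed

section \<open>Differences of unit vectors\<close>

text \<open>The vector \<open>e_i - e_j\<close>. Such vectors generate the vectors of sum zero, and
  as an exchange move \<open>e_i - e_j\<close> replaces the index \<open>i\<close> in a block by
  \<open>j\<close>.\<close>

definition unit_diff :: "nat \<Rightarrow> nat \<Rightarrow> nat \<Rightarrow> int list" where
  "unit_diff n i j = map (\<lambda>h. if h = i then 1 else if h = j then -1 else 0) [0..<n]"

lemma nth_unit_diff:
  "h < n \<Longrightarrow> unit_diff n i j ! h = (if h = i then 1 else if h = j then -1 else 0)"
  by (simp add: unit_diff_def)

lemma unit_diff_tern: "unit_diff n i j \<in> tern n"
  by (auto simp: unit_diff_def tern_def)

lemma plus_idx_unit_diff: "i < n \<Longrightarrow> plus_idx (unit_diff n i j) = {i}"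
  by (auto simp: plus_idx_def unit_diff_def split: if_splits)

lemma minus_idx_unit_diff: "j < n \<Longrightarrow> i \<noteq> j \<Longrightarrow> minus_idx (unit_diff n i j) = {j}"
  by (auto simp: minus_idx_def unit_diff_def split: if_splits)

lemma sum_unit_diff:
  assumes "finite I" "I \<subseteq> {..<n}" "i \<noteq> j"
  shows "(\<Sum>h\<in>I. unit_diff n i j ! h) = (if i \<in> I then 1 else 0) - (if j \<in> I then 1 else 0)"
proof -
  have "(\<Sum>h\<in>I. unit_diff n i j ! h) = (\<Sum>h\<in>I. (if h = i then 1 else 0) - (if h = j then 1 else 0))"
    using assms by (intro sum.cong) (auto simp: nth_unit_diff)
  then show ?thesis using assms(1) by (simp add: sum_subtractf)
qed

lemma unit_diff_split_cut:
  assumes "i \<noteq> j" "i < k \<and> j < k \<or> i \<in> {k..<k+l} \<and> j \<in> {k..<k+l}"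
  shows "unit_diff (k + l) i j \<in> split_cut k l"
proof -
  have "{..<k} \<subseteq> {..<k+l}" "{k..<k+l} \<subseteq> {..<k+l}" by auto
  then show ?thesis
    using assms sum_unit_diff[of "{..<k}" "k + l" i j] sum_unit_diff[of "{k..<k+l}" "k + l" i j]
    by (auto simp: split_cut_def unit_diff_tern)
qed

text \<open>Each of the two groups of coordinates has its first index, 0 or \<open>k\<close>, as
  reference. The differences against the reference, taken with the entries of \<open>x\<close> as
  coefficients, sum to \<open>x\<close>: at the reference itself they produce minus the sum of the
  other entries, which is the right value as the group sums to zero.\<close>

lemma tspan_eq_split_cut:
  assumes A: "A \<subseteq> split_cut k l"
    and diffs: "\<And>i j. i \<noteq> j \<Longrightarrow> i < k \<and> j < k \<or> i \<in> {k..<k+l} \<and> j \<in> {k..<k+l} \<Longrightarrow>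
      unit_diff (k + l) i j \<in> A"
  shows "tspan (k + l) A = split_cut k l"
proof (intro equalityI subsetI)
  fix x assume x: "x \<in> split_cut k l"
  define J where "J = {1..<k} \<union> {k<..<k+l}"
  define g where "g j = unit_diff (k + l) j (if j < k then 0 else k)" for j
  have J: "J \<subseteq> {..<k+l}" "finite J" by (auto simp: J_def)
  show "x \<in> tspan (k + l) A"
  proof (rule tspan_member[of x _ J g _ "\<lambda>j. real_of_int (x ! j)"])
    show "x \<in> tern (k + l)" "finite J"
      using x by (auto simp: split_cut_def J_def)
    show "g j \<in> A" if "j \<in> J" for j
      unfolding g_def using that by (intro diffs) (auto simp: J_def)
    fix i assume i: "i < k + l"
    have g: "g j ! i = (if j = i then 1 else 0) - (if i = (if j < k then 0 else k) then 1 else 0)"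
      if "j \<in> J" for j
      using that i by (auto simp: g_def nth_unit_diff J_def)
    have s1: "(\<Sum>j=1..<k. x ! j) = - x ! 0" if "0 < k"
    proof -
      have "(\<Sum>j<k. x ! j) = x ! 0 + (\<Sum>j=1..<k. x ! j)"
        using that by (simp add: lessThan_atLeast0 sum.atLeast_Suc_lessThan)
      then show ?thesis using x by (simp add: split_cut_def)
    qed
    have s2: "(\<Sum>j\<in>{k<..<k+l}. x ! j) = - x ! k" if "0 < l"
    proof -
      have "(\<Sum>j=k..<k+l. x ! j) = x ! k + (\<Sum>j\<in>{k<..<k+l}. x ! j)"
        using that by (simp add: sum.atLeast_Suc_lessThan atLeastSucLessThan_greaterThanLessThan)
      then show ?thesis using x by (simp add: split_cut_def)
    qed
    have "(\<Sum>j\<in>J. x ! j * g j ! i) =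
        (\<Sum>j\<in>J. (if j = i then x ! j else 0) - (if i = (if j < k then 0 else k) then x ! j else 0))"
      using g by (intro sum.cong) auto
    also have "\<dots> = (if i \<in> J then x ! i else 0) -
        (\<Sum>j\<in>J. if i = (if j < k then 0 else k) then x ! j else 0)"
      using J(2) by (simp add: sum_subtractf)
    also have "(\<Sum>j\<in>J. if i = (if j < k then 0 else k) then x ! j else 0) =
       (\<Sum>j=1..<k. if i = 0 then x ! j else 0) + (\<Sum>j\<in>{k<..<k+l}. if i = k then x ! j else 0)"
      unfolding J_def by (subst sum.union_disjoint) auto
    also have "\<dots> = (if i \<in> J then 0 else - x ! i)"
      using i s1 s2 by (cases "k = 0"; cases "i = 0"; cases "i = k") (auto simp: J_def)
    finally have "(\<Sum>j\<in>J. x ! j * g j ! i) = x ! i" by simp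
    then show "real_of_int (x ! i) = (\<Sum>j\<in>J. real_of_int (x ! j) * real_of_int (g j ! i))"
      by (metis (no_types, lifting) of_int_mult of_int_sum sum.cong)
  qed
qed (use tspan_split_subset[OF A] in auto)

section \<open>Relative cuts of two-valued partitions\<close>

lemma Down_trans: "R \<in> Down S P \<Longrightarrow> P \<in> Down S A \<Longrightarrow> R \<in> Down S A"
  by (induction rule: Down.induct) (blast intro: Down.intros)+

lemma Down_mono: "R \<in> Down S A \<Longrightarrow> S \<subseteq> T \<Longrightarrow> R \<in> Down T A"
  by (induction rule: Down.induct) (blast intro: Down.intros)+

lemma closed_parts_down:
  assumes "\<Gamma> \<subseteq> parts n"
  shows "closed_parts n S (down n S \<Gamma>)"
proof -
  have "down n S (down n S \<Gamma>) \<subseteq> down n S \<Gamma>"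
    unfolding down_def using Down_trans by blast
  moreover have "\<Delta> \<subseteq> down n S \<Delta>" if "\<Delta> \<subseteq> parts n" for \<Delta>
    using that Down.start unfolding down_def by blast
  moreover have "down n S \<Gamma> \<subseteq> parts n"
    unfolding down_def by blast
  ultimately show ?thesis
    unfolding closed_parts_def by blast
qed

text \<open>A smaller cut offers fewer exchange moves. Closedness thus passes from the block cut to
  the split cut, which is what (A2) asks for.\<close>

lemma closed_parts_antimono:
  assumes "closed_parts n T \<Gamma>" "S \<subseteq> T"
  shows "closed_parts n S \<Gamma>"
proof -
  have "down n S \<Gamma> \<subseteq> down n T \<Gamma>"
    unfolding down_def using Down_mono[OF _ assms(2)] by blast
  moreover have "\<Gamma> \<subseteq> down n S \<Gamma>"
    using assms(1) Down.start unfolding closed_parts_def down_def by blast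
  ultimately show ?thesis
    using assms(1) unfolding closed_parts_def by blast
qed

lemma closed_parts_empty: "closed_parts n S {}"
  by (simp add: closed_parts_def down_def)

lemma cut_minus_empty: "cut_minus S {} = S"
  by (simp add: cut_minus_def)

lemma Down_merge_all:
  "N \<noteq> {#} \<Longrightarrow> N + M \<in> Down S A \<Longrightarrow> add_mset (\<Sum>\<^sub># N) M \<in> Down S A"
proof (induction N arbitrary: M)
  case (add B N)
  show ?case
  proof (cases "N = {#}")
    case True
    then show ?thesis using add.prems by simp
  next
    case False
    have "N + add_mset B M \<in> Down S A" using add.prems by simp
    then have "add_mset (\<Sum>\<^sub># N) (add_mset B M) \<in> Down S A" by (rule add.IH[OF False])
    then have "add_mset (B + \<Sum>\<^sub># N) M \<in> Down S A"
      by (intro Down.merge) (simp add: add_mset_commute)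
    then show ?thesis by simp
  qed
qed simp

text \<open>The arbitrary remainder \<open>M\<close> holds the groups that have not been fused
  yet.\<close>

lemma Down_merge_family:
  assumes "finite I" "\<And>i. i \<in> I \<Longrightarrow> N i \<noteq> {#}" "(\<Sum>i\<in>I. N i) + M \<in> Down S A"
  shows "image_mset (\<lambda>i. \<Sum>\<^sub># (N i)) (mset_set I) + M \<in> Down S A"
  using assms
proof (induction I arbitrary: M rule: finite_induct)
  case (insert i I)
  have "(\<Sum>i\<in>I. N i) + (N i + M) \<in> Down S A"
    using insert.prems(2) insert.hyps by (simp add: add_ac)
  then have "image_mset (\<lambda>i. \<Sum>\<^sub># (N i)) (mset_set I) + (N i + M) \<in> Down S A"
    using insert.prems(1) by (intro insert.IH) auto
  then have "N i + (image_mset (\<lambda>i. \<Sum>\<^sub># (N i)) (mset_set I) + M) \<in> Down S A"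
    by (simp add: add_ac)
  then show ?case
    using Down_merge_all insert.prems(1) insert.hyps by fastforce
qed simp

section \<open>Partitions with one distinguished block\<close>

definition one_block :: "nat \<Rightarrow> nat set \<Rightarrow> nat multiset multiset" where
  "one_block n C = add_mset (mset_set C) (image_mset (\<lambda>i. {#i#}) (mset_set ({..<n} - C)))"

lemma one_block_eq_part_mset:
  assumes "C \<subseteq> {..<n}" "2 \<le> card C"
  shows "one_block n C = part_mset (insert C ((\<lambda>i. {i}) ` ({..<n} - C)))"
proof -
  have "C \<notin> (\<lambda>i. {i}) ` ({..<n} - C)"
    using assms(2) by auto
  then have "mset_set (insert C ((\<lambda>i. {i}) ` ({..<n} - C))) =
      add_mset C (image_mset (\<lambda>i. {i}) (mset_set ({..<n} - C)))"
    by (simp add: image_mset_mset_set inj_on_def)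
  then show ?thesis
    unfolding one_block_def part_mset_def by (simp add: image_mset.compositionality o_def)
qed

text \<open>Two exchanges along opposite differences. The first replaces \<open>i\<close> by
  \<open>j\<close> in the block \<open>C\<close>, the second turns the singleton of \<open>j\<close>
  into that of \<open>i\<close>. Between them \<open>j\<close> occurs twice and \<open>i\<close> not
  at all, so the path leaves the set of partitions.\<close>

lemma one_block_swap:
  assumes C: "C \<subseteq> {..<n}" and i: "i \<in> C" and j: "j \<in> {..<n} - C"
    and S: "unit_diff n i j \<in> S" "unit_diff n j i \<in> S"
  shows "one_block n (insert j (C - {i})) \<in> Down S (one_block n C)"
proof -
  let ?M = "image_mset (\<lambda>i. {#i#}) (mset_set ({..<n} - C - {j}))"
  let ?C = "insert j (C - {i})"
  have fin: "finite C" and ij: "i < n" "j < n" "i \<noteq> j"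
    using C i j finite_subset by auto
  have Cj: "j \<notin> C - {i}" using j by simp
  have C': "mset_set C - {#i#} + {#j#} = mset_set ?C"
    using i fin Cj by (simp add: mset_set_Diff)
  have 1: "one_block n C = add_mset (mset_set C) (add_mset {#j#} ?M)"
    using j by (simp add: one_block_def mset_set.remove[of "{..<n} - C" j])
  have "{..<n} - ?C = insert i ({..<n} - C - {j})"
    using C i j by auto
  then have 2: "one_block n ?C = add_mset {#i#} (add_mset (mset_set ?C) ?M)"
    using i unfolding one_block_def by (simp add: add_mset_commute)
  have "add_mset (mset_set C) (add_mset {#j#} ?M) \<in> Down S (one_block n C)"
    unfolding 1 by (rule Down.start)
  then have "add_mset ((mset_set C - mset_set (plus_idx (unit_diff n i j))) +
      mset_set (minus_idx (unit_diff n i j))) (add_mset {#j#} ?M) \<in> Down S (one_block n C)"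
    using S(1) by (rule Down.exchange) (simp add: plus_idx_unit_diff ij i fin)
  then have "add_mset {#j#} (add_mset (mset_set ?C) ?M) \<in> Down S (one_block n C)"
    using C' ij by (simp add: plus_idx_unit_diff minus_idx_unit_diff add_mset_commute)
  then have "add_mset (({#j#} - mset_set (plus_idx (unit_diff n j i))) +
      mset_set (minus_idx (unit_diff n j i))) (add_mset (mset_set ?C) ?M) \<in> Down S (one_block n C)"
    using S(2) by (rule Down.exchange) (simp add: plus_idx_unit_diff ij)
  then show ?thesis
    using ij by (simp add: 2 plus_idx_unit_diff minus_idx_unit_diff)
qed

text \<open>Each swap trades an element of \<open>B\<close> outside \<open>C\<close> for a missing
  element of \<open>C\<close>; equality of cardinalities guarantees that such a pair exists as long
  as the sets differ.\<close>

lemma one_block_Down: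
  assumes D: "D \<subseteq> {..<n}" and S: "\<And>i j. i \<in> D \<Longrightarrow> j \<in> D \<Longrightarrow> i \<noteq> j \<Longrightarrow> unit_diff n i j \<in> S"
    and "B \<subseteq> D" "C \<subseteq> D" "card B = card C"
  shows "one_block n C \<in> Down S (one_block n B)"
  using assms(3-5)
proof (induction "card (C - B)" arbitrary: B)
  case 0
  have fin: "finite D" using D finite_subset by blast
  then have "finite C" "finite B" using 0(2,3) finite_subset by blast+
  then have "C = B" using 0 by (simp add: card_subset_eq)
  then show ?case by (simp add: Down.start)
next
  case (Suc h)
  have fin: "finite D" using D finite_subset by blast
  then have fin: "finite C" "finite B" using Suc(3,4) finite_subset by blast+
  have "C - B \<noteq> {}" using Suc(2) by (metis card.empty nat.distinct(1))
  then obtain j where j: "j \<in> C" "j \<notin> B" by blast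
  have "B - C \<noteq> {}"
  proof
    assume "B - C = {}"
    then have "B \<subset> C" using j by blast
    then have "card B < card C" using fin psubset_card_mono by blast
    then show False using Suc(5) by simp
  qed
  then obtain i where i: "i \<in> B" "i \<notin> C" by blast
  let ?B = "insert j (B - {i})"
  have "one_block n ?B \<in> Down S (one_block n B)"
    using i j Suc(3,4) D by (intro one_block_swap S) auto
  moreover have "one_block n C \<in> Down S (one_block n ?B)"
  proof (rule Suc(1))
    have "C - B = insert j (C - ?B)" "j \<notin> C - ?B" using i j by auto
    then show "h = card (C - ?B)" using Suc(2) fin by simp
    show "?B \<subseteq> D" "C \<subseteq> D" using Suc(3,4) i j by auto
    have "card ?B = card B"
      using i j fin card_gt_0_iff[of B] by auto
    then show "card ?B = card C" using Suc(5) by simp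
  qed
  ultimately show ?case by (rule Down_trans[rotated])
qed

lemma sum_mset_set_blocks:
  assumes "finite R" "\<And>B. B \<in> R \<Longrightarrow> finite B" "disjoint R"
  shows "(\<Sum>B\<in>R. mset_set (B - C)) = mset_set (\<Union>R - C)"
  using assms
proof (induction R rule: finite_induct)
  case (insert B R)
  have disj: "(B - C) \<inter> (\<Union>R - C) = {}"
  proof -
    have "B \<inter> B' = {}" if "B' \<in> R" for B'
      using disjointD[OF insert.prems(2), of B B'] insert.hyps(2) that by auto
    then show ?thesis by auto
  qed
  have fin: "finite (B - C)" "finite (\<Union>R - C)"
    using insert.prems(1) insert.hyps(1) by auto
  have "\<Union>(insert B R) - C = (B - C) \<union> (\<Union>R - C)" by blast
  then have "mset_set (\<Union>(insert B R) - C) = mset_set (B - C) + mset_set (\<Union>R - C)"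
    using mset_set_Union[OF fin disj] by simp
  moreover have "disjoint R"
    using insert.prems(2) by (rule pairwise_subset) blast
  then have "(\<Sum>B\<in>R. mset_set (B - C)) = mset_set (\<Union>R - C)"
    using insert.IH insert.prems(1) by blast
  ultimately show ?case
    using insert.hyps by simp
qed simp

lemma sum_mset_singletons: "\<Sum>\<^sub># (image_mset (\<lambda>i. {#i#}) M) = M"
  by (induction M) auto

text \<open>\<open>R\<close> is coarser than the partition with the single block \<open>C\<close>,
  so merges alone lead to it.\<close>

lemma partition_Down_one_block:
  assumes R: "partition_on {..<n} R" and B: "B \<in> R" and C: "C \<subseteq> B"
  shows "part_mset R \<in> Down S (one_block n C)"
proof -
  have fR: "finite R" using R finite_elements by blast
  have fB: "finite B'" if "B' \<in> R" for B'
    using R that finite_subset[of B' "{..<n}"] partition_onD1 by blast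
  have disj: "disjoint R" and UR: "\<Union>R = {..<n}" and ne: "{} \<notin> R"
    using R unfolding partition_on_def by auto
  \<comment> \<open>The pieces that make up the block \<open>B'\<close>: its singletons outside
    \<open>C\<close>, together with \<open>C\<close> itself if \<open>B'\<close> is the block that
    contains it.\<close>
  define N where "N B' = (if B' = B then {#mset_set C#} else {#}) +
    image_mset (\<lambda>i. {#i#}) (mset_set (B' - C))" for B'
  have other: "B' - C = B'" if "B' \<in> R" "B' \<noteq> B" for B'
    using disj that B C unfolding disjoint_def by blast
  have "N B' \<noteq> {#}" if "B' \<in> R" for B'
  proof (cases "B' = B")
    case False
    then have "B' - C \<noteq> {}" using other that ne by auto
    then show ?thesis using fB[OF that] by (simp add: N_def False mset_set_empty_iff)
  qed (simp add: N_def)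
  moreover have "(\<Sum>B'\<in>R. N B') = one_block n C"
  proof -
    have "(\<Sum>B'\<in>R. N B') = (\<Sum>B'\<in>R. if B' = B then {#mset_set C#} else {#}) +
        (\<Sum>B'\<in>R. image_mset (\<lambda>i. {#i#}) (mset_set (B' - C)))"
      unfolding N_def by (rule sum.distrib)
    also have "(\<Sum>B'\<in>R. if B' = B then {#mset_set C#} else {#}) = {#mset_set C#}"
      using B fR by simp
    also have "(\<Sum>B'\<in>R. image_mset (\<lambda>i. {#i#}) (mset_set (B' - C))) =
        image_mset (\<lambda>i. {#i#}) (\<Sum>B'\<in>R. mset_set (B' - C))"
      using fR by (induction R rule: finite_induct) auto
    also have "(\<Sum>B'\<in>R. mset_set (B' - C)) = mset_set ({..<n} - C)"
      using sum_mset_set_blocks[OF fR fB disj] UR by simp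
    finally show ?thesis by (simp add: one_block_def)
  qed
  ultimately have "image_mset (\<lambda>B'. \<Sum>\<^sub># (N B')) (mset_set R) + {#} \<in> Down S (one_block n C)"
    using Down.start by (intro Down_merge_family fR) auto
  moreover have "\<Sum>\<^sub># (N B') = mset_set B'" if "B' \<in> R" for B'
  proof (cases "B' = B")
    case True
    have "mset_set B = mset_set C + mset_set (B - C)"
      using fB[OF B] C mset_set_Union[of C "B - C"] finite_subset[OF C] by (simp add: Un_absorb1 Int_Diff)
    then show ?thesis by (simp add: N_def True sum_mset_singletons)
  next
    case False
    then show ?thesis using other that by (simp add: N_def sum_mset_singletons)
  qed
  then have "image_mset (\<lambda>B'. \<Sum>\<^sub># (N B')) (mset_set R) = part_mset R"
    unfolding part_mset_def using fR by (intro image_mset_cong) simp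
  ultimately show ?thesis by simp
qed

text \<open>
  The number of parts of size \<open>a\<close> that can be split off the block sums never decreases along
  the moves defining \<^term>\<open>Down\<close>.
\<close>

definition split_count :: "nat \<Rightarrow> (nat \<Rightarrow> nat) \<Rightarrow> nat multiset multiset \<Rightarrow> nat" where
  "split_count a w M = (\<Sum>B\<in>#M. (\<Sum>i\<in>#B. w i) div a)"

text \<open>Merging cannot lower the count because floors are superadditive, and an exchange
  preserves the weight of the block as the plus and minus sides of the vector weigh the
  same.\<close>

lemma Down_split_count:
  assumes "R \<in> Down S A"
    and S: "\<And>x. x \<in> S \<Longrightarrow> (\<Sum>i\<in>plus_idx x. w i) = (\<Sum>i\<in>minus_idx x. w i)"
  shows "split_count a w A \<le> split_count a w R"
  using assms(1)
proof (induction rule: Down.induct)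
  case (merge B C M)
  have "x div a + y div a \<le> (x + y) div a" for x y :: nat
    by (metis add_leE div_add1_eq le_add1)
  then show ?case
    using merge.IH by (fastforce simp: split_count_def intro: order_trans)
next
  case (exchange B M x)
  have "(\<Sum>i\<in>#B - mset_set (plus_idx x) + mset_set (minus_idx x). w i) = (\<Sum>i\<in>#B. w i)"
  proof -
    have "(\<Sum>i\<in>#B. w i) = (\<Sum>i\<in>#(B - mset_set (plus_idx x)) + mset_set (plus_idx x). w i)"
      using exchange(3) by simp
    then show ?thesis
      using S[OF exchange(2)] by (simp add: sum_unfold_sum_mset)
  qed
  then show ?case using exchange.IH by (simp add: split_count_def)
qed simp

section \<open>The closed family generated by collecting \<open>a\<close> ones\<close>

text \<open>The closure of the partition that joins the first \<open>a\<close> ones, by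
  \<open>down_lead_part\<close>. Being described without the cut, the family can be used with the
  block cut and the split cut alike.\<close>

definition big_parts :: "nat \<Rightarrow> nat \<Rightarrow> nat \<Rightarrow> nat set set set" where
  "big_parts a k l = {R \<in> parts (k + l). \<exists>B\<in>R. a \<le> card (B \<inter> {k..<k+l})}"

definition lead_part :: "nat \<Rightarrow> nat \<Rightarrow> nat \<Rightarrow> nat set list" where
  "lead_part a k l = map (\<lambda>i. {i}) [0..<k] @ [{k..<k+a}] @ map (\<lambda>i. {i}) [k+a..<k+l]"

lemma partition_insert_singletons:
  assumes "C \<subseteq> A" "C \<noteq> {}"
  shows "partition_on A (insert C ((\<lambda>i. {i}) ` (A - C)))"
proof (subst partition_on_insert)
  show "disjnt C (\<Union> ((\<lambda>i. {i}) ` (A - C)))"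
    by (auto simp: disjnt_def)
qed (use assms partition_on_singletons in auto)

lemma set_lead_part:
  assumes "a \<le> l"
  shows "set (lead_part a k l) = insert {k..<k+a} ((\<lambda>i. {i}) ` ({..<k+l} - {k..<k+a}))"
proof -
  have "{..<k+l} - {k..<k+a} = {0..<k} \<union> {k+a..<k+l}"
    using assms by auto
  then show ?thesis by (simp add: lead_part_def image_Un)
qed

lemma lead_part_oparts:
  assumes "0 < a" "a \<le> l"
  shows "lead_part a k l \<in> oparts (k + l)"
proof -
  have "distinct (lead_part a k l)"
  proof -
    have eq: "i = k" if "{k..<k+a} = {i}" for i
    proof -
      have "k \<in> {k..<k+a}" using assms by simp
      then show ?thesis using that by simp
    qed
    show ?thesis
      using assms by (auto simp: lead_part_def distinct_map inj_on_def dest: eq eq[OF sym])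
  qed
  moreover have "partition_on {..<k+l} (set (lead_part a k l))"
    unfolding set_lead_part[OF assms(2)] using assms by (intro partition_insert_singletons) auto
  ultimately show ?thesis
    by (simp add: oparts_def parts_def)
qed

lemma length_lead_part: "a \<le> l \<Longrightarrow> length (lead_part a k l) = Suc k + (l - a)"
  by (simp add: lead_part_def)

lemma nth_lead_part:
  assumes "j < Suc k + (l - a)" "a \<le> l" "0 < a"
  shows "lead_part a k l ! j = (if j < k then {j} else if j = k then {k..<k+a} else {j + a - 1})"
  using assms by (auto simp: lead_part_def nth_append)

text \<open>A vector that is constant on the collected block has \<open>a\<close> times its value
  there as the sum over the block, so the block acts as one more coordinate of weight
  \<open>a\<close>.\<close>

lemma pull_lead_part:
  assumes a: "0 < a" "a \<le> l"
  shows "pull (lead_part a k l) (block_cut a k l) = block_cut a (Suc k) (l - a)"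
proof -
  let ?m = "Suc k + (l - a)"
  have rel: "s \<in> block_cut a k l \<longleftrightarrow> t \<in> block_cut a (Suc k) (l - a)"
    if s: "s \<in> tern (k + l)" and t: "t \<in> tern ?m"
      and st: "\<forall>j<?m. \<forall>i\<in>lead_part a k l ! j. s ! i = t ! j" for s t
  proof -
    have 1: "s ! i = t ! i" if "i < k" for i
      using st[rule_format, of i i] that a by (simp add: nth_lead_part)
    have 2: "s ! i = t ! k" if "i \<in> {k..<k+a}" for i
      using st[rule_format, of k i] that a by (simp add: nth_lead_part)
    \<comment> \<open>The \<open>a\<close> collected ones shrink to one position, so later indices
      move by \<open>a - 1\<close>.\<close>
    have 3: "s ! (j + (a - 1)) = t ! j" if "k < j" "j < ?m" for j
      using st[rule_format, of j "j + a - 1"] that a by (simp add: nth_lead_part)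
    have "(\<Sum>i<k. s ! i) = (\<Sum>i<k. t ! i)"
      using 1 by (intro sum.cong) auto
    moreover have "(\<Sum>i=k..<k+a. s ! i) = int a * t ! k"
      using 2 by simp
    moreover have "(\<Sum>i=k+a..<k+l. s ! i) = (\<Sum>j=Suc k..<?m. t ! j)"
    proof -
      have "(\<Sum>i=k+a..<k+l. s ! i) = (\<Sum>i=Suc k+(a-1)..<?m+(a-1). s ! i)"
        using a by simp
      also have "\<dots> = (\<Sum>j=Suc k..<?m. s ! (j + (a - 1)))"
        by (rule sum.shift_bounds_nat_ivl)
      also have "\<dots> = (\<Sum>j=Suc k..<?m. t ! j)"
        using 3 by (intro sum.cong) auto
      finally show ?thesis .
    qed
    moreover have "(\<Sum>i=k..<k+l. s ! i) = (\<Sum>i=k..<k+a. s ! i) + (\<Sum>i=k+a..<k+l. s ! i)"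
      using a by (simp add: sum.atLeastLessThan_concat)
    ultimately show ?thesis
      using s t by (simp add: block_cut_def distrib_left add.assoc del: sum.op_ivl_Suc)
  qed
  show ?thesis
  proof (intro equalityI subsetI)
    fix t assume "t \<in> pull (lead_part a k l) (block_cut a k l)"
    then obtain s where "s \<in> block_cut a k l" "t \<in> tern ?m" "\<forall>j<?m. \<forall>i\<in>lead_part a k l ! j. s ! i = t ! j"
      using a unfolding pull_def length_lead_part[OF a(2)] by blast
    then show "t \<in> block_cut a (Suc k) (l - a)"
      using rel[of s t] by (auto simp: block_cut_def)
  next
    fix t assume t: "t \<in> block_cut a (Suc k) (l - a)"
    \<comment> \<open>\<open>g\<close> sends an index to the position of its block in
      \<open>lead_part\<close>; the witness \<open>s\<close> is \<open>t\<close> spread over the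
      blocks.\<close>
    define g where "g i = (if i < k then i else if i < k + a then k else i - (a - 1))" for i
    define s where "s = map (\<lambda>i. t ! g i) [0..<k+l]"
    have t': "t \<in> tern ?m" using t by (simp add: block_cut_def)
    have g: "g i < ?m" if "i < k + l" for i
      using that a by (auto simp: g_def)
    then have "s \<in> tern (k + l)"
      using tern_nth[OF t'] by (fastforce simp: s_def tern_def)
    moreover have st: "\<forall>j<?m. \<forall>i\<in>lead_part a k l ! j. s ! i = t ! j"
      using a by (auto simp: nth_lead_part s_def g_def split: if_splits)
    ultimately have "s \<in> block_cut a k l"
      using rel t t' by blast
    then show "t \<in> pull (lead_part a k l) (block_cut a k l)"
      unfolding pull_def length_lead_part[OF a(2)] using st t' by blast
  qed
qed

lemma sum_tern:
  assumes x: "x \<in> tern n" and I: "I \<subseteq> {..<n}"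
  shows "(\<Sum>i\<in>I. int (w i) * x ! i) = int (\<Sum>i\<in>{i \<in> I. x ! i = 1}. w i) - int (\<Sum>i\<in>{i \<in> I. x ! i = -1}. w i)"
proof -
  have fin: "finite I" using I finite_subset by blast
  have "(\<Sum>i\<in>I. int (w i) * x ! i) =
      (\<Sum>i\<in>I. (if x ! i = 1 then int (w i) else 0) - (if x ! i = -1 then int (w i) else 0))"
    using I tern_nth[OF x] by (intro sum.cong) (auto dest!: subsetD)
  then show ?thesis
    using fin by (simp only: of_nat_sum) (simp add: sum_subtractf sum.inter_filter)
qed

lemma split_count_part_mset:
  "split_count a w (part_mset R) = (\<Sum>B\<in>R. (\<Sum>i\<in>B. w i) div a)"
  by (simp add: split_count_def part_mset_def sum_unfold_sum_mset image_mset.compositionality o_def)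

text \<open>Swaps among the ones carry the collected block to any set of \<open>a\<close> ones, and
  merges then reach every partition with a block containing that set. Conversely, give weight
  \<open>a\<close> to the indices below \<open>k\<close> and weight 1 to the others. The generating
  partition has count at least \<open>k + 1\<close>. If every block has fewer than \<open>a\<close>
  ones, its count is its number of heavy indices, and the total is only \<open>k\<close>.\<close>

lemma down_lead_part:
  assumes a: "2 \<le> a" "a \<le> l"
  shows "down (k + l) (block_cut a k l) {set (lead_part a k l)} = big_parts a k l"
proof -
  let ?n = "k + l" and ?C = "{k..<k+a}" and ?D = "{k..<k+l}" and ?S = "block_cut a k l"
  have lead: "part_mset (set (lead_part a k l)) = one_block ?n ?C"
    using a by (subst one_block_eq_part_mset) (auto simp: set_lead_part)
  have "part_mset R \<in> Down ?S (one_block ?n ?C) \<longleftrightarrow> (\<exists>B\<in>R. a \<le> card (B \<inter> ?D))"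
    if R: "R \<in> parts ?n" for R
  proof
    have part: "partition_on {..<?n} R" using R by (simp add: parts_def)
    assume "\<exists>B\<in>R. a \<le> card (B \<inter> ?D)"
    then obtain B where B: "B \<in> R" "a \<le> card (B \<inter> ?D)" by blast
    then obtain C where C: "C \<subseteq> B \<inter> ?D" "card C = a"
      using obtain_subset_with_card_n[OF B(2)] by blast
    have "one_block ?n C \<in> Down ?S (one_block ?n ?C)"
    proof (rule one_block_Down[of ?D])
      fix i j assume "i \<in> ?D" "j \<in> ?D" "i \<noteq> j"
      then show "unit_diff ?n i j \<in> ?S"
        using unit_diff_split_cut split_subset_block by blast
    qed (use C a in auto)
    moreover have "part_mset R \<in> Down ?S (one_block ?n C)"
      using C by (intro partition_Down_one_block[OF part B(1)]) blast
    ultimately show "part_mset R \<in> Down ?S (one_block ?n ?C)"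
      by (rule Down_trans[rotated])
  next
    have part: "partition_on {..<?n} R" using R by (simp add: parts_def)
    define w where "w i = (if i < k then a else 1)" for i
    have w_int: "int (w i) = (if i < k then int a else 1)" for i by (simp add: w_def)
    assume down: "part_mset R \<in> Down ?S (one_block ?n ?C)"
    have "split_count a w (one_block ?n ?C) \<le> split_count a w (part_mset R)"
    proof (rule Down_split_count[OF down])
      fix x assume x: "x \<in> ?S"
      then have t: "x \<in> tern ?n" and "(\<Sum>i<?n. int (w i) * x ! i) = 0"
        by (simp_all add: block_cut_weighted w_int)
      moreover have "plus_idx x = {i \<in> {..<?n}. x ! i = 1}" "minus_idx x = {i \<in> {..<?n}. x ! i = -1}"
        using t by (auto simp: plus_idx_def minus_idx_def tern_def)
      ultimately show "(\<Sum>i\<in>plus_idx x. w i) = (\<Sum>i\<in>minus_idx x. w i)"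
        using sum_tern[OF t subset_refl, of w] by (simp del: of_nat_sum)
    qed
    moreover have "Suc k \<le> split_count a w (one_block ?n ?C)"
    proof -
      have "(\<Sum>i\<in>?C. w i) = a" by (simp add: w_def)
      moreover have "k \<le> (\<Sum>i\<in>{..<?n} - ?C. w i div a)"
      proof -
        have "k = (\<Sum>i<k. w i div a)" using a by (simp add: w_def)
        also have "\<dots> \<le> (\<Sum>i\<in>{..<?n} - ?C. w i div a)"
          by (intro sum_mono2) auto
        finally show ?thesis .
      qed
      ultimately show ?thesis
        using a by (simp add: one_block_def split_count_def image_mset.compositionality o_def
            sum_unfold_sum_mset)
    qed
    ultimately have count: "Suc k \<le> (\<Sum>B\<in>R. (\<Sum>i\<in>B. w i) div a)"
      by (simp add: split_count_part_mset)
    have fR: "finite R" using part finite_elements by blast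
    have sub: "B \<subseteq> {..<?n}" if "B \<in> R" for B
      using part that partition_onD1 by blast
    show "\<exists>B\<in>R. a \<le> card (B \<inter> ?D)"
    proof (rule ccontr)
      assume "\<not> ?thesis"
      then have small: "card (B \<inter> ?D) < a" if "B \<in> R" for B
        using that by force
      have "(\<Sum>i\<in>B. w i) div a = card (B \<inter> {..<k})" if B: "B \<in> R" for B
      proof -
        have fB: "finite B" using sub[OF B] finite_subset by blast
        have "B = (B \<inter> {..<k}) \<union> (B \<inter> ?D)" using sub[OF B] by auto
        then have "(\<Sum>i\<in>B. w i) = (\<Sum>i\<in>B \<inter> {..<k}. w i) + (\<Sum>i\<in>B \<inter> ?D. w i)"
          using fB by (subst sum.union_disjoint[symmetric]) auto
        also have "\<dots> = a * card (B \<inter> {..<k}) + card (B \<inter> ?D)"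
          by (simp add: w_def)
        finally show ?thesis using small[OF B] by simp
      qed
      then have "(\<Sum>B\<in>R. (\<Sum>i\<in>B. w i) div a) = (\<Sum>B\<in>R. card (B \<inter> {..<k}))"
        by (intro sum.cong) auto
      also have "\<dots> = card (\<Union>B\<in>R. B \<inter> {..<k})"
      proof (rule card_UN_disjoint[symmetric, OF fR])
        show "\<forall>B\<in>R. \<forall>B'\<in>R. B \<noteq> B' \<longrightarrow> (B \<inter> {..<k}) \<inter> (B' \<inter> {..<k}) = {}"
          using partition_onD2[OF part] unfolding disjoint_def by blast
      qed simp
      also have "(\<Union>B\<in>R. B \<inter> {..<k}) = {..<k}"
        using partition_onD1[OF part] by auto
      finally show False using count by simp
    qed
  qed
  then show ?thesis
    by (auto simp: down_def big_parts_def lead)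
qed

lemma closed_big_parts:
  assumes "2 \<le> a" "a \<le> l"
  shows "closed_parts (k + l) (block_cut a k l) (big_parts a k l)"
    and "closed_parts (k + l) (split_cut k l) (big_parts a k l)"
proof -
  have "set (lead_part a k l) \<in> parts (k + l)"
    using lead_part_oparts[of a l k] assms by (simp add: oparts_def)
  then show "closed_parts (k + l) (block_cut a k l) (big_parts a k l)"
    using closed_parts_down[of "{set (lead_part a k l)}" "k + l" "block_cut a k l"] down_lead_part[OF assms]
    by simp
  then show "closed_parts (k + l) (split_cut k l) (big_parts a k l)"
    by (rule closed_parts_antimono) (rule split_subset_block)
qed

text \<open>Membership in a stratum forces equal nonzero signs on each block with two elements or
  more. Conversely, \<open>a\<close> ones carrying the same sign, with all other indices as
  singletons, form a partition in \<open>big_parts\<close> whose stratum contains the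
  vector.\<close>

lemma cut_minus_big_parts:
  assumes S: "S \<subseteq> tern (k + l)" and a: "2 \<le> a"
  shows "cut_minus S (big_parts a k l) =
    {x \<in> S. card {i \<in> {k..<k+l}. x ! i = 1} < a \<and> card {i \<in> {k..<k+l}. x ! i = -1} < a}"
proof -
  let ?D = "{k..<k+l}"
  have "(\<exists>P\<in>big_parts a k l. x \<in> stratum S P) \<longleftrightarrow>
      a \<le> card {i \<in> ?D. x ! i = 1} \<or> a \<le> card {i \<in> ?D. x ! i = -1}" if x: "x \<in> S" for x
  proof
    assume "\<exists>P\<in>big_parts a k l. x \<in> stratum S P"
    then obtain P B where B: "B \<in> P" "a \<le> card (B \<inter> ?D)" and P: "x \<in> stratum S P"
      by (auto simp: big_parts_def)
    have eq: "x ! i = x ! j \<and> x ! i \<noteq> 0" if "i \<in> B" "j \<in> B" "i \<noteq> j" for i j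
      using P B(1) that unfolding stratum_def by blast
    have "B \<inter> ?D \<noteq> {}" using B(2) a by (metis card.empty not_numeral_le_zero order_trans)
    then obtain i where i: "i \<in> B \<inter> ?D" by blast
    \<comment> \<open>A stratum constrains only pairs of distinct indices, so a second element of
      the block is what shows that \<open>x ! i\<close> is nonzero. This is where
      \<open>2 <= a\<close> enters.\<close>
    have "\<not> B \<inter> ?D \<subseteq> {i}"
      using B(2) a card_mono[of "{i}" "B \<inter> ?D"] by auto
    then obtain j where j: "j \<in> B" "j \<noteq> i" by blast
    have "B \<inter> ?D \<subseteq> {h \<in> ?D. x ! h = x ! i}"
      using eq i by blast
    then have "card (B \<inter> ?D) \<le> card {h \<in> ?D. x ! h = x ! i}"
      by (intro card_mono) simp_all
    then have "a \<le> card {h \<in> ?D. x ! h = x ! i}"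
      using B(2) by simp
    moreover have "x ! i = 1 \<or> x ! i = -1"
      using eq[of i j] i j tern_nth[of x "k + l" i] x S by auto
    ultimately show "a \<le> card {i \<in> ?D. x ! i = 1} \<or> a \<le> card {i \<in> ?D. x ! i = -1}"
      by auto
  next
    assume "a \<le> card {i \<in> ?D. x ! i = 1} \<or> a \<le> card {i \<in> ?D. x ! i = -1}"
    then obtain c where c: "c \<noteq> 0" "a \<le> card {i \<in> ?D. x ! i = c}"
    proof
      assume "a \<le> card {i \<in> ?D. x ! i = 1}"
      then show ?thesis by (intro that[of 1]) simp_all
    next
      assume "a \<le> card {i \<in> ?D. x ! i = -1}"
      then show ?thesis by (intro that[of "-1"]) simp_all
    qed
    then obtain C where C: "C \<subseteq> {i \<in> ?D. x ! i = c}" "card C = a"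
      using obtain_subset_with_card_n[OF c(2)] by blast
    let ?P = "insert C ((\<lambda>i. {i}) ` ({..<k+l} - C))"
    have "C \<subseteq> ?D" using C(1) by blast
    then have CD: "C \<subseteq> {..<k+l}" "C \<inter> ?D = C" by auto
    have "C \<noteq> {}" using C(2) a by fastforce
    then have "partition_on {..<k+l} ?P"
      using CD by (intro partition_insert_singletons)
    then have "?P \<in> big_parts a k l"
      using C(2) CD(2) unfolding big_parts_def parts_def
      by (intro CollectI conjI bexI[of _ C]) simp_all
    moreover have "x ! i = c" if "i \<in> C" for i
      using C(1) that by blast
    then have "x \<in> stratum S ?P"
      using x c(1) unfolding stratum_def by simp
    ultimately show "\<exists>P\<in>big_parts a k l. x \<in> stratum S P" by blast
  qed
  then show ?thesis
    unfolding cut_minus_def by (auto simp: not_le[symmetric])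
qed

lemma cut_minus_block_eq_split:
  assumes a: "2 \<le> a"
  shows "cut_minus (block_cut a k l) (big_parts a k l) = cut_minus (split_cut k l) (big_parts a k l)"
proof -
  have "x \<in> split_cut k l" if x: "x \<in> block_cut a k l"
    and small: "card {i \<in> {k..<k+l}. x ! i = 1} < a" "card {i \<in> {k..<k+l}. x ! i = -1} < a" for x
  proof -
    have t: "x \<in> tern (k + l)" and eq: "int a * (\<Sum>i<k. x ! i) + (\<Sum>i=k..<k+l. x ! i) = 0"
      using x by (auto simp: block_cut_def)
    have "{k..<k+l} \<subseteq> {..<k+l}" by auto
    from sum_tern[OF t this, of "\<lambda>_. 1"] have "\<bar>\<Sum>i=k..<k+l. x ! i\<bar> < int a"
      using small by simp
    moreover have "(\<Sum>i=k..<k+l. x ! i) = int a * - (\<Sum>i<k. x ! i)"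
      using eq by simp
    ultimately have "(\<Sum>i=k..<k+l. x ! i) = 0"
      by (metis dvd_imp_le_int dvd_triv_left abs_of_nat linorder_not_le)
    then show ?thesis using eq t a by (simp add: split_cut_def)
  qed
  moreover have "block_cut a k l \<subseteq> tern (k + l)" "split_cut k l \<subseteq> tern (k + l)"
    by (auto simp: block_cut_def split_cut_def)
  ultimately show ?thesis
    using split_subset_block[of k l a] a by (auto simp: cut_minus_big_parts)
qed

text \<open>With fewer than \<open>a\<close> ones no sign can occur \<open>a\<close> times, so the
  divisibility argument applies to every vector of the cut.\<close>

lemma block_cut_eq_split_cut:
  assumes "l < a"
  shows "block_cut a k l = split_cut k l"
proof -
  have "x \<in> split_cut k l" if x: "x \<in> block_cut a k l" for x
  proof -
    have t: "x \<in> tern (k + l)" and eq: "int a * (\<Sum>i<k. x ! i) + (\<Sum>i=k..<k+l. x ! i) = 0"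
      using x by (auto simp: block_cut_def)
    have small: "card {i \<in> {k..<k+l}. x ! i = c} < a" for c
    proof -
      have "card {i \<in> {k..<k+l}. x ! i = c} \<le> card {k..<k+l}" by (intro card_mono) auto
      then show ?thesis using assms by simp
    qed
    have "{k..<k+l} \<subseteq> {..<k+l}" by auto
    from sum_tern[OF t this, of "\<lambda>_. 1"] have "\<bar>\<Sum>i=k..<k+l. x ! i\<bar> < int a"
      using small[of 1] small[of "-1"] by simp
    moreover have "(\<Sum>i=k..<k+l. x ! i) = int a * - (\<Sum>i<k. x ! i)"
      using eq by simp
    ultimately have "(\<Sum>i=k..<k+l. x ! i) = 0"
      by (metis dvd_imp_le_int dvd_triv_left abs_of_nat linorder_not_le)
    then show ?thesis using eq t assms by (simp add: split_cut_def)
  qed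
  then show ?thesis using split_subset_block by blast
qed

section \<open>Concatenation and products of relative cuts\<close>

lemma sum_append:
  assumes "length x = k" "length y = l"
  shows "(\<Sum>i<k. (x @ y) ! i) = (\<Sum>i<k. x ! i)" "(\<Sum>i=k..<k+l. (x @ y) ! i) = (\<Sum>i<l. y ! i)"
proof -
  show "(\<Sum>i<k. (x @ y) ! i) = (\<Sum>i<k. x ! i)"
    using assms by (simp add: nth_append)
  have "(\<Sum>i=k..<k+l. (x @ y) ! i) = (\<Sum>i=0+k..<l+k. (x @ y) ! i)"
    by (simp add: add.commute)
  also have "\<dots> = (\<Sum>i=0..<l. (x @ y) ! (i + k))"
    by (rule sum.shift_bounds_nat_ivl)
  finally show "(\<Sum>i=k..<k+l. (x @ y) ! i) = (\<Sum>i<l. y ! i)"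
    using assms by (simp add: nth_append lessThan_atLeast0)
qed

lemma split_cut_append:
  assumes "length x = k" "length y = l"
  shows "x @ y \<in> split_cut k l \<longleftrightarrow> x \<in> split_cut 0 k \<and> y \<in> split_cut 0 l"
  using assms sum_append[OF assms] by (auto simp: split_cut_def tern_def lessThan_atLeast0)

lemma card_append:
  assumes "length x = k" "length y = l"
  shows "card {i \<in> {k..<k+l}. (x @ y) ! i = c} = card {i \<in> {0..<0+l}. y ! i = c}"
proof -
  have "{i \<in> {k..<k+l}. (x @ y) ! i = c} = (\<lambda>i. i + k) ` {i \<in> {0..<0+l}. y ! i = c}"
    using assms by (force simp: nth_append image_iff intro: exI[of _ "_ - k"])
  then show ?thesis by (simp add: card_image)
qed

text \<open>The removed vectors are singled out by their signs on the ones, that is, by the second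
  factor alone.\<close>

lemma cut_minus_split_append:
  assumes "2 \<le> a"
  shows "{x @ y |x y. x \<in> split_cut 0 k \<and> y \<in> cut_minus (split_cut 0 l) (big_parts a 0 l)} =
    cut_minus (split_cut k l) (big_parts a k l)"
proof -
  have sub: "split_cut 0 l \<subseteq> tern (0 + l)" "split_cut k l \<subseteq> tern (k + l)" "split_cut 0 k \<subseteq> tern k"
    by (auto simp: split_cut_def)
  have len: "length x = k" if "x \<in> split_cut 0 k" for x using that sub(3) by (auto simp: tern_def)
  have len': "length x = l" if "x \<in> split_cut 0 l" for x using that sub(1) by (auto simp: tern_def)
  show ?thesis
    unfolding cut_minus_big_parts[OF sub(1) assms] cut_minus_big_parts[OF sub(2) assms]
  proof (intro equalityI subsetI)
    fix z assume "z \<in> {x @ y |x y. x \<in> split_cut 0 k \<and> y \<in> {x \<in> split_cut 0 l.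
      card {i \<in> {0..<0+l}. x ! i = 1} < a \<and> card {i \<in> {0..<0+l}. x ! i = -1} < a}}"
    then obtain x y where xy: "z = x @ y" "x \<in> split_cut 0 k" "y \<in> split_cut 0 l"
      "card {i \<in> {0..<0+l}. y ! i = 1} < a" "card {i \<in> {0..<0+l}. y ! i = -1} < a"
      by blast
    have l: "length x = k" "length y = l" using len len' xy by blast+
    show "z \<in> {x \<in> split_cut k l. card {i \<in> {k..<k+l}. x ! i = 1} < a \<and>
       card {i \<in> {k..<k+l}. x ! i = -1} < a}"
      using xy split_cut_append[OF l] card_append[OF l, of 1] card_append[OF l, of "-1"] by simp
  next
    fix z assume z: "z \<in> {x \<in> split_cut k l. card {i \<in> {k..<k+l}. x ! i = 1} < a \<and>
       card {i \<in> {k..<k+l}. x ! i = -1} < a}"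
    have "length z = k + l" using z sub(2) by (auto simp: tern_def)
    then have l: "length (take k z) = k" "length (drop k z) = l" by auto
    then show "z \<in> {x @ y |x y. x \<in> split_cut 0 k \<and> y \<in> {x \<in> split_cut 0 l.
      card {i \<in> {0..<0+l}. x ! i = 1} < a \<and> card {i \<in> {0..<0+l}. x ! i = -1} < a}}"
      using z split_cut_append[OF l] card_append[OF l]
      by (intro CollectI exI[of _ "take k z"] exI[of _ "drop k z"]) auto
  qed
qed

lemma split_cut_eq_append:
  "{x @ y |x y. x \<in> split_cut 0 k \<and> y \<in> split_cut 0 l} = split_cut k l"
proof (intro equalityI subsetI)
  fix z assume "z \<in> {x @ y |x y. x \<in> split_cut 0 k \<and> y \<in> split_cut 0 l}"
  then show "z \<in> split_cut k l"
    by (auto simp: split_cut_append split_cut_def[of 0] tern_def)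
next
  fix z assume z: "z \<in> split_cut k l"
  then have "length z = k + l" by (auto simp: split_cut_def tern_def)
  then have l: "length (take k z) = k" "length (drop k z) = l" by auto
  then show "z \<in> {x @ y |x y. x \<in> split_cut 0 k \<and> y \<in> split_cut 0 l}"
    using z split_cut_append[OF l] by (intro CollectI exI[of _ "take k z"] exI[of _ "drop k z"]) auto
qed

lemma parts_times_empty: "parts_times n m {} \<Lambda> = {}" "parts_times n m \<Gamma> {} = {}"
  by (auto simp: parts_times_def)

lemma restrict_part_parts:
  assumes P: "P \<in> parts (k + l)"
  shows "restrict_part P {..<k} \<in> parts k"
    and "(\<lambda>B. (\<lambda>i. i - k) ` B) ` restrict_part P {k..<k+l} \<in> parts l"
proof -
  have part: "partition_on {..<k+l} P" using P by (simp add: parts_def)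
  have r: "restrict_part P A = (\<inter>) A ` P - {{}}" for A
    by (simp add: restrict_part_def Int_commute)
  have "{..<k} \<inter> {..<k+l} = {..<k}" by auto
  then show "restrict_part P {..<k} \<in> parts k"
    using partition_on_restrict[OF part, of "{..<k}"] by (simp add: r parts_def)
  have "{k..<k+l} \<inter> {..<k+l} = {k..<k+l}" by auto
  then have 1: "partition_on {k..<k+l} (restrict_part P {k..<k+l})"
    using partition_on_restrict[OF part, of "{k..<k+l}"] by (simp add: r)
  have "inj_on (\<lambda>i. i - k) {k..<k+l}" by (auto simp: inj_on_def)
  from partition_on_inj_image[OF 1 this]
  have "partition_on ((\<lambda>i. i - k) ` {k..<k+l}) ((`) (\<lambda>i. i - k) ` restrict_part P {k..<k+l} - {{}})" .
  moreover have "(\<lambda>i. i - k) ` {k..<k+l} = {..<l}"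
    by (force simp: image_iff intro: bexI[of _ "_ + k"])
  moreover have "{} \<notin> (`) (\<lambda>i. i - k) ` restrict_part P {k..<k+l}"
    by (auto simp: restrict_part_def)
  ultimately show "(\<lambda>B. (\<lambda>i. i - k) ` B) ` restrict_part P {k..<k+l} \<in> parts l"
    by (simp add: parts_def)
qed

text \<open>The defining count sees a block only through its trace on the ones. As \<open>a\<close>
  is positive, a trace that is large enough is nonempty and survives in
  \<open>restrict_part\<close>.\<close>

lemma parts_times_big_parts:
  assumes "0 < a"
  shows "parts_times k l (parts k) (big_parts a 0 l) = big_parts a k l"
proof -
  have "(\<exists>B\<in>(\<lambda>B. (\<lambda>i. i - k) ` B) ` restrict_part P {k..<k+l}. a \<le> card (B \<inter> {0..<0+l})) \<longleftrightarrow>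
      (\<exists>B\<in>P. a \<le> card (B \<inter> {k..<k+l}))" for P
  proof -
    have card: "card ((\<lambda>i. i - k) ` (B \<inter> {k..<k+l}) \<inter> {0..<0+l}) = card (B \<inter> {k..<k+l})" for B
    proof -
      have "(\<lambda>i. i - k) ` (B \<inter> {k..<k+l}) \<inter> {0..<0+l} = (\<lambda>i. i - k) ` (B \<inter> {k..<k+l})"
        by auto
      moreover have "inj_on (\<lambda>i. i - k) (B \<inter> {k..<k+l})" by (auto simp: inj_on_def)
      ultimately show ?thesis by (simp add: card_image)
    qed
    have "B \<inter> {k..<k+l} \<noteq> {}" if "a \<le> card (B \<inter> {k..<k+l})" for B
    proof
      assume "B \<inter> {k..<k+l} = {}"
      then show False using that assms by simp
    qed
    then have "(\<exists>B\<in>P. a \<le> card (B \<inter> {k..<k+l})) \<longleftrightarrow>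
        (\<exists>B\<in>restrict_part P {k..<k+l}. a \<le> card (B \<inter> {k..<k+l}))"
    proof (intro iffI; elim bexE)
      fix B assume B: "B \<in> P" "a \<le> card (B \<inter> {k..<k+l})"
        and ne: "\<And>B. a \<le> card (B \<inter> {k..<k+l}) \<Longrightarrow> B \<inter> {k..<k+l} \<noteq> {}"
      have "B \<inter> {k..<k+l} \<in> restrict_part P {k..<k+l}"
        using B ne[OF B(2)] by (simp add: restrict_part_def)
      then show "\<exists>B\<in>restrict_part P {k..<k+l}. a \<le> card (B \<inter> {k..<k+l})"
        using B(2) by (intro bexI[of _ "B \<inter> {k..<k+l}"]) (simp_all add: Int_assoc)
    next
      fix B assume "B \<in> restrict_part P {k..<k+l}" "a \<le> card (B \<inter> {k..<k+l})"
      then show "\<exists>B\<in>P. a \<le> card (B \<inter> {k..<k+l})"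
        by (auto simp: restrict_part_def Int_assoc)
    qed
    moreover have "B \<inter> {k..<k+l} = B" if "B \<in> restrict_part P {k..<k+l}" for B
      using that by (auto simp: restrict_part_def)
    then have "card ((\<lambda>i. i - k) ` B \<inter> {0..<0+l}) = card (B \<inter> {k..<k+l})"
      if "B \<in> restrict_part P {k..<k+l}" for B
      using card[of B] that by simp
    then have "(\<exists>B\<in>(\<lambda>B. (\<lambda>i. i - k) ` B) ` restrict_part P {k..<k+l}. a \<le> card (B \<inter> {0..<0+l})) \<longleftrightarrow>
        (\<exists>B\<in>restrict_part P {k..<k+l}. a \<le> card (B \<inter> {k..<k+l}))"
      by (simp only: bex_simps(7)) (rule bex_cong[OF refl], simp)
    ultimately show ?thesis by (rule trans[OF _ sym, rotated])
  qed
  then show ?thesis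
    unfolding parts_times_def big_parts_def[of a 0] big_parts_def[of a k]
    using restrict_part_parts by auto
qed

text \<open>The empty family of the first factor contributes no partition, so the product family
  comes entirely from the second factor.\<close>

lemma relcut_times_big_parts:
  assumes "2 \<le> a"
  shows "relcut_times k l (split_cut 0 k, {}) (cut_minus (split_cut 0 l) (big_parts a 0 l), big_parts a 0 l) =
    (cut_minus (split_cut k l) (big_parts a k l), big_parts a k l)"
  using cut_minus_split_append[OF assms] assms
  by (simp add: relcut_times_def parts_times_empty parts_times_big_parts)

lemma relcut_times_split_cut:
  "relcut_times k l (split_cut 0 k, {}) (split_cut 0 l, {}) = (split_cut k l, {})"
  by (simp add: relcut_times_def parts_times_empty split_cut_eq_append)

lemma tspan_split_cut:
  assumes "0 < k + l"
  shows "tspan (k + l) (split_cut k l) = split_cut k l"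
  using split_cut_in_cuts[OF assms] by (simp add: cuts_def)

text \<open>A difference of unit vectors has one index of each sign, so it survives the removal when
  \<open>2 <= a\<close>, and these differences already span. \<open>Frel\<close> relies on this, as
  it recovers the underlying cut by taking the span.\<close>

lemma tspan_cut_minus_big_parts:
  assumes "2 \<le> a"
  shows "tspan (k + l) (cut_minus (split_cut k l) (big_parts a k l)) = split_cut k l"
proof (rule tspan_eq_split_cut)
  show "cut_minus (split_cut k l) (big_parts a k l) \<subseteq> split_cut k l"
    by (auto simp: cut_minus_def)
  fix i j assume ij: "i \<noteq> j" "i < k \<and> j < k \<or> i \<in> {k..<k+l} \<and> j \<in> {k..<k+l}"
  have "{h \<in> {k..<k+l}. unit_diff (k + l) i j ! h = 1} \<subseteq> {i}"
    "{h \<in> {k..<k+l}. unit_diff (k + l) i j ! h = -1} \<subseteq> {j}"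
    by (auto simp: nth_unit_diff split: if_splits)
  then have "card {h \<in> {k..<k+l}. unit_diff (k + l) i j ! h = 1} \<le> 1"
    "card {h \<in> {k..<k+l}. unit_diff (k + l) i j ! h = -1} \<le> 1"
    using card_mono[of "{i}"] card_mono[of "{j}"] by auto
  moreover have "split_cut k l \<subseteq> tern (k + l)" by (auto simp: split_cut_def)
  ultimately show "unit_diff (k + l) i j \<in> cut_minus (split_cut k l) (big_parts a k l)"
    using unit_diff_split_cut[OF ij] assms by (simp add: cut_minus_big_parts)
qed

lemma relative_cut_split_cut:
  assumes "0 < k"
  shows "relative_cut k (split_cut 0 k, {})"
  using tspan_split_cut[of 0 k] split_cut_in_cuts[of 0 k] assms
  by (auto simp: relative_cut_def closed_parts_empty cut_minus_empty split_cut_def)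

lemma relative_cut_big_parts:
  assumes "2 \<le> a" "a \<le> l"
  shows "relative_cut l (cut_minus (split_cut 0 l) (big_parts a 0 l), big_parts a 0 l)"
proof -
  have "cut_minus (split_cut 0 l) (big_parts a 0 l) \<subseteq> tern l"
    by (auto simp: cut_minus_def split_cut_def)
  then show ?thesis
    using tspan_cut_minus_big_parts[of a 0 l] split_cut_in_cuts[of 0 l] closed_big_parts(2)[of a l 0] assms
    by (simp add: relative_cut_def)
qed

section \<open>Resonance functors on two-valued partitions\<close>

locale contractible_resonance_functor =
  fixes Fo :: "int list set \<Rightarrow> 'a pointed"
    and Fm :: "int list set \<Rightarrow> int list set \<Rightarrow> nat set list \<Rightarrow> 'a \<Rightarrow> 'a"
    and a :: nat
  assumes res: "resonance_functor Fo Fm" and a2: "2 \<le> a"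
    and contr: "\<And>j. 2 \<le> j \<Longrightarrow> pointed_contractible (Fo (split_cut 0 j))"
begin

abbreviation F :: "nat \<Rightarrow> nat \<Rightarrow> 'a pointed" where
  "F k l \<equiv> Fo (block_cut a k l)"

lemma pointed_space_Fo: "S \<in> cuts n \<Longrightarrow> pointed_space (Fo S)"
  using res by (auto simp: resonance_functor_def res_pointed_functor_def)

lemma pointed_space_F: "0 < k + l \<Longrightarrow> pointed_space (F k l)"
  using pointed_space_Fo block_cut_in_cuts[of a k l] a2 by simp

lemma block_cut_0: "block_cut a 0 l = split_cut 0 l"
  by (rule trans[OF partition_cut_ones[symmetric] split_cut_0[symmetric]])

lemma Fquot_empty: "Fquot Fo Fm n S {} = Fo S"
  by (simp add: Fquot_def collapse_empty)

lemma smash_heq_times: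
  "relative_cut n C \<Longrightarrow> relative_cut m D \<Longrightarrow>
    pointed_heq (smash (Frel Fo Fm n C) (Frel Fo Fm m D)) (Frel Fo Fm (n + m) (relcut_times n m C D))"
  using res unfolding resonance_functor_def direct_product_axiom_def by blast

text \<open>The case \<open>k = 0\<close>, the quotient for \<open>(1^l)\<close>, reappears as the
  second smash factor for every positive \<open>k\<close>.\<close>

definition quot :: "nat \<Rightarrow> nat \<Rightarrow> 'a pointed" where
  "quot k l = collapse (fst (F k l)) (pull_image Fo Fm (block_cut a k l) (lead_part a k l)) (snd (F k l))"

lemma F_cofibration:
  assumes "a \<le> l"
  obtains i where "pointed_map (F (Suc k) (l - a)) (F k l) i" "inj_on i (topspace (fst (F (Suc k) (l - a))))"
    "pointed_hep (F (Suc k) (l - a)) (F k l) i"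
    "quot k l = collapse (fst (F k l)) (i ` topspace (fst (F (Suc k) (l - a)))) (snd (F k l))"
proof -
  have cut: "block_cut a k l \<in> cuts (k + l)" and p: "lead_part a k l \<in> oparts (k + l)"
    and pull: "pull (lead_part a k l) (block_cut a k l) = block_cut a (Suc k) (l - a)"
    using a2 assms by (auto intro!: block_cut_in_cuts lead_part_oparts pull_lead_part)
  let ?i = "Fm (block_cut a (Suc k) (l - a)) (block_cut a k l) (lead_part a k l)"
  have "inclusion_cofibration (F (Suc k) (l - a)) (F k l) ?i"
    using res cut p pull unfolding resonance_functor_def inclusion_axiom_def by metis
  then show ?thesis
    by (intro that[of ?i])
       (auto simp: inclusion_cofibration_def embedding_map_def quot_def pull_image_def pull
          dest: homeomorphic_imp_injective_map)
qed

text \<open>Axiom (A1), with the closure of the collected partition identified by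
  \<open>down_lead_part\<close>.\<close>

lemma quot_Fquot:
  assumes "a \<le> l"
  shows "pointed_heq (quot k l) (Fquot Fo Fm (k + l) (block_cut a k l) (big_parts a k l))"
proof -
  have "block_cut a k l \<in> cuts (k + l)" "lead_part a k l \<in> oparts (k + l)"
    using a2 assms by (auto intro!: block_cut_in_cuts lead_part_oparts)
  then show ?thesis
    using res a2 assms down_lead_part[of a l k]
    unfolding resonance_functor_def inclusion_axiom_def quot_def by metis
qed

lemma pointed_space_quot: "0 < k + l \<Longrightarrow> pointed_space (quot k l)"
  unfolding quot_def using pointed_space_F[of k l]
  by (intro pointed_space_collapse) (simp add: pointed_space_def)

text \<open>(A2) applies to one and the same relative cut, presented once by the block cut and once
  by the split cut. (A3) then separates the two groups of coordinates, and (A1), read backwards,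
  returns the second factor to a quotient by a single image.\<close>

lemma quot_smash:
  assumes k: "0 < k" and l: "a \<le> l"
  shows "pointed_heq (quot k l) (smash (Fo (split_cut 0 k)) (quot 0 l))"
proof -
  let ?C = "(split_cut 0 k, {})" and ?L = "big_parts a 0 l" and ?G = "big_parts a k l"
  let ?D = "(cut_minus (split_cut 0 l) ?L, ?L)"
  have "Qcut (block_cut a k l) ?G = Qcut (split_cut k l) ?G"
    using cut_minus_block_eq_split[OF a2] by (simp add: Qcut_def)
  moreover have "block_cut a k l \<in> cuts (k + l)" "split_cut k l \<in> cuts (k + l)"
    using a2 k by (auto intro!: block_cut_in_cuts split_cut_in_cuts)
  ultimately have "pointed_heq (Fquot Fo Fm (k + l) (block_cut a k l) ?G)
      (Fquot Fo Fm (k + l) (split_cut k l) ?G)"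
    using res closed_big_parts[OF a2 l, of k]
    unfolding resonance_functor_def relative_resonance_axiom_def by metis
  with quot_Fquot[OF l] have "pointed_heq (quot k l) (Fquot Fo Fm (k + l) (split_cut k l) ?G)"
    by (rule pointed_heq_trans)
  also have "Fquot Fo Fm (k + l) (split_cut k l) ?G = Frel Fo Fm (k + l) (relcut_times k l ?C ?D)"
    using tspan_cut_minus_big_parts[OF a2, of k l]
    by (simp add: Frel_def relcut_times_big_parts[OF a2])
  also have "pointed_heq \<dots> (smash (Frel Fo Fm k ?C) (Frel Fo Fm l ?D))"
    by (intro pointed_heq_sym[OF smash_heq_times] relative_cut_split_cut relative_cut_big_parts a2 k l)
  also have "Frel Fo Fm k ?C = Fo (split_cut 0 k)"
    using tspan_split_cut[of 0 k] k by (simp add: Frel_def Fquot_empty)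
  also have "Frel Fo Fm l ?D = Fquot Fo Fm l (split_cut 0 l) ?L"
    using tspan_cut_minus_big_parts[OF a2, of 0 l] by (simp add: Frel_def)
  also have "pointed_heq (smash (Fo (split_cut 0 k)) (Fquot Fo Fm l (split_cut 0 l) ?L))
      (smash (Fo (split_cut 0 k)) (quot 0 l))"
  proof (intro smash_heq pointed_heq_refl)
    show "pointed_heq (Fquot Fo Fm l (split_cut 0 l) ?L) (quot 0 l)"
      using pointed_heq_sym[OF quot_Fquot[OF l, of 0]] by (simp add: block_cut_0)
    have "pointed_space (Fo (split_cut 0 l))" "pointed_space (Fo (split_cut 0 k))"
      using pointed_space_F[of 0 l] pointed_space_F[of 0 k] k l a2 by (simp_all add: block_cut_0)
    then show "pointed_space (Fo (split_cut 0 k))" "pointed_space (Fo (split_cut 0 k))"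
      "pointed_space (Fquot Fo Fm l (split_cut 0 l) ?L)"
      unfolding Fquot_def by (simp_all add: pointed_space_collapse pointed_space_def[of "Fo S" for S])
    show "pointed_space (quot 0 l)"
      using pointed_space_quot[of 0 l] l a2 by simp
  qed
  finally show ?thesis .
qed

text \<open>Here the cut itself is a product, and (A3) is applied with empty families.\<close>

lemma F_heq_smash_small:
  assumes k: "0 < k" and l: "0 < l" "l < a"
  shows "pointed_heq (F k l) (smash (Fo (split_cut 0 k)) (Fo (split_cut 0 l)))"
proof -
  have "F k l = Fo (split_cut k l)"
    using block_cut_eq_split_cut[OF l(2)] by simp
  also have "\<dots> = Frel Fo Fm (k + l) (relcut_times k l (split_cut 0 k, {}) (split_cut 0 l, {}))"
    using tspan_split_cut[of k l] k by (simp add: Frel_def Fquot_empty relcut_times_split_cut)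
  also have "pointed_heq \<dots> (smash (Frel Fo Fm k (split_cut 0 k, {})) (Frel Fo Fm l (split_cut 0 l, {})))"
    by (intro pointed_heq_sym[OF smash_heq_times] relative_cut_split_cut k l)
  also have "Frel Fo Fm k (split_cut 0 k, {}) = Fo (split_cut 0 k)"
    using tspan_split_cut[of 0 k] k by (simp add: Frel_def Fquot_empty)
  also have "Frel Fo Fm l (split_cut 0 l, {}) = Fo (split_cut 0 l)"
    using tspan_split_cut[of 0 l] l by (simp add: Frel_def Fquot_empty)
  finally show ?thesis .
qed

lemma F_no_ones: "F k 0 = Fo (split_cut 0 k)"
  using partition_cut_block[of k a 0] partition_cut_no_ones[of a k] a2 by (simp add: split_cut_0)

lemma pointed_space_ones: "0 < j \<Longrightarrow> pointed_space (Fo (split_cut 0 j))"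
  using pointed_space_F[of 0 j] by (simp add: block_cut_0)

lemma F_contractible_ge_2:
  assumes "2 \<le> k"
  shows "pointed_contractible (F k l)"
  using assms
proof (induction l arbitrary: k rule: less_induct)
  case (less l)
  \<comment> \<open>The case \<open>l = 0\<close> stands apart from \<open>l < a\<close> because
    there is no cut of length 0 to serve as a smash factor. In the last case collecting ones raises
    \<open>k\<close>, so the induction hypothesis is needed for every \<open>k\<close>.\<close>
  consider "l = 0" | "0 < l" "l < a" | "a \<le> l" by linarith
  then show ?case
  proof cases
    case 1
    then show ?thesis using contr less.prems by (simp add: F_no_ones)
  next
    case 2
    have "pointed_contractible (smash (Fo (split_cut 0 k)) (Fo (split_cut 0 l)))"
      using less.prems 2 by (intro smash_contractible contr pointed_space_ones) auto
    then show ?thesis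
      using F_heq_smash_small[of k l] less.prems 2 by (intro pointed_contractible_heq[OF F_heq_smash_small]) auto
  next
    case 3
    obtain i where i: "pointed_map (F (Suc k) (l - a)) (F k l) i" "inj_on i (topspace (fst (F (Suc k) (l - a))))"
      "pointed_hep (F (Suc k) (l - a)) (F k l) i"
      "quot k l = collapse (fst (F k l)) (i ` topspace (fst (F (Suc k) (l - a)))) (snd (F k l))"
      using F_cofibration[OF 3] .
    have "pointed_contractible (F (Suc k) (l - a))"
      using 3 a2 less.prems by (intro less.IH) auto
    then have "pointed_heq (F k l) (quot k l)"
      unfolding i(4) using i(1-3) less.prems
      by (intro collapse_contractible_heq pointed_space_F) auto
    moreover have "pointed_heq (quot k l) (smash (Fo (split_cut 0 k)) (quot 0 l))"
      using less.prems 3 by (intro quot_smash) auto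
    moreover have "pointed_contractible (smash (Fo (split_cut 0 k)) (quot 0 l))"
      using less.prems 3 a2
      by (intro smash_contractible contr pointed_space_ones pointed_space_quot) auto
    ultimately show ?thesis
      by (rule pointed_contractible_heq[OF pointed_heq_trans])
  qed
qed

lemma F_1_step:
  assumes "a \<le> l"
  shows "pointed_heq (F 1 l) (smash (Fo (split_cut 0 1)) (susp (F 1 (l - a))))"
proof -
  obtain i where i: "pointed_map (F 2 (l - a)) (F 1 l) i" "inj_on i (topspace (fst (F 2 (l - a))))"
    "pointed_hep (F 2 (l - a)) (F 1 l) i"
    "quot 1 l = collapse (fst (F 1 l)) (i ` topspace (fst (F 2 (l - a)))) (snd (F 1 l))"
    using F_cofibration[OF assms, of 1] by (auto simp: numeral_2_eq_2)
  obtain j where j: "pointed_map (F 1 (l - a)) (F 0 l) j" "inj_on j (topspace (fst (F 1 (l - a))))"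
    "pointed_hep (F 1 (l - a)) (F 0 l) j"
    "quot 0 l = collapse (fst (F 0 l)) (j ` topspace (fst (F 1 (l - a)))) (snd (F 0 l))"
    using F_cofibration[OF assms, of 0] by auto
  have sp: "pointed_space (F 1 (l - a))" "pointed_space (F 0 l)" "pointed_space (F 1 l)"
    "pointed_space (F 2 (l - a))" "pointed_space (quot 0 l)"
    using a2 assms by (auto intro!: pointed_space_F pointed_space_quot)
  have "pointed_heq (F 1 l) (quot 1 l)"
    unfolding i(4) using i(1-3) sp F_contractible_ge_2[of 2 "l - a"]
    by (intro collapse_contractible_heq) auto
  also have "pointed_heq (quot 1 l) (smash (Fo (split_cut 0 1)) (quot 0 l))"
    using assms by (intro quot_smash) auto
  also have "pointed_heq (smash (Fo (split_cut 0 1)) (quot 0 l))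
      (smash (Fo (split_cut 0 1)) (susp (F 1 (l - a))))"
  proof (intro smash_heq pointed_heq_refl pointed_space_susp sp pointed_space_ones)
    have "pointed_contractible (F 0 l)"
      using contr[of l] assms a2 by (simp add: block_cut_0)
    then show "pointed_heq (quot 0 l) (susp (F 1 (l - a)))"
      unfolding j(4) using j(1-3) sp by (intro collapse_heq_susp) auto
  qed simp_all
  finally show ?thesis .
qed

text \<open>The factor for \<open>(1^e)\<close> makes the starting value contractible, and
  \<open>F_1_step\<close> carries contractibility upwards through suspension and smash
  product.\<close>

lemma F_1_contractible:
  assumes "2 \<le> e" "e < a"
  shows "pointed_contractible (F 1 (a * m + e))"
proof (induction m)
  case 0
  have "pointed_contractible (smash (Fo (split_cut 0 1)) (Fo (split_cut 0 e)))"
    using assms by (intro smash_contractible_right contr pointed_space_ones) auto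
  then show ?case
    using F_heq_smash_small[of 1 e] assms by (auto intro: pointed_contractible_heq)
next
  case (Suc m)
  have "pointed_heq (F 1 (a * Suc m + e)) (smash (Fo (split_cut 0 1)) (susp (F 1 (a * m + e))))"
    using F_1_step[of "a * Suc m + e"] by simp
  then show ?case
    by (rule pointed_contractible_heq)
       (intro smash_contractible_right susp_contractible pointed_space_susp pointed_space_ones
          pointed_space_F Suc.IH; simp)
qed

text \<open>The start is the functor at \<open>(1)\<close> for \<open>e = 0\<close> and the smash
  square of that space for \<open>e = 1\<close>, so \<open>e + 1\<close> factors. Each
  \<open>F_1_step\<close> adds one factor and one suspension, and \<open>smash_susp_iter\<close>
  moves the suspensions to the outside.\<close>

lemma F_1_susp:
  assumes "e = 0 \<or> e = 1"
  shows "pointed_heq (F 1 (a * m + e)) (susp_iter m (smash_power (Fo (split_cut 0 1)) (m + e + 1)))"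
proof -
  let ?X = "Fo (split_cut 0 1)"
  have X: "pointed_space ?X" by (simp add: pointed_space_ones)
  have X1: "pointed_heq ?X (smash_power ?X 1)"
    using pointed_heq_relabel[OF X, of "\<lambda>x. [x]"] by (simp add: inj_def)
  show ?thesis
  proof (induction m)
    case 0
    have "pointed_heq (F 1 e) (smash_power ?X (Suc e))"
      using assms
    proof
      assume "e = 0"
      then show ?thesis using X1 by (simp add: F_no_ones)
    next
      assume e: "e = 1"
      have "pointed_heq (F 1 1) (smash ?X ?X)"
        using F_heq_smash_small[of 1 1] a2 by simp
      also have "pointed_heq (smash ?X ?X) (smash ?X (smash_power ?X (Suc 0)))"
        using X1 by (intro smash_heq pointed_heq_refl X pointed_space_smash_power) simp
      also have "pointed_heq \<dots> (smash_power ?X (Suc (Suc 0)))"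
        by (rule smash_power_Suc_heq[OF X])
      finally show ?thesis by (simp only: e One_nat_def)
    qed
    also have "pointed_heq (smash_power ?X (Suc e)) (susp_iter 0 (smash_power ?X (Suc e)))"
      by (intro susp_iter_0_heq pointed_space_smash_power X)
    finally show ?case by (simp only: mult_0_right add_0 Suc_eq_plus1)
  next
    case (Suc m)
    let ?P = "smash_power ?X (Suc (m + e))"
    have P: "pointed_space ?P" by (intro pointed_space_smash_power X)
    have "pointed_heq (F 1 (a * Suc m + e)) (smash ?X (susp (F 1 (a * m + e))))"
      using F_1_step[of "a * Suc m + e"] by simp
    also have "pointed_heq \<dots> (smash ?X (susp (susp_iter m ?P)))"
      using Suc.IH
      by (intro smash_heq susp_heq pointed_heq_refl pointed_space_susp pointed_space_susp_iter P X
          pointed_space_F) simp_all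
    also have "pointed_heq \<dots> (smash ?X (susp_iter (Suc m) ?P))"
      by (intro smash_heq susp_iter_Suc_heq pointed_heq_refl pointed_space_susp pointed_space_susp_iter P X)
    also have "pointed_heq \<dots> (susp_iter (Suc m) (smash ?X ?P))"
      by (rule smash_susp_iter[OF X P])
    also have "pointed_heq \<dots> (susp_iter (Suc m) (smash_power ?X (Suc (Suc (m + e)))))"
      by (intro susp_iter_heq smash_power_Suc_heq pointed_space_smash pointed_space_smash_power X)
    finally have "pointed_heq (F 1 (a * Suc m + e)) (susp_iter (Suc m) (smash_power ?X (Suc (Suc (m + e)))))" .
    moreover have "Suc m + e + 1 = Suc (Suc (m + e))" by simp
    ultimately show ?case by (simp only:)
  qed
qed

end

theorem theorem1p4p2:
  fixes Fo :: "int list set \<Rightarrow> 'a pointed"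
    and Fm :: "int list set \<Rightarrow> int list set \<Rightarrow> nat set list \<Rightarrow> 'a \<Rightarrow> 'a"
    and a k l m e :: nat
  assumes "resonance_functor Fo Fm"
    and "\<And>j. 2 \<le> j \<Longrightarrow> pointed_contractible (Fo (partition_cut (replicate j 1)))"
    and "2 \<le> a" and "1 \<le> k" and "1 \<le> l"
    and "l = a * m + e" and "e \<le> a - 1"
  shows "(k \<noteq> 1 \<or> 2 \<le> e \<longrightarrow>
      pointed_contractible (Fo (partition_cut (replicate k a @ replicate l 1)))) \<and>
    (k = 1 \<and> e \<in> {0, 1} \<longrightarrow>
      pointed_heq (Fo (partition_cut (replicate k a @ replicate l 1)))
        (susp_iter m (smash_power (Fo (partition_cut [1])) (m + e + 1))))"
proof -
  interpret contractible_resonance_functor Fo Fm a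
    using assms(1-3) by unfold_locales (simp_all add: split_cut_0)
  have one: "partition_cut [1] = split_cut 0 1"
    by (simp add: split_cut_0)
  have "pointed_contractible (F k l)" if "k \<noteq> 1 \<or> 2 \<le> e"
  proof (cases "2 \<le> k")
    case True
    then show ?thesis by (rule F_contractible_ge_2)
  next
    case False
    then have "k = 1" "2 \<le> e" "e < a" using that assms by auto
    then show ?thesis using F_1_contractible assms(6) by simp
  qed
  moreover have "pointed_heq (F k l) (susp_iter m (smash_power (Fo (split_cut 0 1)) (m + e + 1)))"
    if "k = 1 \<and> e \<in> {0, 1}"
    using that F_1_susp[of e m] assms(6) by auto
  ultimately show ?thesis
    unfolding partition_cut_block one by blast
qed

end
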